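(* Let $|q|<1$. Then \begin{align*} \sum_{i,j\geq 0}\frac{q^{\frac{1}{2}i^2-ij+j^2-\frac{3}{2}i+2j}}{(q;q)_i(q;q)_j} &=2q^{-1}\frac{(q^2;q^2)_\infty^4}{(q;q)_\infty^3 (q^4;q^4)_\infty},\\ \sum_{i,j\geq 0}\frac{q^{i^2-2ij+2j^2}}{(q^2;q^2)_i (q^2;q^2)_j} &=\frac{(q^2;q^2)_\infty^3 (q^3,q^5,q^8;q^8)_\infty}{(q;q)_\infty^2 (q^4;q^4)_\infty^2},\\ \sum_{i,j\geq 0}\frac{q^{\frac{1}{2}i^2-ij+j^2-\frac{1}{2}i+j}}{(q;q)_i (q;q)_j}&=2\frac{(q^2;q^2)_\infty (q^4;q^4)_\infty}{(q;q)_\infty^2},\\ \sum_{i,j\geq 0}\frac{q^{\frac{1}{2}i^2-ij+j^2+\frac{1}{2}i}}{(q;q)_i (q;q)_j} &=\frac{(q^2;q^2)_\infty^4}{(q;q)_\infty^3 (q^4;q^4)_\infty},\\ \sum_{i,j\geq 0} \frac{q^{i^2-2ij+2j^2+2j}}{(q^2;q^2)_i (q^2;q^2)_j} &=\frac{(q^2;q^2)_\infty^3 (q,q^7,q^8;q^8)_\infty}{(q;q)_\infty^2 (q^4;q^4)_\infty^2}. \end{align*} As a consequence, with $A=\begin{pmatrix} 1&-1\\-1&2\end{pmatrix}$, for each of the five triples $(B,C,N)$ given by $B=(-3/2,2)^{\mathrm T}, C=25/24, N=2304$; $B=(0,0)^{\mathrm T}, C=-5/96, N=9216$; $B=(-1/2,1)^{\mathrm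 T}, C=1/6, N=576$; $B=(1/2,0)^{\mathrm T}, C=1/24, N=2304$; $B=(0,1)^{\mathrm T}, C=19/96, N=9216$, the function $\tau\mapsto f_{A,B,C}(q^{\mathrm{denom}(C)})$ (with $q=e^{2\pi i\tau}$) is a modular function on $\Gamma_1(N)$.
   Context: Notation: $(a;q)_n=\prod_{k=0}^{n-1}(1-aq^k)$, $(a;q)_\infty=\prod_{k\ge0}(1-aq^k)$, $(a_1,\dots,a_m;q)_n=(a_1;q)_n\cdots(a_m;q)_n$. Fractional powers $q^{x}$ mean $e^{2\pi i x\tau}$ where $q=e^{2\pi i\tau}$, $\tau$ in the upper half-plane. For a positive definite symmetric rational $2\times2$ matrix $A$, a rational vector $B$ and rational scalar $C$, the Nahm sum is $f_{A,B,C}(q)=\sum_{n=(n_1,n_2)^{\mathrm T}\in\mathbb{Z}_{\ge0}^2}\frac{q^{\frac12 n^{\mathrm T}An+n^{\mathrm T}B+C}}{(q;q)_{n_1}(q;q)_{n_2}}$. $\mathrm{denom}(C)$ is the denominator of $C$ in lowest terms. $\Gamma_1(N)=\{\gamma\in\mathrm{SL}_2(\mathbb Z):\gamma\equiv\begin{pmatrix}1&*\\0&1\end{pmatrix}\pmod N\}$. *)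

theory Defs
  imports "HOL-Complex_Analysis.Complex_Analysis" "HOL-Number_Theory.Cong"
begin

definition qpoch :: "complex \<Rightarrow> complex \<Rightarrow> nat \<Rightarrow> complex" where
  "qpoch a q n = (\<Prod>k<n. 1 - a * q ^ k)"

definition qpoch_inf :: "complex \<Rightarrow> complex \<Rightarrow> complex" where
  "qpoch_inf a q = (\<Prod>k. 1 - a * q ^ k)"

text \<open>
  The power \<open>q\<^sup>x\<close> for rational \<open>x\<close>, where \<open>q = exp (2\<pi>i\<tau>)\<close>. The branch is determined by \<open>\<tau>\<close>, so
  functions involving fractional powers take \<open>\<tau>\<close> rather than \<open>q\<close> as their argument.
\<close>

definition qpow :: "complex \<Rightarrow> rat \<Rightarrow> complex" where
  "qpow \<tau> x = exp (2 * of_real pi * \<i> * of_rat x * \<tau>)"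

definition nahm_exponent :: "rat^2^2 \<Rightarrow> rat^2 \<Rightarrow> rat \<Rightarrow> rat^2 \<Rightarrow> rat" where
  "nahm_exponent A B C n =
     1 / 2 * (\<Sum>i\<in>UNIV. \<Sum>j\<in>UNIV. n $ i * A $ i $ j * n $ j) + (\<Sum>i\<in>UNIV. n $ i * B $ i) + C"

text \<open>
  The Nahm sum \<open>f\<^bsub>A,B,C\<^esub>\<close> as a function of \<open>\<tau>\<close>. It is meant for positive definite symmetric \<open>A\<close> and
  \<open>\<tau>\<close> in the upper half-plane, where the series converges absolutely.
  Substituting \<open>q\<^sup>m\<close> for \<open>q\<close> amounts to substituting \<open>m\<tau>\<close> for \<open>\<tau>\<close>.
\<close>

definition nahm_sum :: "rat^2^2 \<Rightarrow> rat^2 \<Rightarrow> rat \<Rightarrow> complex \<Rightarrow> complex" where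
  "nahm_sum A B C \<tau> =
     (\<Sum>\<^sub>\<infinity>(n1, n2) \<in> (UNIV :: (nat \<times> nat) set).
        qpow \<tau> (nahm_exponent A B C (vector [of_nat n1, of_nat n2]))
          / (qpoch (qpow \<tau> 1) (qpow \<tau> 1) n1 * qpoch (qpow \<tau> 1) (qpow \<tau> 1) n2))"

definition denom :: "rat \<Rightarrow> int" where
  "denom C = snd (quotient_of C)"

definition SL2Z :: "(int^2^2) set" where
  "SL2Z = {M. det M = 1}"

definition Gamma1 :: "nat \<Rightarrow> (int^2^2) set" where
  "Gamma1 N = {M \<in> SL2Z. [M $ 1 $ 1 = 1] (mod int N) \<and> [M $ 2 $ 1 = 0] (mod int N)
                 \<and> [M $ 2 $ 2 = 1] (mod int N)}"

definition mat_act :: "int^2^2 \<Rightarrow> complex \<Rightarrow> complex" where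
  "mat_act M = moebius (of_int (M $ 1 $ 1)) (of_int (M $ 1 $ 2)) (of_int (M $ 2 $ 1)) (of_int (M $ 2 $ 2))"

text \<open>
  Meromorphy at \<open>i\<infinity>\<close>: near \<open>i\<infinity>\<close>, \<open>g\<close> is a Laurent series with finite principal part in
  \<open>q\<^sup>1\<^sup>/\<^sup>h = exp (2\<pi>i\<tau>/h)\<close> for some positive integer \<open>h\<close>.
\<close>

definition meromorphic_at_ii_inf :: "(complex \<Rightarrow> complex) \<Rightarrow> bool" where
  "meromorphic_at_ii_inf g \<longleftrightarrow>
     (\<exists>h>0. \<exists>F. F meromorphic_on {0} \<and>
        (\<exists>Y>0. \<forall>\<tau>. Im \<tau> > Y \<longrightarrow> g \<tau> = F (qpow \<tau> (1 / of_nat h))))"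

text \<open>
  A modular function (of weight 0) on \<open>\<Gamma>\<close>: meromorphic on the upper half-plane, invariant under \<open>\<Gamma>\<close>,
  and meromorphic at every cusp. The cusps are the points \<open>\<gamma>(i\<infinity>)\<close> for \<open>\<gamma>\<close> in \<open>SL\<^sub>2(\<int>)\<close>.
  Nice meromorphy fixes the value at poles to be 0, so that pointwise invariance makes sense.
\<close>

definition modular_function :: "(int^2^2) set \<Rightarrow> (complex \<Rightarrow> complex) \<Rightarrow> bool" where
  "modular_function \<Gamma> f \<longleftrightarrow>
     f nicely_meromorphic_on {\<tau>. Im \<tau> > 0} \<and>
     (\<forall>\<gamma>\<in>\<Gamma>. \<forall>\<tau>. Im \<tau> > 0 \<longrightarrow> f (mat_act \<gamma> \<tau>) = f \<tau>) \<and>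
     (\<forall>\<gamma>\<in>SL2Z. meromorphic_at_ii_inf (\<lambda>\<tau>. f (mat_act \<gamma> \<tau>)))"

text \<open>
  Exponents such as \<open>i\<^sup>2/2 - ij + j\<^sup>2 - 3i/2 + 2j\<close> are integers; they are written with an exact integer
  division of \<open>i\<^sup>2 + ki\<close> by 2 for odd \<open>k\<close>.
\<close>

lemma half_exponent_exact:
  fixes i k :: int
  assumes "odd k"
  shows "real_of_int ((i\<^sup>2 + k * i) div 2) = 1 / 2 * (real_of_int i)\<^sup>2 + real_of_int k / 2 * real_of_int i"
proof -
  have "even (i\<^sup>2 + k * i)"
    using assms by simp
  then have "real_of_int ((i\<^sup>2 + k * i) div 2) = real_of_int (i\<^sup>2 + k * i) / 2"
    by (simp add: real_of_int_div)
  then show ?thesis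
    by (simp add: field_simps)
qed

end

(*
  Summing over i by Euler's identity turns identities 1, 3, 4 into Lebesgue's identity and identities
  2, 5 into the Goellnitz-Gordon identities. The latter follow from the Bailey pair with
  beta_n = 1 / (q; q)_n, a confluent q-Gauss summation and the Jacobi triple product.

  For modularity, all five products are, up to a constant and a power of q, of the form
  "product of theta_g(8 tau)^e_g over g", with theta_g = (q^g, q^(m-g); q^m)_inf and the e_g summing
  to -5. Multiplied by eta(8 tau)^(-10), such a product is a product of Klein forms at rational
  points. Klein forms transform with weight -1 under SL_2(Z), without any root of unity: two entire
  functions with the same quasi-periods and the same simple zeros are proportional, by Liouville.
  Since eta^(-10) is itself, up to a constant, a product of Klein forms at 2- and 3-torsion points,
  each Nahm sum is a product of Klein forms of total weight 0, and no Dedekind sums or theta inversion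
  formulas are needed.
*)
theory Submission
  imports Defs
begin

section \<open>Infinite q-Pochhammer symbols\<close>

text \<open>A Klein form at (g/m, 0) is, up to a constant and a power of the nome Q = q^8, theta_g /
  (Q;Q)_inf^2. Exponents with sum -5 thus bring in (Q;Q)_inf^10, which eta^(-10) removes, and the
  weights 5 and -5 cancel. The three nonzero 2-torsion points give eta^(-6), the four nonzero
  3-torsion points up to sign give eta^(-8), and -10 = 2 * (-8) - (-6). The products live modulo 8
  in q or, in the Goellnitz-Gordon cases, modulo 16 in q^(1/2). Both have nome q^8, hence the
  argument 8 tau. What remains is the cost of moving the points: translating a Klein form by an
  integer vector multiplies it by a sign and by a root of unity given by a symplectic pairing. The
  level N = 12 * 8 delta, with delta the denominator of C, makes all translations even, so the signs
  vanish: 8 delta comes from rescaling tau, and 12 = 2 * 6 from torsion of orders 2 and 3. The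
  pairing leaves two rational sums, checked for each product.\<close>

lemma qpoch_0 [simp]: "qpoch a q 0 = 1"
  by (simp add: qpoch_def)

lemma qpoch_Suc: "qpoch a q (Suc n) = qpoch a q n * (1 - a * q ^ n)"
  by (simp add: qpoch_def)

lemma qpoch_Suc_left: "qpoch a q (Suc n) = (1 - a) * qpoch (a * q) q n"
  unfolding qpoch_def by (subst prod.lessThan_Suc_shift) (simp add: mult.assoc)

lemma qpoch_add: "qpoch a q (m + n) = qpoch a q m * qpoch (a * q ^ m) q n"
  by (induction n) (simp_all add: qpoch_Suc power_add mult.assoc)

lemma qpoch_zero_left [simp]: "qpoch 0 q n = 1"
  by (simp add: qpoch_def)

lemma abs_convergent_qpoch:
  fixes a q :: complex
  assumes "norm q < 1"
  shows "abs_convergent_prod (\<lambda>k. 1 - a * q ^ k)"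
proof -
  have "summable (\<lambda>k. norm a * norm q ^ k)"
    using assms by (intro summable_mult summable_geometric) simp
  then show ?thesis
    by (subst abs_convergent_prod_conv_summable) (simp add: norm_mult norm_power)
qed

lemma convergent_qpoch: "norm q < 1 \<Longrightarrow> convergent_prod (\<lambda>k. 1 - a * q ^ k :: complex)"
  by (intro abs_convergent_prod_imp_convergent_prod abs_convergent_qpoch)

lemma qpoch_tendsto:
  assumes "norm q < 1"
  shows "qpoch a q \<longlonglongrightarrow> qpoch_inf a q"
proof -
  have "(\<lambda>n. \<Prod>i\<le>n. 1 - a * q ^ i) \<longlonglongrightarrow> qpoch_inf a q"
    unfolding qpoch_inf_def by (rule convergent_prod_LIMSEQ[OF convergent_qpoch[OF assms]])
  then have "(\<lambda>n. qpoch a q (Suc n)) \<longlonglongrightarrow> qpoch_inf a q"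
    by (simp add: qpoch_def lessThan_Suc_atMost)
  then show ?thesis
    by (rule LIMSEQ_imp_Suc)
qed

lemma qpoch_inf_zero_left [simp]: "qpoch_inf 0 q = 1"
  by (simp add: qpoch_inf_def)

lemma qpoch_inf_split:
  assumes "norm q < 1"
  shows "qpoch_inf a q = qpoch a q n * qpoch_inf (a * q ^ n) q"
proof (rule LIMSEQ_unique)
  show "(\<lambda>m. qpoch a q (m + n)) \<longlonglongrightarrow> qpoch_inf a q"
    by (rule LIMSEQ_ignore_initial_segment[OF qpoch_tendsto[OF assms]])
  show "(\<lambda>m. qpoch a q (m + n)) \<longlonglongrightarrow> qpoch a q n * qpoch_inf (a * q ^ n) q"
    by (subst add.commute, subst qpoch_add) (intro tendsto_intros qpoch_tendsto assms)
qed

lemma qpoch_inf_step: "norm q < 1 \<Longrightarrow> qpoch_inf a q = (1 - a) * qpoch_inf (a * q) q"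
  using qpoch_inf_split[of q a 1] by (simp add: qpoch_Suc)

lemma qpoch_inf_eq_0_iff:
  assumes "norm q < 1"
  shows "qpoch_inf a q = 0 \<longleftrightarrow> (\<exists>k. a * q ^ k = 1)"
proof
  assume "qpoch_inf a q = 0"
  then show "\<exists>k. a * q ^ k = 1"
    using prodinf_nonzero[OF convergent_qpoch[OF assms, of a]] unfolding qpoch_inf_def by auto
next
  assume "\<exists>k. a * q ^ k = 1"
  then obtain k where "a * q ^ k = 1" ..
  then have "qpoch a q (Suc k) = 0" by (simp add: qpoch_Suc)
  then show "qpoch_inf a q = 0"
    using qpoch_inf_split[OF assms, of a "Suc k"] by simp
qed

lemma power_neq_1_of_norm_less_1:
  fixes q :: complex
  assumes "norm q < 1" "n > 0"
  shows "q ^ n \<noteq> 1"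
proof
  assume "q ^ n = 1"
  then have "norm q ^ n = 1" by (metis norm_one norm_power)
  moreover have "norm q ^ n < 1" using assms by (simp add: power_less_one_iff)
  ultimately show False by simp
qed

lemma norm_power_less_1: "norm (q :: complex) < 1 \<Longrightarrow> n > 0 \<Longrightarrow> norm (q ^ n) < 1"
  by (simp add: norm_power power_less_one_iff)

lemma qpoch_inf_nonzero_power:
  assumes "norm q < 1" "m > 0" "n > 0"
  shows "qpoch_inf (q ^ m) (q ^ n) \<noteq> 0"
  using assms norm_power_less_1[of q n] power_neq_1_of_norm_less_1[of q]
  by (auto simp: qpoch_inf_eq_0_iff power_mult[symmetric] power_add[symmetric])

lemma qpoch_inf_nonzero [simp]: "norm q < 1 \<Longrightarrow> qpoch_inf q q \<noteq> 0"
  using qpoch_inf_nonzero_power[of q 1 1] by simp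

lemma qpoch_nonzero [simp]:
  assumes "norm q < 1"
  shows "qpoch q q n \<noteq> 0"
  using qpoch_inf_split[OF assms, of q n] qpoch_inf_nonzero[OF assms] by auto

lemma qpoch_inf_nonzero_small:
  assumes "norm q < 1" "norm a < 1"
  shows "qpoch_inf a q \<noteq> 0"
proof -
  have "a * q ^ k \<noteq> 1" for k
  proof
    assume "a * q ^ k = 1"
    then have "norm a * norm q ^ k = 1" by (metis norm_mult norm_one norm_power)
    moreover have "norm a * norm q ^ k \<le> norm a * 1"
      using assms by (intro mult_left_mono power_le_one) auto
    ultimately show False using assms by simp
  qed
  then show ?thesis by (simp add: qpoch_inf_eq_0_iff assms)
qed

lemma qpoch_inf_minus:
  assumes "norm q < 1"
  shows "qpoch_inf a q * qpoch_inf (- a) q = qpoch_inf (a\<^sup>2) (q\<^sup>2)"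
proof (rule LIMSEQ_unique)
  show "(\<lambda>n. qpoch a q n * qpoch (- a) q n) \<longlonglongrightarrow> qpoch_inf a q * qpoch_inf (- a) q"
    by (intro tendsto_intros qpoch_tendsto assms)
  have "qpoch a q n * qpoch (- a) q n = qpoch (a\<^sup>2) (q\<^sup>2) n" for n
    by (simp add: qpoch_def prod.distrib[symmetric] algebra_simps power2_eq_square power_mult_distrib)
  then show "(\<lambda>n. qpoch a q n * qpoch (- a) q n) \<longlonglongrightarrow> qpoch_inf (a\<^sup>2) (q\<^sup>2)"
    using qpoch_tendsto[OF norm_power_less_1[OF assms, of 2]] by simp
qed

text \<open>For a primitive cube root of unity w each factor satisfies (1 - x) (1 - w x) (1 - w^2 x)
  = 1 - x^3. This evaluates the product of the Klein forms at 3-torsion points.\<close>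

lemma qpoch_inf_cube_root:
  assumes "norm q < 1" "1 + w + w\<^sup>2 = 0"
  shows "qpoch_inf a q * qpoch_inf (w * a) q * qpoch_inf (w\<^sup>2 * a) q = qpoch_inf (a ^ 3) (q ^ 3)"
proof (rule LIMSEQ_unique)
  show "(\<lambda>n. qpoch a q n * qpoch (w * a) q n * qpoch (w\<^sup>2 * a) q n)
    \<longlonglongrightarrow> qpoch_inf a q * qpoch_inf (w * a) q * qpoch_inf (w\<^sup>2 * a) q"
    by (intro tendsto_intros qpoch_tendsto assms)
  have w: "w\<^sup>2 = - 1 - w" using assms(2) by algebra
  have "(1 - x) * (1 - w * x) * (1 - w\<^sup>2 * x) = 1 - x ^ 3" for x
    using assms(2) by algebra
  from this[of "a * q ^ k" for k]
  have "qpoch a q n * qpoch (w * a) q n * qpoch (w\<^sup>2 * a) q n = qpoch (a ^ 3) (q ^ 3) n" for n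
    by (simp add: qpoch_def prod.distrib[symmetric] mult.assoc power_mult_distrib power_mult[symmetric] mult.commute[of _ 3])
  then show "(\<lambda>n. qpoch a q n * qpoch (w * a) q n * qpoch (w\<^sup>2 * a) q n) \<longlonglongrightarrow> qpoch_inf (a ^ 3) (q ^ 3)"
    using qpoch_tendsto[OF norm_power_less_1[OF assms(1), of 3]] by simp
qed

lemma qpoch_dissect: "qpoch a q (m * n) = (\<Prod>r<m. qpoch (a * q ^ r) (q ^ m) n)"
proof (induction n)
  case (Suc n)
  have "qpoch a q (m * Suc n) = qpoch a q (m * n) * qpoch (a * q ^ (m * n)) q m"
    using qpoch_add[of a q "m * n" m] by (simp add: algebra_simps)
  also have "qpoch (a * q ^ (m * n)) q m = (\<Prod>r<m. 1 - a * q ^ r * (q ^ m) ^ n)"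
    by (simp add: qpoch_def mult_ac power_mult)
  finally show ?case by (simp add: Suc.IH qpoch_Suc prod.distrib)
qed simp

text \<open>Exponents are sorted by residue modulo m: exactly for \<open>qpoch a q (m * n)\<close>,
  then in the limit along multiples of m.\<close>

lemma qpoch_inf_dissect:
  assumes "norm q < 1" "m > 0"
  shows "qpoch_inf a q = (\<Prod>r<m. qpoch_inf (a * q ^ r) (q ^ m))"
proof (rule LIMSEQ_unique)
  have "strict_mono (\<lambda>n. m * n)" using assms by (simp add: strict_mono_def)
  from LIMSEQ_subseq_LIMSEQ[OF qpoch_tendsto[OF assms(1)] this]
  show "(\<lambda>n. qpoch a q (m * n)) \<longlonglongrightarrow> qpoch_inf a q" by (simp add: o_def)
  show "(\<lambda>n. qpoch a q (m * n)) \<longlonglongrightarrow> (\<Prod>r<m. qpoch_inf (a * q ^ r) (q ^ m))"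
    unfolding qpoch_dissect
    by (intro tendsto_prod qpoch_tendsto norm_power_less_1 assms)
qed

lemma qpoch_bounded:
  assumes "norm q < 1"
  obtains C where "C > 0" "\<And>n. norm (qpoch a q n) \<le> C"
  using qpoch_tendsto[OF assms, of a] convergent_imp_Bseq[of "qpoch a q"]
  unfolding convergent_def Bseq_def by blast

lemma inverse_qpoch_bounded:
  assumes "norm q < 1" "qpoch_inf a q \<noteq> 0"
  obtains C where "C > 0" "\<And>n. norm (1 / qpoch a q n) \<le> C"
proof -
  have "(\<lambda>n. 1 / qpoch a q n) \<longlonglongrightarrow> 1 / qpoch_inf a q"
    by (intro tendsto_intros qpoch_tendsto assms)
  then show ?thesis
    using that convergent_imp_Bseq[of "\<lambda>n. 1 / qpoch a q n"] unfolding convergent_def Bseq_def by blast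
qed

lemma qpoch_nonzeroI: "norm q < 1 \<Longrightarrow> qpoch_inf a q \<noteq> 0 \<Longrightarrow> qpoch a q n \<noteq> 0"
  using qpoch_inf_split[of q a n] by auto

text \<open>On a compact ball the n-th factor differs from 1 by at most B r^n, with r < 1 the
  maximum of |g|, so the partial products converge uniformly. Both arguments vary because three uses
  are made: entire in the elliptic variable, holomorphic in tau, and analytic in a local parameter
  at a cusp, where the base takes the value 0.\<close>

lemma holomorphic_qpoch_inf:
  assumes "open S" "f holomorphic_on S" "g holomorphic_on S" "\<And>z. z \<in> S \<Longrightarrow> norm (g z) < 1"
  shows "(\<lambda>z. qpoch_inf (f z) (g z)) holomorphic_on S"
proof (rule holomorphic_uniform_sequence[OF assms(1)])
  show "(\<lambda>z. qpoch (f z) (g z) n) holomorphic_on S" for n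
    unfolding qpoch_def by (intro holomorphic_intros assms)
  fix x assume "x \<in> S"
  then obtain d where d: "d > 0" "cball x d \<subseteq> S"
    using assms(1) open_contains_cball by blast
  define K where "K = cball x d"
  have K: "compact K" "K \<subseteq> S" "K \<noteq> {}" using d by (auto simp: K_def)
  have cont: "continuous_on K f" "continuous_on K g"
    using K assms holomorphic_on_imp_continuous_on continuous_on_subset by blast+
  obtain y where y: "y \<in> K" "\<And>z. z \<in> K \<Longrightarrow> norm (g z) \<le> norm (g y)"
    using continuous_attains_sup[OF K(1,3), of "\<lambda>z. norm (g z)"] cont continuous_on_norm by blast
  define r where "r = norm (g y)"
  have r: "r < 1" "r \<ge> 0" using y K assms(4) by (auto simp: r_def)
  obtain B where B: "\<And>z. z \<in> K \<Longrightarrow> norm (f z) \<le> B"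
    using compact_continuous_image[OF cont(1) K(1)] compact_imp_bounded bounded_iff by (metis imageI)
  have "uniformly_convergent_on K (\<lambda>N z. \<Prod>n<N. 1 + (- (f z * g z ^ n)))"
  proof (rule uniformly_convergent_on_prod)
    show "compact K" by fact
    show "continuous_on K (\<lambda>z. - (f z * g z ^ n))" for n by (intro continuous_intros cont)
    show "uniformly_convergent_on K (\<lambda>N z. \<Sum>n<N. norm (- (f z * g z ^ n)))"
    proof (rule Weierstrass_m_test')
      show "summable (\<lambda>n. B * r ^ n)" using r by (intro summable_mult summable_geometric) simp
      fix n z assume z: "z \<in> K"
      have "norm (f z) * norm (g z) ^ n \<le> B * r ^ n"
        using z B y r by (intro mult_mono power_mono) (auto simp: r_def intro: order_trans[OF norm_ge_zero])
      then show "norm (norm (- (f z * g z ^ n))) \<le> B * r ^ n" by (simp add: norm_mult norm_power)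
    qed
  qed
  then obtain l where l: "uniform_limit K (\<lambda>N z. qpoch (f z) (g z) N) l sequentially"
    by (auto simp: uniformly_convergent_on_def qpoch_def)
  have "l z = qpoch_inf (f z) (g z)" if "z \<in> K" for z
  proof (rule LIMSEQ_unique)
    show "qpoch (f z) (g z) \<longlonglongrightarrow> l z" using tendsto_uniform_limitI[OF l that] .
    show "qpoch (f z) (g z) \<longlonglongrightarrow> qpoch_inf (f z) (g z)" using that K assms(4) by (intro qpoch_tendsto) auto
  qed
  then have "uniform_limit K (\<lambda>N z. qpoch (f z) (g z) N) (\<lambda>z. qpoch_inf (f z) (g z)) sequentially"
    using l by (simp cong: uniform_limit_cong')
  with d show "\<exists>d>0. cball x d \<subseteq> S \<and> uniform_limit (cball x d) (\<lambda>N z. qpoch (f z) (g z) N) (\<lambda>z. qpoch_inf (f z) (g z)) sequentially"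
    unfolding K_def by blast
qed

section \<open>The identities of Euler, Lebesgue and Jacobi\<close>

lemma tannery_sequentially:
  fixes a :: "nat \<Rightarrow> nat \<Rightarrow> complex"
  assumes "\<And>k. (\<lambda>n. a k n) \<longlonglongrightarrow> b k" "\<And>k n. norm (a k n) \<le> M k" "summable M"
  shows "(\<lambda>n. \<Sum>k. a k n) \<longlonglongrightarrow> (\<Sum>k. b k)" "summable b"
proof -
  have *: "\<forall>\<^sub>F (k, n) in at_top \<times>\<^sub>F sequentially. norm (a k n) \<le> M k"
    using assms(2) by (intro always_eventually) auto
  note t = tannerys_theorem[OF assms(1) * assms(3)]
  show "(\<lambda>n. \<Sum>k. a k n) \<longlonglongrightarrow> (\<Sum>k. b k)" using t by simp
  show "summable b" using t summable_norm_cancel by auto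
qed

text \<open>Terms of the basic hypergeometric series 1phi1(c/b; c; q, b), with (c/b;q)_m b^m
  multiplied out so that b = 0 and c = 0 make sense.\<close>

definition phi11 :: "complex \<Rightarrow> complex \<Rightarrow> complex \<Rightarrow> nat \<Rightarrow> complex" where
  "phi11 b c q m = (\<Prod>k<m. (c * q ^ (2 * k) - b * q ^ k) / ((1 - q ^ Suc k) * (1 - c * q ^ k)))"

lemma phi11_Suc: "phi11 b c q (Suc m) =
   phi11 b c q m * ((c * q ^ (2 * m) - b * q ^ m) / ((1 - q ^ Suc m) * (1 - c * q ^ m)))"
  by (simp add: phi11_def)

lemma power_tendsto_0: "norm (q::complex) < 1 \<Longrightarrow> (\<lambda>n. q ^ n) \<longlonglongrightarrow> 0"
  by (rule LIMSEQ_power_zero)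

lemma summable_norm_phi11:
  assumes "norm q < 1"
  shows "summable (\<lambda>m. norm (phi11 b c q m))"
proof -
  have "(\<lambda>m. (c * q ^ (2 * m) - b * q ^ m) / ((1 - q ^ Suc m) * (1 - c * q ^ m))) \<longlonglongrightarrow>
         (c * 0 - b * 0) / ((1 - 0) * (1 - c * 0))"
    using norm_power_less_1[OF assms, of 2]
    by (intro tendsto_intros power_tendsto_0 LIMSEQ_Suc assms)
       (simp_all add: power_mult power_tendsto_0)
  then have "(\<lambda>m. norm ((c * q ^ (2 * m) - b * q ^ m) / ((1 - q ^ Suc m) * (1 - c * q ^ m)))) \<longlonglongrightarrow> 0"
    using tendsto_norm_zero by force
  then have "\<forall>\<^sub>F m in sequentially. norm ((c * q ^ (2 * m) - b * q ^ m) / ((1 - q ^ Suc m) * (1 - c * q ^ m))) < 1 / 2"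
    by (rule order_tendstoD) simp
  then obtain N where N: "\<And>m. m \<ge> N \<Longrightarrow> norm ((c * q ^ (2 * m) - b * q ^ m) / ((1 - q ^ Suc m) * (1 - c * q ^ m))) < 1 / 2"
    by (auto simp: eventually_sequentially)
  show ?thesis
  proof (rule summable_ratio_test[of "1/2" N])
    fix n assume "N \<le> n"
    from mult_left_mono[OF less_imp_le[OF N[OF this]], of "norm (phi11 b c q n)"]
    show "norm (norm (phi11 b c q (Suc n))) \<le> 1 / 2 * norm (norm (phi11 b c q n))"
      by (simp only: phi11_Suc norm_mult real_norm_def abs_mult abs_norm_cancel) (simp add: mult_ac)
  qed simp
qed

text \<open>Each numerator gains a factor q, and the denominators 1 - c q^k move to 1 - c q^(k+1),
  so their quotient telescopes.\<close>

lemma phi11_shift: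
  assumes "norm q < 1" "\<And>k. c * q ^ k \<noteq> 1"
  shows "phi11 (b * q) (c * q) q m = q ^ m * (1 - c) / (1 - c * q ^ m) * phi11 b c q m"
proof (induction m)
  case 0
  then show ?case using assms(2)[of 0] by (simp add: phi11_def)
next
  case (Suc m)
  have nz: "1 - c * q ^ m \<noteq> 0" "1 - c * q ^ Suc m \<noteq> 0" "1 - q ^ Suc m \<noteq> 0" "1 - c * (q * q ^ m) \<noteq> 0" "1 - q * q ^ m \<noteq> 0"
    using assms(2)[of m] assms(2)[of "Suc m"] power_neq_1_of_norm_less_1[OF assms(1), of "Suc m"]
    by auto
  show ?case
    unfolding phi11_Suc Suc.IH using nz
    by (simp add: divide_simps power_mult power2_eq_square[symmetric] power_even_eq)
       (simp add: algebra_simps power2_eq_square)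
qed

text \<open>The contiguous relation that mirrors splitting off the first factors of (b;q)_inf /
  (c;q)_inf. It is proved by creative telescoping.\<close>

lemma phi11_step:
  assumes "norm q < 1" "\<And>k. c * q ^ k \<noteq> 1"
  shows "(\<Sum>m. phi11 b c q m) = (1 - b) / (1 - c) * (\<Sum>m. phi11 (b * q) (c * q) q m)"
proof -
  define t t' where "t = phi11 b c q" and "t' = phi11 (b * q) (c * q) q"
  \<comment> \<open>The certificate: 1 - q^m makes it vanish at m = 0 and cancels the denominator 1
    - q^(m+1) of t (m+1). It tends to 0 because t does.\<close>
  define U where "U m = - (1 - q ^ m) * t m" for m
  have nz: "1 - c * q ^ m \<noteq> 0" "1 - q ^ Suc m \<noteq> 0" for m
    using assms(2)[of m] power_neq_1_of_norm_less_1[OF assms(1), of "Suc m"] by auto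
  have c1: "1 - c \<noteq> 0" using nz(1)[of 0] by simp
  have sm: "summable t" "summable t'"
    using summable_norm_phi11[OF assms(1)] by (auto simp: t_def t'_def intro: summable_norm_cancel)
  have "t m - (1 - b) / (1 - c) * t' m = U (Suc m) - U m" for m
  proof -
    have "t m - (1 - b) / (1 - c) * t' m = t m * (1 - (1 - b) * q ^ m / (1 - c * q ^ m))"
      unfolding t'_def phi11_shift[OF assms] t_def using c1 by (simp add: divide_simps) (simp add: algebra_simps)
    also have "\<dots> = t m * (- ((c * q ^ (2 * m) - b * q ^ m) / (1 - c * q ^ m)) + (1 - q ^ m))"
      using nz(1)[of m] by (simp add: divide_simps power_even_eq) (simp add: algebra_simps power2_eq_square)
    also have "\<dots> = U (Suc m) - U m"
      unfolding U_def t_def phi11_Suc using nz[of m] by (simp add: divide_simps) (simp add: algebra_simps)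
    finally show ?thesis .
  qed
  moreover have "(\<lambda>m. U (Suc m) - U m) sums (- (1 - 0) * 0 - U 0)"
    unfolding U_def
    by (intro telescope_sums tendsto_intros power_tendsto_0 assms summable_LIMSEQ_zero sm)
  ultimately have "(\<lambda>m. t m - (1 - b) / (1 - c) * t' m) sums 0"
    by (simp add: U_def)
  moreover have "(\<lambda>m. t m - (1 - b) / (1 - c) * t' m) sums (suminf t - (1 - b) / (1 - c) * suminf t')"
    by (intro sums_diff sums_mult summable_sums sm)
  ultimately have "suminf t - (1 - b) / (1 - c) * suminf t' = 0"
    using sums_unique2 by blast
  then show ?thesis by (simp add: t_def t'_def)
qed

text \<open>The confluent case of the q-Gauss summation; \<open>c = 0\<close> is Euler's identity.\<close>
lemma phi11_sums:
  assumes "norm q < 1" "qpoch_inf c q \<noteq> 0"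
  shows "phi11 b c q sums (qpoch_inf b q / qpoch_inf c q)"
proof -
  have nz: "c * q ^ k \<noteq> 1" for k using assms by (auto simp: qpoch_inf_eq_0_iff)
  have nzK: "(c * q ^ K) * q ^ k \<noteq> 1" for k K using nz[of "K + k"] by (simp add: power_add mult_ac)
  define F where "F K = (\<Sum>m. phi11 (b * q ^ K) (c * q ^ K) q m)" for K
  obtain C1 where C1: "C1 > 0" "\<And>n. norm (qpoch c q n) \<le> C1" using qpoch_bounded[OF assms(1)] by blast
  obtain C2 where C2: "C2 > 0" "\<And>n. norm (1 / qpoch c q n) \<le> C2" using inverse_qpoch_bounded[OF assms] by blast
  note qnz = qpoch_nonzeroI[OF assms]
  \<comment> \<open>Apart from q^(mK), the ratio to \<open>phi11 b c q m\<close> is bounded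
    uniformly in K and m, which is what dominated convergence requires.\<close>
  have tK: "phi11 (b * q ^ K) (c * q ^ K) q m =
     q ^ (m * K) * (qpoch c q K * qpoch c q m * (1 / qpoch c q (m + K))) * phi11 b c q m" for K m
  proof (induction K)
    case 0 then show ?case using qnz by simp
  next
    case (Suc K)
    have "c * q ^ (m + K) \<noteq> 1" by (rule nz)
    then show ?case
      using phi11_shift[OF assms(1) nzK[of K], of "b * q ^ K" m] qnz Suc.IH
      by (simp add: mult_ac qpoch_Suc power_add divide_simps)
  qed
  \<comment> \<open>For m > 0 the factor q^(mK) kills the term, so only the term m = 0, which is 1,
    survives.\<close>
  have "F \<longlonglongrightarrow> (\<Sum>m. if m = 0 then 1 else 0)"
    unfolding F_def
  proof (rule tannery_sequentially)
    show "summable (\<lambda>m. C1 * C1 * C2 * norm (phi11 b c q m))"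
      by (intro summable_mult summable_norm_phi11 assms)
    fix m K
    have "norm (q ^ (m * K) * (qpoch c q K * qpoch c q m * (1 / qpoch c q (m + K)))) \<le> 1 * (C1 * C1 * C2)"
      unfolding norm_mult using assms(1) C1 C2
      by (intro mult_mono) (auto simp: norm_power power_le_one intro: less_imp_le)
    then show "norm (phi11 (b * q ^ K) (c * q ^ K) q m) \<le> C1 * C1 * C2 * norm (phi11 b c q m)"
      unfolding tK by (subst norm_mult) (intro mult_right_mono, auto)
  next
    fix m
    show "(\<lambda>K. phi11 (b * q ^ K) (c * q ^ K) q m) \<longlonglongrightarrow> (if m = 0 then 1 else 0)"
    proof (cases "m = 0")
      case False
      have "(\<lambda>K. q ^ (m * K) * (qpoch c q K * qpoch c q m * (1 / qpoch c q (m + K))) * phi11 b c q m) \<longlonglongrightarrow>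
          0 * (qpoch_inf c q * qpoch c q m * (1 / qpoch_inf c q)) * phi11 b c q m"
        using False assms
        by (intro tendsto_intros qpoch_tendsto)
           (auto simp: power_mult add.commute[of m] intro!: power_tendsto_0 norm_power_less_1 LIMSEQ_ignore_initial_segment qpoch_tendsto)
      then show ?thesis unfolding tK using False by simp
    qed (simp add: phi11_def)
  qed
  also have "(\<Sum>m. if m = 0 then 1 else 0) = (1::complex)"
    using suminf_finite[of "{0}" "\<lambda>m. if m = 0 then 1 else (0::complex)"] by simp
  finally have F: "F \<longlonglongrightarrow> 1" .
  have F0: "F 0 = qpoch b q K / qpoch c q K * F K" for K
  proof (induction K)
    case (Suc K)
    have "F K = (1 - b * q ^ K) / (1 - c * q ^ K) * F (Suc K)"
      unfolding F_def using phi11_step[OF assms(1) nzK[of K], of "b * q ^ K"] by (simp add: mult_ac)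
    then show ?case using Suc by (simp add: qpoch_Suc)
  qed simp
  have "(\<lambda>K. qpoch b q K / qpoch c q K * F K) \<longlonglongrightarrow> qpoch_inf b q / qpoch_inf c q * 1"
    by (intro tendsto_intros qpoch_tendsto assms F)
  then have "(\<lambda>K. F 0) \<longlonglongrightarrow> qpoch_inf b q / qpoch_inf c q"
    unfolding F0[symmetric] by simp
  then have "F 0 = qpoch_inf b q / qpoch_inf c q" by (simp add: LIMSEQ_const_iff)
  moreover have "phi11 b c q sums F 0"
    unfolding F_def using summable_norm_phi11[OF assms(1)] by (auto intro: summable_sums summable_norm_cancel)
  ultimately show ?thesis by simp
qed

lemma Suc_choose_2: "Suc n choose 2 = (n choose 2) + n"
  by (simp add: numeral_2_eq_2)

lemma add_choose_2: "(m + n) choose 2 = (m choose 2) + (n choose 2) + m * n"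
  by (induction n) (simp_all add: Suc_choose_2)

lemma choose_2_square: "2 * (n choose 2) + n = n ^ 2"
  by (induction n) (simp_all add: Suc_choose_2 power2_eq_square)

lemma phi11_euler: "phi11 (- z) 0 q = (\<lambda>n. z ^ n * q ^ (n choose 2) / qpoch q q n)"
proof
  show "phi11 (- z) 0 q n = z ^ n * q ^ (n choose 2) / qpoch q q n" for n
    by (induction n) (simp_all add: phi11_def numeral_2_eq_2 qpoch_Suc power_add mult_ac)
qed

lemma euler_sums:
  assumes "norm q < 1"
  shows "(\<lambda>n. z ^ n * q ^ (n choose 2) / qpoch q q n) sums qpoch_inf (- z) q"
  using phi11_sums[OF assms, of 0 "- z"] by (simp add: phi11_euler)

text \<open>Lebesgue's identity by iteration: the sum satisfies F y = (1 + y q) F (y q^2), and as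
  the argument tends to 0 it becomes Euler's series for (-q;q)_inf. The hypothesis on y says that no
  1 + y q^k vanishes; the bounds and the certificate divide by such factors.\<close>

lemma lebesgue_sums:
  assumes "norm q < 1" "qpoch_inf (- y) q \<noteq> 0"
  shows "(\<lambda>n. qpoch (- y) q n * q ^ (Suc n choose 2) / qpoch q q n) sums
           (qpoch_inf (- (y * q)) (q\<^sup>2) * qpoch_inf (- q) q)"
proof -
  define t where "t y n = qpoch (- y) q n * q ^ (Suc n choose 2) / qpoch q q n" for y n
  define F where "F y = (\<Sum>n. t y n)" for y
  have nz: "y * q ^ k \<noteq> -1" for k using assms by (auto simp: qpoch_inf_eq_0_iff) (metis minus_equation_iff)
  obtain C1 where C1: "C1 > 0" "\<And>n. norm (qpoch (-y) q n) \<le> C1" using qpoch_bounded[OF assms(1)] by blast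
  obtain C2 where C2: "C2 > 0" "\<And>n. norm (1 / qpoch (-y) q n) \<le> C2" using inverse_qpoch_bounded[OF assms] by blast
  obtain C3 where C3: "C3 > 0" "\<And>n. norm (1 / qpoch q q n) \<le> C3"
    using inverse_qpoch_bounded[OF assms(1) qpoch_inf_nonzero[OF assms(1)]] by blast
  note qnz = qpoch_nonzeroI[OF assms]
  \<comment> \<open>(-y q^K;q)_n is a quotient of two initial products of (-y;q)_inf, hence bounded
    in K and n. The geometric decay comes from n <= (n+1 choose 2).\<close>
  have bound: "norm (t (y * q ^ K) n) \<le> C1 * C2 * C3 * norm q ^ n" for K n
  proof -
    have "qpoch (- (y * q ^ K)) q n = qpoch (- y) q (K + n) * (1 / qpoch (- y) q K)"
      using qnz[of K] by (simp add: qpoch_add)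
    then have "norm (t (y * q ^ K) n) = norm (qpoch (-y) q (K + n)) * norm (1 / qpoch (-y) q K) * norm (1 / qpoch q q n) * norm q ^ (Suc n choose 2)"
      by (simp add: t_def norm_mult norm_divide norm_power)
    also have "\<dots> \<le> C1 * C2 * C3 * norm q ^ n"
      using C1 C2 C3 assms(1)
      by (intro mult_mono power_decreasing) (auto simp: Suc_choose_2 intro: less_imp_le)
    finally show ?thesis .
  qed
  have smM: "summable (\<lambda>n. C1 * C2 * C3 * norm q ^ n)"
    using assms by (intro summable_mult summable_geometric) simp
  have sm: "summable (t (y * q ^ K))" for K
    using summable_comparison_test'[OF smM, of 0] bound by blast
  have step: "F (y * q ^ K) = (1 + y * q ^ K * q) * F (y * q ^ (K + 2))" for K
  proof -
    define x where "x = y * q ^ K"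
    \<comment> \<open>Certificate for the shift by q^2: again 1 - q^n gives the zero at n = 0 and
      cancels the new denominator of t x (n+1).\<close>
    define U where "U n = - (x / (1 + x)) * (1 - q ^ n) * t x n" for n
    have x1: "1 + x * q ^ k \<noteq> 0" for k
      using nz[of "K + k"] by (simp add: x_def power_add mult_ac add_eq_0_iff)
    have q1: "1 - q ^ Suc m \<noteq> 0" for m
      using power_neq_1_of_norm_less_1[OF assms(1), of "Suc m"] by auto
    have sh: "(1 + x * q) * t (x * q\<^sup>2) n = t x n * ((1 + x * q ^ n) * (1 + x * q * q ^ n) / (1 + x))" for n
    proof -
      have "(1 + x) * (1 + x * q) * qpoch (- (x * q\<^sup>2)) q n = qpoch (-x) q (Suc (Suc n))"
        by (subst qpoch_Suc_left, subst qpoch_Suc_left) (simp add: power2_eq_square mult_ac)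
      also have "\<dots> = qpoch (-x) q n * ((1 + x * q ^ n) * (1 + x * q * q ^ n))"
        by (simp add: qpoch_Suc mult_ac)
      finally have "(1 + x) * ((1 + x * q) * t (x * q\<^sup>2) n) = t x n * ((1 + x * q ^ n) * (1 + x * q * q ^ n))"
        by (simp add: t_def mult_ac)
      then show ?thesis using x1[of 0] by (simp add: field_simps)
    qed
    have tS: "t x (Suc n) = t x n * ((1 + x * q ^ n) * q ^ Suc n / (1 - q ^ Suc n))" for n
      by (simp add: t_def qpoch_Suc Suc_choose_2[of "Suc n"] power_add)
    have "t x n - (1 + x * q) * t (x * q\<^sup>2) n = U (Suc n) - U n" for n
    proof -
      have "t x n - (1 + x * q) * t (x * q\<^sup>2) n = t x n * (1 - (1 + x * q ^ n) * (1 + x * q * q ^ n) / (1 + x))"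
        unfolding sh by (simp add: algebra_simps)
      also have "\<dots> = t x n * (- (x / (1 + x)) * ((1 + x * q ^ n) * q ^ Suc n) + x / (1 + x) * (1 - q ^ n))"
        using x1[of 0] by (simp add: divide_simps) (simp add: algebra_simps)
      also have "\<dots> = U (Suc n) - U n"
        unfolding U_def tS using q1[of n] x1[of 0] by (simp add: divide_simps) (simp add: algebra_simps)
      finally show ?thesis .
    qed
    moreover have "(\<lambda>m. U (Suc m) - U m) sums (- (x / (1 + x)) * (1 - 0) * 0 - U 0)"
      unfolding U_def x_def
      by (intro telescope_sums tendsto_intros power_tendsto_0 assms summable_LIMSEQ_zero sm)
    ultimately have "(\<lambda>n. t x n - (1 + x * q) * t (x * q\<^sup>2) n) sums 0"
      by (simp add: U_def)
    moreover have "(\<lambda>n. t x n - (1 + x * q) * t (x * q\<^sup>2) n) sums (F x - (1 + x * q) * F (x * q\<^sup>2))"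
      unfolding F_def using sm[of K] sm[of "K + 2"]
      by (intro sums_diff sums_mult summable_sums) (simp_all only: x_def power_add mult.assoc)
    ultimately have "F x - (1 + x * q) * F (x * q\<^sup>2) = 0"
      using sums_unique2 by blast
    then show ?thesis by (simp only: x_def power_add mult.assoc) simp
  qed
  have q2: "norm (q\<^sup>2) < 1" by (rule norm_power_less_1[OF assms(1)]) simp
  have iter: "F y = qpoch (- (y * q)) (q\<^sup>2) K * F (y * q ^ (2 * K))" for K
  proof (induction K)
    case (Suc K)
    show ?case using Suc step[of "2 * K"] by (simp add: qpoch_Suc power_mult[symmetric])
  qed simp
  have "(\<lambda>K. F (y * q ^ K)) \<longlonglongrightarrow> (\<Sum>n. q ^ n * q ^ (n choose 2) / qpoch q q n)"
    unfolding F_def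
  proof (rule tannery_sequentially[OF _ bound smM])
    fix n
    have "(\<lambda>K. (\<Prod>k<n. 1 - (- (y * q ^ K)) * q ^ k) * q ^ (Suc n choose 2) / qpoch q q n) \<longlonglongrightarrow>
       (\<Prod>k<n. 1 - (- (y * 0)) * q ^ k) * q ^ (Suc n choose 2) / qpoch q q n"
      using assms by (intro tendsto_intros power_tendsto_0) auto
    then show "(\<lambda>K. t (y * q ^ K) n) \<longlonglongrightarrow> q ^ n * q ^ (n choose 2) / qpoch q q n"
      by (simp add: t_def qpoch_def Suc_choose_2 power_add mult_ac)
  qed
  then have "(\<lambda>K. F (y * q ^ K)) \<longlonglongrightarrow> qpoch_inf (- q) q"
    using euler_sums[OF assms(1), of q] by (simp add: sums_iff)
  then have "(\<lambda>K. F (y * q ^ (2 * K))) \<longlonglongrightarrow> qpoch_inf (- q) q"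
    using LIMSEQ_subseq_LIMSEQ[of "\<lambda>K. F (y * q ^ K)" _ "\<lambda>K. 2 * K"] by (simp add: strict_mono_def o_def)
  then have "(\<lambda>K. qpoch (- (y * q)) (q\<^sup>2) K * F (y * q ^ (2 * K))) \<longlonglongrightarrow> qpoch_inf (- (y * q)) (q\<^sup>2) * qpoch_inf (- q) q"
    by (intro tendsto_mult qpoch_tendsto q2)
  then have "F y = qpoch_inf (- (y * q)) (q\<^sup>2) * qpoch_inf (- q) q"
    unfolding iter[symmetric] by (simp add: LIMSEQ_const_iff)
  moreover have "t y sums F y" using sm[of 0] unfolding F_def by (simp add: summable_sums)
  ultimately show ?thesis by (simp add: t_def[abs_def])
qed

text \<open>For j = 1, ..., N the factor 1 - z / q^j is - z / q^j times 1 - q^j / z, and the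
  extracted exponents add up to N (N + 1) / 2.\<close>

lemma qpoch_reverse:
  assumes "q \<noteq> 0" "z \<noteq> 0"
  shows "qpoch (z / q ^ N) q N = (- z) ^ N / q ^ (Suc N choose 2) * qpoch (q / z) q N"
proof (induction N)
  case (Suc N)
  have "qpoch (z / q ^ Suc N) q (Suc N) = (1 - z / q ^ Suc N) * qpoch (z / q ^ N) q N"
    using assms by (subst qpoch_Suc_left) simp
  also have "(1 - z / q ^ Suc N) = (- z / q ^ Suc N) * (1 - q / z * q ^ N)"
    using assms by (simp add: field_simps)
  also have "\<dots> * qpoch (z / q ^ N) q N = (- z / q ^ Suc N) * ((- z) ^ N / q ^ (Suc N choose 2)) * qpoch (q / z) q (Suc N)"
    unfolding Suc.IH qpoch_Suc by (simp add: mult_ac)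
  also have "(- z / q ^ Suc N) * ((- z) ^ N / q ^ (Suc N choose 2)) = (- z) ^ Suc N / q ^ (Suc (Suc N) choose 2)"
    unfolding Suc_choose_2[of "Suc N"] power_add by simp
  finally show ?case .
qed (simp add: numeral_2_eq_2)

text \<open>In Euler's series for (z / q^N;q)_inf, index N is taken as the origin. After
  normalisation there, the series is a bilateral theta series cut off on the left, with weights
  tending to 1 / (q;q)_inf. Since z y = q, terms of negative index are powers of y. The conclusions
  fold the bilateral series by pairing n with -n-1 and n with -n; the Bailey pairs relative to q^2
  and to 1 lead to these two forms.\<close>

lemma jacobi_triple_product:
  assumes "norm q < 1" "z * y = q" "q \<noteq> 0"
  shows "(\<lambda>n. (- z) ^ n * q ^ (n choose 2) + (- y) ^ Suc n * q ^ (Suc n choose 2)) sums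
           (qpoch_inf z q * qpoch_inf y q * qpoch_inf q q)" (is ?th1)
    and "(\<lambda>n. if n = 0 then 1 else ((- z) ^ n + (- y) ^ n) * q ^ (n choose 2)) sums
           (qpoch_inf z q * qpoch_inf y q * qpoch_inf q q)" (is ?th2)
proof -
  obtain C where C: "C > 0" "\<And>n. norm (1 / qpoch q q n) \<le> C"
    using inverse_qpoch_bounded[OF assms(1) qpoch_inf_nonzero[OF assms(1)]] by blast
  have z: "z \<noteq> 0" and y: "y = q / z" using assms(2,3) by auto
  have sq: "N * N = N + 2 * (N choose 2)" for N :: nat
    using choose_2_square[of N] by (simp add: power2_eq_square)
  have smz: "summable (\<lambda>n. norm (x ^ n * q ^ (n choose 2)))" for x
  proof -
    obtain C' where C': "C' > 0" "\<And>n. norm (qpoch q q n) \<le> C'" using qpoch_bounded[OF assms(1)] by blast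
    have "norm (x ^ n * q ^ (n choose 2)) \<le> C' * norm (phi11 (- x) 0 q n)" for n
    proof -
      have "x ^ n * q ^ (n choose 2) = qpoch q q n * phi11 (- x) 0 q n"
        using assms by (simp add: phi11_euler)
      then show ?thesis using C'(2)[of n] by (simp add: norm_mult mult_right_mono)
    qed
    then show ?thesis
      by (intro summable_comparison_test'[OF summable_mult[OF summable_norm_phi11[OF assms(1), of "-x" 0], of C'], of 0]) simp
  qed
  define A where "A n = (- z) ^ n * q ^ (n choose 2)" for n
  define B where "B n = (- y) ^ Suc n * q ^ (Suc n choose 2)" for n
  \<comment> \<open>B n stands at bilateral index -(n+1), that is, at index N-1-n of Euler's series,
    which exists only for n < N. The value 0 beyond turns the finite sum into a series to which
    Tannery's theorem applies.\<close>
  define wB where "wB N n = (if n < N then 1 / qpoch q q (N - Suc n) else 0)" for N n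
  have fin: "(\<lambda>n. A n * (1 / qpoch q q (N + n))) sums (qpoch_inf z q * qpoch y q N - (\<Sum>n. B n * wB N n))" for N
  proof -
    define e where "e m = (- (z / q ^ N)) ^ m * q ^ (m choose 2) / qpoch q q m" for m
    \<comment> \<open>The numerator of the N-th term of \<open>e\<close>; dividing by it moves the
      origin of the summation to index N.\<close>
    define \<kappa> where "\<kappa> = (- z) ^ N * q ^ (N choose 2) / q ^ (N * N)"
    have \<kappa>: "\<kappa> \<noteq> 0" using z assms by (simp add: \<kappa>_def)
    have "N * N = (N choose 2) + (Suc N choose 2)" using sq[of N] by (simp add: Suc_choose_2)
    then have poch: "qpoch (z / q ^ N) q N = \<kappa> * qpoch y q N"
      using qpoch_reverse[OF assms(3) z, of N] assms(3) by (simp add: \<kappa>_def y power_add)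
    have "e sums qpoch_inf (z / q ^ N) q"
      unfolding e_def using euler_sums[OF assms(1), of "- (z / q ^ N)"] by simp
    also have "qpoch_inf (z / q ^ N) q = \<kappa> * (qpoch_inf z q * qpoch y q N)"
      using qpoch_inf_split[OF assms(1), of "z / q ^ N" N] poch assms(3) by simp
    finally have "(\<lambda>n. e (n + N)) sums (\<kappa> * (qpoch_inf z q * qpoch y q N) - (\<Sum>m<N. e m))"
      by (rule sums_split_initial_segment)
    then have "(\<lambda>n. e (n + N) / \<kappa>) sums ((\<kappa> * (qpoch_inf z q * qpoch y q N) - (\<Sum>m<N. e m)) / \<kappa>)"
      by (rule sums_divide)
    also have "(\<lambda>n. e (n + N) / \<kappa>) = (\<lambda>n. A n * (1 / qpoch q q (N + n)))"
      using z assms(3) qpoch_nonzero[OF assms(1)]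
      by (auto simp: fun_eq_iff e_def \<kappa>_def A_def add_choose_2 power_add power_minus[of "_ / _"] power_minus[of z]
           power_divide power_mult field_simps)
         (simp add: power_mult[symmetric] mult.commute)
    also have "((\<kappa> * (qpoch_inf z q * qpoch y q N) - (\<Sum>m<N. e m)) / \<kappa>) = qpoch_inf z q * qpoch y q N - (\<Sum>m<N. e m / \<kappa>)"
      using \<kappa> by (simp add: diff_divide_distrib sum_divide_distrib)
    also have "(\<Sum>m<N. e m / \<kappa>) = (\<Sum>n<N. e (N - Suc n) / \<kappa>)"
      by (rule sum.nat_diff_reindex[symmetric])
    also have "\<dots> = (\<Sum>n<N. B n * wB N n)"
    proof (rule sum.cong, goal_cases)
      case (2 n)
      then have "N = Suc n + (N - Suc n)" by simp
      then obtain p where p: "N = Suc n + p" by blast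
      define s where "s = Suc n"
      have N: "N = s + p" using p s_def by simp
      have "s + (s choose 2) + (N choose 2) + N * p = (p choose 2) + N * N"
        unfolding N add_choose_2 using sq[of s] by (simp add: algebra_simps)
      then have ex: "q ^ s * q ^ (s choose 2) * q ^ (N choose 2) * q ^ (N * p) = q ^ (p choose 2) * q ^ (N * N)"
        by (simp only: power_add[symmetric])
      have "(- y) ^ s * (- z) ^ N = ((- y) * (- z)) ^ s * (- z) ^ p"
        unfolding N power_add power_mult_distrib by simp
      then have yz: "(- y) ^ s * (- z) ^ N = q ^ s * (- z) ^ p"
        using assms(2) by (simp add: mult.commute)
      have "e p = (- z) ^ p * (q ^ (p choose 2) / q ^ (N * p)) / qpoch q q p"
        by (simp add: e_def power_minus[of "_ / _"] power_minus[of z] power_divide power_mult)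
      also have "q ^ (p choose 2) / q ^ (N * p) = q ^ s * q ^ (s choose 2) * q ^ (N choose 2) / q ^ (N * N)"
        using ex assms(3) by (simp add: frac_eq_eq)
      also have "(- z) ^ p * (q ^ s * q ^ (s choose 2) * q ^ (N choose 2) / q ^ (N * N)) =
          ((- y) ^ s * (- z) ^ N) * (q ^ (s choose 2) * q ^ (N choose 2) / q ^ (N * N))"
        unfolding yz by simp
      finally have "e p = B n * (1 / qpoch q q p) * \<kappa>"
        unfolding B_def \<kappa>_def s_def[symmetric] by (simp add: mult_ac)
      then show ?case using p \<kappa> by (simp add: wB_def)
    qed simp
    also have "\<dots> = (\<Sum>n. B n * wB N n)"
      by (rule suminf_finite[symmetric]) (auto simp: wB_def)
    finally show ?thesis .
  qed
  have smA: "summable (\<lambda>n. norm (A n))" and smB: "summable (\<lambda>n. norm (B n))"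
    using smz[of "-z"] summable_Suc_iff[of "\<lambda>n. norm ((-y) ^ n * q ^ (n choose 2))"] smz[of "-y"]
    by (simp_all only: A_def B_def)
  have lA: "(\<lambda>N. \<Sum>n. A n * (1 / qpoch q q (N + n))) \<longlonglongrightarrow> (\<Sum>n. A n * (1 / qpoch_inf q q))"
  proof (rule tannery_sequentially)
    show "summable (\<lambda>n. norm (A n) * C)" by (intro summable_mult2 smA)
    show "norm (A n * (1 / qpoch q q (N + n))) \<le> norm (A n) * C" for n N
      unfolding norm_mult by (intro mult_left_mono C) simp
    show "(\<lambda>N. A n * (1 / qpoch q q (N + n))) \<longlonglongrightarrow> A n * (1 / qpoch_inf q q)" for n
      by (intro tendsto_intros LIMSEQ_ignore_initial_segment qpoch_tendsto assms qpoch_inf_nonzero)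
  qed
  have lB: "(\<lambda>N. \<Sum>n. B n * wB N n) \<longlonglongrightarrow> (\<Sum>n. B n * (1 / qpoch_inf q q))"
  proof (rule tannery_sequentially)
    show "summable (\<lambda>n. norm (B n) * C)" by (intro summable_mult2 smB)
    show "norm (B n * wB N n) \<le> norm (B n) * C" for n N
      unfolding norm_mult using C by (intro mult_left_mono) (auto simp: wB_def)
    fix n
    have "(\<lambda>N. wB (N + Suc n) n) \<longlonglongrightarrow> 1 / qpoch_inf q q"
      unfolding wB_def using assms by (auto intro!: tendsto_intros qpoch_tendsto)
    then have "(\<lambda>N. wB N n) \<longlonglongrightarrow> 1 / qpoch_inf q q" by (rule LIMSEQ_offset)
    then show "(\<lambda>N. B n * wB N n) \<longlonglongrightarrow> B n * (1 / qpoch_inf q q)" by (intro tendsto_intros)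
  qed
  have "(\<lambda>N. qpoch_inf z q * qpoch y q N - (\<Sum>n. B n * wB N n)) \<longlonglongrightarrow>
     qpoch_inf z q * qpoch_inf y q - (\<Sum>n. B n * (1 / qpoch_inf q q))"
    by (intro tendsto_intros lB qpoch_tendsto assms)
  moreover have "(\<lambda>N. qpoch_inf z q * qpoch y q N - (\<Sum>n. B n * wB N n)) \<longlonglongrightarrow> (\<Sum>n. A n * (1 / qpoch_inf q q))"
    using lA fin by (simp add: sums_iff)
  ultimately have "(\<Sum>n. A n * (1 / qpoch_inf q q)) = qpoch_inf z q * qpoch_inf y q - (\<Sum>n. B n * (1 / qpoch_inf q q))"
    using LIMSEQ_unique by blast
  then have "suminf A * (1 / qpoch_inf q q) = qpoch_inf z q * qpoch_inf y q - suminf B * (1 / qpoch_inf q q)"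
    unfolding suminf_mult2[OF summable_norm_cancel[OF smA]] suminf_mult2[OF summable_norm_cancel[OF smB]] .
  then have "suminf A + suminf B = qpoch_inf z q * qpoch_inf y q * qpoch_inf q q"
    using qpoch_inf_nonzero[OF assms(1)] by (simp add: divide_simps)
  moreover have "(\<lambda>n. A n + B n) sums (suminf A + suminf B)"
    by (intro sums_add summable_sums summable_norm_cancel[OF smA] summable_norm_cancel[OF smB])
  ultimately show ?th1 by (simp add: A_def B_def)
  define g where "g n = (if n = 0 then 0 else (- y) ^ n * q ^ (n choose 2))" for n
  have "(\<lambda>n. g (Suc n)) = B" by (auto simp: g_def B_def fun_eq_iff)
  then have "(\<lambda>n. g (Suc n)) sums suminf B"
    using summable_sums[OF summable_norm_cancel[OF smB]] by simp
  then have "g sums suminf B" by (rule sums_Suc_imp[rotated]) (simp add: g_def)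
  from sums_add[OF summable_sums[OF summable_norm_cancel[OF smA]] this]
  have "(\<lambda>n. A n + g n) sums (qpoch_inf z q * qpoch_inf y q * qpoch_inf q q)"
    by (simp only: \<open>suminf A + suminf B = _\<close>)
  also have "(\<lambda>n. A n + g n) =
     (\<lambda>n. if n = 0 then 1 else ((- z) ^ n + (- y) ^ n) * q ^ (n choose 2))"
    by (auto simp: A_def g_def fun_eq_iff ring_distribs numeral_2_eq_2)
  finally show ?th2 .
qed

section \<open>Bailey pairs and the identities of Goellnitz and Gordon\<close>

text \<open>The Bailey pair relative to \<open>a\<close> with \<open>\<beta>\<^sub>n = 1 / (q; q)\<^sub>n\<close>, written so that \<open>a = 1\<close> causes no division by zero.\<close>
definition bailey_alpha :: "complex \<Rightarrow> complex \<Rightarrow> nat \<Rightarrow> complex" where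
  "bailey_alpha a q r = (case r of 0 \<Rightarrow> 1 | Suc s \<Rightarrow>
     (- a) ^ r * q ^ ((r choose 2) + r ^ 2) * (1 - a * q ^ (2 * r)) * qpoch (a * q) q s / qpoch q q r)"

text \<open>Creative telescoping for the recurrence \<open>(1 - q\<^sup>n) S(n) = S(n - 1)\<close> of the sum in \<open>bailey_pair\<close>.\<close>
lemma bailey_telescope:
  assumes "norm q < 1" "\<And>k. a * q ^ Suc k \<noteq> 1" "n = R + Suc k"
  shows "(\<Sum>r\<le>R. (1 - q ^ n) * (bailey_alpha a q r / (qpoch q q (n - r) * qpoch (a * q) q (n + r)))
            - bailey_alpha a q r / (qpoch q q (n - 1 - r) * qpoch (a * q) q (n - 1 + r))) =
         - (q ^ k) * ((- a) ^ Suc R * q ^ ((Suc R choose 2) + Suc R ^ 2) * qpoch (a * q) q R / qpoch q q R)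
           / (qpoch q q k * qpoch (a * q) q (n + R))"
  using assms(3)
proof (induction R arbitrary: k)
  case 0
  have nz: "qpoch q q m \<noteq> 0" for m using assms(1) by simp
  have nz': "qpoch (a * q) q m \<noteq> 0" for m using assms(2) by (auto simp: qpoch_def mult.assoc)
  have n: "n = Suc k" using 0 by simp
  have "1 - q * q ^ k \<noteq> 0" "1 - a * q * q ^ k \<noteq> 0"
    using power_neq_1_of_norm_less_1[OF assms(1), of "Suc k"] assms(2)[of k] by (auto simp: mult_ac)
  then show ?case
    using nz[of k] nz'[of k]
    by (simp add: n bailey_alpha_def qpoch_Suc numeral_2_eq_2 divide_simps)
next
  case (Suc R)
  have nz: "qpoch q q m \<noteq> 0" for m using assms(1) by simp
  have nz': "qpoch (a * q) q m \<noteq> 0" for m using assms(2) by (auto simp: qpoch_def mult.assoc)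
  \<comment> \<open>With x = q^(R+1) and u = q^(k+1), so that x u = q^n, the induction step becomes
    the rational identity \<open>id\<close> below.\<close>
  define x where "x = q ^ Suc R"
  define u where "u = q ^ Suc k"
  define D where "D = (- a) ^ Suc R * q ^ ((Suc R choose 2) + Suc R ^ 2) * qpoch (a * q) q R / qpoch q q R"
  define P where "P = qpoch q q k"
  define S where "S = qpoch (a * q) q (n + R)"
  have n: "n = Suc R + Suc k" "n - Suc R = Suc k" "n - 1 - Suc R = k" "n - 1 + Suc R = n + R" "n + Suc R = Suc (n + R)"
    using Suc.prems by auto
  have nz1: "1 - x \<noteq> 0" "1 - u \<noteq> 0" "1 - a * x\<^sup>2 * u \<noteq> 0"
  proof -
    show "1 - x \<noteq> 0" "1 - u \<noteq> 0" unfolding x_def u_def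
      using power_neq_1_of_norm_less_1[OF assms(1), of "Suc R"] power_neq_1_of_norm_less_1[OF assms(1), of "Suc k"] by auto
    have "x\<^sup>2 * u = q ^ Suc (n + R)"
      unfolding x_def u_def n power_mult[symmetric] power_add[symmetric]
      by (rule arg_cong[of _ _ "\<lambda>m. q ^ m"]) simp
    then show "1 - a * x\<^sup>2 * u \<noteq> 0" using assms(2)[of "n + R"] by (simp add: mult.assoc)
  qed
  have qn: "q ^ n = x * u" unfolding x_def u_def power_add[symmetric] n ..
  have qk: "q ^ Suc k = u" by (simp add: u_def)
  have pk: "qpoch q q (Suc k) = P * (1 - u)" by (simp add: qpoch_Suc P_def u_def)
  have sk: "qpoch (a * q) q (Suc (n + R)) = S * (1 - a * x\<^sup>2 * u)"
  proof -
    have "q * q ^ (n + R) = x\<^sup>2 * u"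
      unfolding x_def u_def n power_mult[symmetric] power_add[symmetric] power_Suc[symmetric]
      by (rule arg_cong[of _ _ "\<lambda>m. q ^ m"]) simp
    then show ?thesis by (simp add: qpoch_Suc S_def mult.assoc)
  qed
  have al: "bailey_alpha a q (Suc R) = D * (1 - a * x\<^sup>2) / (1 - x)"
    unfolding D_def bailey_alpha_def x_def
    by (simp add: qpoch_Suc power_mult[symmetric] mult_ac power2_eq_square power_add[symmetric])
       (simp add: mult_2_right)
  have "(Suc (Suc R) choose 2) + Suc (Suc R) ^ 2 = (Suc R choose 2) + Suc R ^ 2 + 3 * Suc R + 1"
    by (simp add: Suc_choose_2[of "Suc R"] power2_eq_square algebra_simps)
  then have dS: "(- a) ^ Suc (Suc R) * q ^ ((Suc (Suc R) choose 2) + Suc (Suc R) ^ 2) * qpoch (a * q) q (Suc R) / qpoch q q (Suc R)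
     = D * (- a) * x ^ 3 * q * (1 - a * x) / (1 - x)"
    unfolding D_def x_def
    by (simp add: qpoch_Suc power_mult[symmetric] mult_ac power2_eq_square power_add[symmetric])
       (simp add: power_add power_mult mult_ac power3_eq_cube)
  have IH: "(\<Sum>r\<le>R. (1 - q ^ n) * (bailey_alpha a q r / (qpoch q q (n - r) * qpoch (a * q) q (n + r)))
            - bailey_alpha a q r / (qpoch q q (n - 1 - r) * qpoch (a * q) q (n - 1 + r))) = - u * D / (P * (1 - u) * S)"
    using Suc.IH[of "Suc k"] Suc.prems unfolding D_def[symmetric] qk pk S_def[symmetric] by simp
  have PS: "P \<noteq> 0" "S \<noteq> 0" using nz nz' by (auto simp: P_def S_def)
  have id: "- u / (1 - u) + (1 - a * x\<^sup>2) / (1 - x) * ((1 - x * u) / ((1 - u) * (1 - a * x\<^sup>2 * u)) - 1)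
    = a * x ^ 3 * u * (1 - a * x) / ((1 - x) * (1 - a * x\<^sup>2 * u))"
    using nz1 by (simp add: divide_simps) (simp add: algebra_simps power2_eq_square power3_eq_cube)
  have "- u * D / (P * (1 - u) * S) +
     ((1 - x * u) * (D * (1 - a * x\<^sup>2) / (1 - x) / (P * (1 - u) * (S * (1 - a * x\<^sup>2 * u)))) - D * (1 - a * x\<^sup>2) / (1 - x) / (P * S))
     = D / (P * S) * (- u / (1 - u) + (1 - a * x\<^sup>2) / (1 - x) * ((1 - x * u) / ((1 - u) * (1 - a * x\<^sup>2 * u)) - 1))"
    using PS by (simp add: algebra_simps add_divide_distrib diff_divide_distrib)
  also have "\<dots> = - (q ^ k) * (D * (- a) * x ^ 3 * q * (1 - a * x) / (1 - x)) / (P * (S * (1 - a * x\<^sup>2 * u)))"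
    unfolding id using PS nz1 by (simp add: u_def mult_ac)
  finally show ?case
    unfolding sum.atMost_Suc IH[unfolded qn] dS n(2,3,4,5) qn pk al sk unfolding P_def[symmetric] S_def[symmetric] .
qed

lemma bailey_pair:
  assumes "norm q < 1" "\<And>k. a * q ^ Suc k \<noteq> 1"
  shows "(\<Sum>r\<le>n. bailey_alpha a q r / (qpoch q q (n - r) * qpoch (a * q) q (n + r))) = 1 / qpoch q q n"
proof (induction n)
  case (Suc n)
  have nz: "qpoch q q m \<noteq> 0" for m using assms(1) by simp
  have nz': "qpoch (a * q) q m \<noteq> 0" for m using assms(2) by (auto simp: qpoch_def mult.assoc)
  have nz1: "1 - q ^ Suc n \<noteq> 0" "1 - a * q ^ Suc (Suc (n + n)) \<noteq> 0"
    using power_neq_1_of_norm_less_1[OF assms(1), of "Suc n"] assms(2)[of "Suc (n + n)"] by auto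
  define T where "T m r = bailey_alpha a q r / (qpoch q q (m - r) * qpoch (a * q) q (m + r))" for m r
  have "(1 - q ^ Suc n) * (\<Sum>r\<le>Suc n. T (Suc n) r) - (\<Sum>r\<le>n. T n r)
     = (\<Sum>r\<le>n. (1 - q ^ Suc n) * T (Suc n) r - T n r) + (1 - q ^ Suc n) * T (Suc n) (Suc n)"
    by (simp add: sum_subtractf sum_distrib_left ring_distribs)
  also have "\<dots> = 0"
    \<comment> \<open>With k = 0 the telescoping covers r = 0, ..., n. Its boundary term cancels the
      extra summand r = n + 1 of the larger sum.\<close>
    using bailey_telescope[OF assms, of "Suc n" n 0] nz1 nz[of n] nz'[of "n + Suc n"]
    unfolding T_def
    by (simp add: bailey_alpha_def qpoch_Suc) (simp add: divide_simps mult_ac power_add power_mult power2_eq_square)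
  finally have "(1 - q ^ Suc n) * (\<Sum>r\<le>Suc n. T (Suc n) r) = 1 / qpoch q q n"
    using Suc.IH by (simp add: T_def)
  then show ?case
    unfolding T_def using nz1 nz[of n] by (simp add: qpoch_Suc field_simps)
qed (simp add: bailey_alpha_def)

text \<open>A geometric double series dominates f, so f is absolutely summable and both iterated
  sums equal the unordered sum. The first conclusion serves the double sums of the theorem, the
  second the interchange of summations for Bailey pairs.\<close>

lemma double_sums:
  fixes f :: "nat \<Rightarrow> nat \<Rightarrow> complex"
  assumes bound: "\<And>i j. norm (f i j) \<le> C * r ^ i * r ^ j" and r: "0 \<le> r" "r < 1"
    and g: "\<And>j. (\<lambda>i. f i j) sums g j" "g sums S"
  shows "((\<lambda>(i, j). f i j) has_sum S) UNIV"
    and "\<And>h. (\<And>i. (\<lambda>j. f i j) sums h i) \<Longrightarrow> h sums S"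
proof -
  have geo: "((\<lambda>n. r ^ n) has_sum (1 / (1 - r))) UNIV"
    using r by (intro norm_summable_imp_has_sum geometric_sums) (simp_all add: summable_geometric)
  have "(\<lambda>(i, j). C * r ^ i * r ^ j) summable_on (UNIV \<times> UNIV)"
  proof (rule summable_on_SigmaI)
    show "((\<lambda>j. case (i, j) of (i, j) \<Rightarrow> C * r ^ i * r ^ j) has_sum (C * r ^ i * (1 / (1 - r)))) UNIV" for i
      using has_sum_cmult_right[OF geo, of "C * r ^ i"] by simp
    show "(\<lambda>i. C * r ^ i * (1 / (1 - r))) summable_on UNIV"
      using has_sum_imp_summable[OF has_sum_cmult_left[OF has_sum_cmult_right[OF geo, of C], of "1 / (1 - r)"]] .
    show "0 \<le> (case (i, j) of (i, j) \<Rightarrow> C * r ^ i * r ^ j)" for i j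
      using order_trans[OF norm_ge_zero bound[of i j]] by simp
  qed
  then have abs: "(\<lambda>x. norm (case x of (i, j) \<Rightarrow> f i j)) summable_on (UNIV \<times> UNIV)"
    by (rule Infinite_Sum.abs_summable_on_comparison_test') (use bound in \<open>auto simp: mult.assoc\<close>)
  then obtain S' where S': "((\<lambda>(i, j). f i j) has_sum S') (UNIV \<times> UNIV)"
    using abs_summable_summable summable_on_def by blast
  then have S'': "((\<lambda>(j, i). f i j) has_sum S') (UNIV \<times> UNIV)"
    using has_sum_swap[of "\<lambda>(i, j). f i j" UNIV UNIV S'] by simp
  have "summable (\<lambda>i. norm (f i j))" for j
  proof (rule summable_comparison_test'[of "\<lambda>i. C * r ^ i * r ^ j" 0])
    show "summable (\<lambda>i. C * r ^ i * r ^ j)"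
      using r by (intro summable_mult summable_mult2 summable_geometric) simp
  qed (use bound in simp)
  moreover have "summable (\<lambda>j. norm (f i j))" for i
  proof (rule summable_comparison_test'[of "\<lambda>j. C * r ^ i * r ^ j" 0])
    show "summable (\<lambda>j. C * r ^ i * r ^ j)"
      using r by (intro summable_mult summable_geometric) simp
  qed (use bound in simp)
  ultimately have norm_sm: "summable (\<lambda>i. norm (f i j))" "summable (\<lambda>j. norm (f i j))" for i j by auto
  have "(g has_sum S') UNIV"
    by (rule has_sum_SigmaD[OF S''[unfolded case_prod_unfold]])
       (use g norm_sm in \<open>auto intro: norm_summable_imp_has_sum\<close>)
  then have "S' = S" using g(2) has_sum_imp_sums sums_unique2 by blast
  then show "((\<lambda>(i, j). f i j) has_sum S) UNIV" using S' by simp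
  fix h assume h: "\<And>i. (\<lambda>j. f i j) sums h i"
  have "(h has_sum S') UNIV"
    by (rule has_sum_SigmaD[OF S'[unfolded case_prod_unfold]])
       (use h norm_sm in \<open>auto intro: norm_summable_imp_has_sum\<close>)
  then show "h sums S" using \<open>S' = S\<close> has_sum_imp_sums by blast
qed

lemma norm_power_le_1:
  fixes a :: complex
  shows "norm a \<le> 1 \<Longrightarrow> norm (a ^ n) \<le> 1"
  by (simp add: norm_power power_le_one)

text \<open>The limiting case of Bailey's lemma in base q^2 with one parameter tending to infinity
  and the other equal to -q: write 1 / (q^2;q^2)_n through the Bailey pair, interchange the sums,
  and evaluate the inner sum over n >= r by the confluent q-Gauss summation.\<close>

lemma bailey_goellnitz_gordon:
  assumes "norm q < 1" "norm a \<le> 1"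
    and S: "(\<lambda>r. bailey_alpha a (q\<^sup>2) r * (a ^ r * q ^ (r\<^sup>2) * qpoch (- q) (q\<^sup>2) r * qpoch_inf (- (a * q ^ (2 * r + 1))) (q\<^sup>2)
              / qpoch_inf (a * q\<^sup>2) (q\<^sup>2))) sums S"
  shows "(\<lambda>n. a ^ n * q ^ (n\<^sup>2) * qpoch (- q) (q\<^sup>2) n / qpoch (q\<^sup>2) (q\<^sup>2) n) sums S"
proof -
  define p where "p = q\<^sup>2"
  have p: "norm p < 1" using norm_power_less_1[OF assms(1), of 2] by (simp add: p_def)
  have ap: "norm (a * p * p ^ k) < 1" for k
  proof -
    have "norm a * (norm p * norm p ^ k) \<le> 1 * norm p"
      using assms p by (intro mult_mono) (auto simp: mult_left_le power_le_one)
    then show ?thesis using p by (simp add: norm_mult norm_power mult.assoc)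
  qed
  have nza: "qpoch_inf (a * p) p \<noteq> 0"
    using ap by (auto simp: qpoch_inf_eq_0_iff[OF p]) (metis less_irrefl norm_one)
  obtain C1 where C1: "C1 > 0" "\<And>n. norm (qpoch (-q) p n) \<le> C1" using qpoch_bounded[OF p] by blast
  obtain C2 where C2: "C2 > 0" "\<And>n. norm (1 / qpoch (a * p) p n) \<le> C2" using inverse_qpoch_bounded[OF p nza] by blast
  obtain C3 where C3: "C3 > 0" "\<And>n. norm (1 / qpoch p p n) \<le> C3"
    using inverse_qpoch_bounded[OF p qpoch_inf_nonzero[OF p]] by blast
  obtain C4 where C4: "C4 > 0" "\<And>n. norm (qpoch (a * p) p n) \<le> C4" using qpoch_bounded[OF p] by blast
  have alpha_bound: "norm (bailey_alpha a p r) \<le> (1 + 2 * C4 * C3) * norm q ^ r" for r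
  proof (cases r)
    case 0
    then show ?thesis using C3 C4 by (simp add: bailey_alpha_def)
  next
    case (Suc s)
    have "norm (bailey_alpha a p r) = norm ((- a) ^ r) * norm (p ^ ((r choose 2) + r ^ 2)) * norm (1 - a * p ^ (2 * r)) * norm (qpoch (a * p) p s) * norm (1 / qpoch p p r)"
      by (simp add: Suc bailey_alpha_def norm_mult norm_divide)
    also have "\<dots> \<le> 1 * norm q ^ r * 2 * C4 * C3"
    proof (intro mult_mono C3 C4)
      show "norm ((- a) ^ r) \<le> 1" using assms by (intro norm_power_le_1) simp
      have "r \<le> 2 * ((r choose 2) + r ^ 2)" by (simp add: power2_eq_square Suc)
      then show "norm (p ^ ((r choose 2) + r ^ 2)) \<le> norm q ^ r"
        unfolding p_def norm_power power_mult[symmetric] using assms by (intro power_decreasing) auto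
      have "norm (a * p ^ (2 * r)) \<le> 1 * 1"
        unfolding norm_mult using assms p by (intro mult_mono norm_power_le_1) auto
      then show "norm (1 - a * p ^ (2 * r)) \<le> 2" using norm_triangle_ineq4[of 1 "a * p ^ (2 * r)"] by simp
    qed (use C4 C3 in \<open>auto intro: less_imp_le mult_nonneg_nonneg\<close>)
    also have "\<dots> \<le> (1 + 2 * C4 * C3) * norm q ^ r" by (simp add: algebra_simps)
    finally show ?thesis .
  qed
  \<comment> \<open>The zero part, r > n, turns the triangular double sum into one over all pairs,
    as the interchange lemma expects.\<close>
  define f where "f n r = (if r \<le> n then a ^ n * q ^ (n\<^sup>2) * qpoch (- q) p n *
      (bailey_alpha a p r / (qpoch p p (n - r) * qpoch (a * p) p (n + r))) else 0)" for n r
  define h where "h n = a ^ n * q ^ (n\<^sup>2) * qpoch (- q) p n / qpoch p p n" for n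
  have "h sums S"
  proof (rule double_sums(2)[where f = f])
    show "0 \<le> norm q" "norm q < 1" using assms by auto
    fix n r
    show "norm (f n r) \<le> (C1 * (1 + 2 * C4 * C3) * C3 * C2) * norm q ^ n * norm q ^ r"
    proof (cases "r \<le> n")
      case True
      have "norm (f n r) = norm (a ^ n) * norm (q ^ (n\<^sup>2)) * norm (qpoch (- q) p n) *
           norm (bailey_alpha a p r) * norm (1 / qpoch p p (n - r)) * norm (1 / qpoch (a * p) p (n + r))"
        using True by (simp add: f_def norm_mult norm_divide)
      also have "\<dots> \<le> 1 * norm q ^ n * C1 * ((1 + 2 * C4 * C3) * norm q ^ r) * C3 * C2"
      proof (intro mult_mono C1 C2 C3 alpha_bound)
        show "norm (a ^ n) \<le> 1" using assms by (intro norm_power_le_1) simp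
        show "norm (q ^ n\<^sup>2) \<le> norm q ^ n"
          unfolding norm_power using assms by (intro power_decreasing) (auto simp: power2_eq_square)
      qed (use C1 C4 C3 C2 in \<open>auto intro!: mult_nonneg_nonneg add_nonneg_nonneg intro: less_imp_le\<close>)
      finally show ?thesis by (simp add: mult_ac)
    next
      case False
      then show ?thesis using C1 C4 C3 C2 by (auto simp: f_def intro!: mult_nonneg_nonneg add_nonneg_nonneg intro: less_imp_le)
    qed
  next
    fix n
    have "(\<lambda>r. f n r) sums (\<Sum>r\<le>n. f n r)"
      by (rule sums_finite) (auto simp: f_def)
    also have "(\<Sum>r\<le>n. f n r) = a ^ n * q ^ (n\<^sup>2) * qpoch (- q) p n * (\<Sum>r\<le>n. bailey_alpha a p r / (qpoch p p (n - r) * qpoch (a * p) p (n + r)))"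
      by (simp add: f_def sum_distrib_left)
    also have "\<dots> = h n"
    proof (subst bailey_pair[OF p])
      show "a * p ^ Suc k \<noteq> 1" for k using ap[of k] by (auto simp: mult.assoc)
    qed (simp add: h_def)
    finally show "(\<lambda>r. f n r) sums h n" .
  next
    fix r
    \<comment> \<open>With n = m + r the sum over m is a 1phi1 series with lower parameter c. Its
      upper parameter c / b = - q p^r comes from (-q;p)_(m+r), and c itself from (a
      p;p)_(m+2r).\<close>
    define c where "c = a * p ^ (2 * r + 1)"
    define b where "b = - (a * q ^ (2 * r + 1))"
    have qs: "qpoch_inf (a * p) p = qpoch (a * p) p (2 * r) * qpoch_inf c p"
      using qpoch_inf_split[OF p, of "a * p" "2 * r"] by (simp add: c_def mult_ac)
    have nzc: "qpoch_inf c p \<noteq> 0" using qs nza by auto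
    have nzr: "qpoch (a * p) p m \<noteq> 0" for m using qpoch_nonzeroI[OF p nza] .
    define K where "K = a ^ r * q ^ (r\<^sup>2) * qpoch (- q) p r * bailey_alpha a p r / qpoch (a * p) p (2 * r)"
    have ph: "phi11 b c p m = a ^ m * q ^ (m\<^sup>2 + 2 * r * m) * qpoch (- q * p ^ r) p m / (qpoch p p m * qpoch c p m)" for m
    proof (induction m)
      case (Suc m)
      have e: "c * p ^ (2 * m) - b * p ^ m = a * q ^ (2 * r + 2 * m + 1) * (1 - (- q * p ^ r) * p ^ m)"
        by (simp add: c_def b_def p_def algebra_simps power_mult[symmetric] power_add[symmetric])
      have e2: "q ^ (m\<^sup>2 + 2 * r * m) * q ^ (2 * r + 2 * m + 1) = q ^ ((Suc m)\<^sup>2 + 2 * r * Suc m)"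
        unfolding power_add[symmetric] by (rule arg_cong[of _ _ "\<lambda>n. q ^ n"]) (simp add: power2_eq_square algebra_simps)
      show ?case unfolding phi11_Suc Suc.IH e e2[symmetric] by (simp add: qpoch_Suc mult_ac)
    qed (simp add: phi11_def)
    have fm: "f (m + r) r = K * phi11 b c p m" for m
    proof -
      have "(m + r)\<^sup>2 = r\<^sup>2 + (m\<^sup>2 + 2 * r * m)" by (simp add: power2_eq_square algebra_simps)
      then have e: "q ^ ((m + r)\<^sup>2) = q ^ (r\<^sup>2) * q ^ (m\<^sup>2 + 2 * r * m)" by (simp only: power_add)
      have mrr: "m + r + r = 2 * r + m" by simp
      then have e2: "qpoch (a * p) p (m + r + r) = qpoch (a * p) p (2 * r) * qpoch c p m"
        using qpoch_add[of "a * p" p "2 * r" m] unfolding mrr by (simp add: c_def mult_ac)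
      have e3: "qpoch (- q) p (m + r) = qpoch (- q) p r * qpoch (- q * p ^ r) p m"
        using qpoch_add[of "- q" p r m] by (simp add: add.commute)
      show ?thesis unfolding f_def ph K_def e e2 e3 by (simp add: power_add mult_ac)
    qed
    have "(\<lambda>m. K * phi11 b c p m) sums (K * (qpoch_inf b p / qpoch_inf c p))"
      by (intro sums_mult phi11_sums p nzc)
    then have "(\<lambda>n. f n r) sums (K * (qpoch_inf b p / qpoch_inf c p) + (\<Sum>n<r. f n r))"
      unfolding fm[symmetric] by (subst (asm) sums_iff_shift)
    also have "(\<Sum>n<r. f n r) = 0" by (simp add: f_def)
    also have "K * (qpoch_inf b p / qpoch_inf c p) + 0 =
        bailey_alpha a p r * (a ^ r * q ^ (r\<^sup>2) * qpoch (- q) p r * qpoch_inf b p / qpoch_inf (a * p) p)"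
      unfolding qs K_def by simp
    finally show "(\<lambda>n. f n r) sums (bailey_alpha a p r * (a ^ r * q ^ (r\<^sup>2) * qpoch (- q) p r * qpoch_inf b p / qpoch_inf (a * p) p))" .
    show "(\<lambda>r. bailey_alpha a p r * (a ^ r * q ^ (r\<^sup>2) * qpoch (- q) p r * qpoch_inf (- (a * q ^ (2 * r + 1))) p / qpoch_inf (a * p) p)) sums S"
      using S by (simp only: p_def)
  qed
  then show ?thesis by (simp only: h_def[abs_def] p_def)
qed

text \<open>For a = 1 the factor 1 - p^r cancels in the Bailey pair, leaving 1 + p^r. The r-th term
  is then (-1)^r (q^(4r^2-r) + q^(4r^2+r)) up to a factor independent of r, which is the theta
  series with base q^8 folded by pairing r with -r.\<close>

lemma goellnitz_gordon_1:
  assumes "norm q < 1" "q \<noteq> 0"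
  shows "(\<lambda>n. q ^ (n\<^sup>2) * qpoch (- q) (q\<^sup>2) n / qpoch (q\<^sup>2) (q\<^sup>2) n) sums
           (qpoch_inf (- q) (q\<^sup>2) / qpoch_inf (q\<^sup>2) (q\<^sup>2) *
             (qpoch_inf (q ^ 3) (q ^ 8) * qpoch_inf (q ^ 5) (q ^ 8) * qpoch_inf (q ^ 8) (q ^ 8)))"
proof -
  define P where "P = qpoch_inf (q ^ 3) (q ^ 8) * qpoch_inf (q ^ 5) (q ^ 8) * qpoch_inf (q ^ 8) (q ^ 8)"
  define p where "p = q\<^sup>2"
  have p: "norm p < 1" unfolding p_def using norm_power_less_1[OF assms(1), of 2] by simp
  define c where "c n = (if n = 0 then 1 else ((- (q ^ 3)) ^ n + (- (q ^ 5)) ^ n) * (q ^ 8) ^ (n choose 2))" for n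
  have "c sums P"
    unfolding c_def P_def using assms norm_power_less_1[of q 8]
    by (intro jacobi_triple_product(2)) (auto simp: power_add[symmetric])
  then have "(\<lambda>r. qpoch_inf (- q) p / qpoch_inf p p * c r) sums (qpoch_inf (- q) p / qpoch_inf p p * P)"
    by (rule sums_mult)
  also have "(\<lambda>r. qpoch_inf (- q) p / qpoch_inf p p * c r) =
    (\<lambda>r. bailey_alpha 1 p r * (1 ^ r * q ^ (r\<^sup>2) * qpoch (- q) p r * qpoch_inf (- (1 * q ^ (2 * r + 1))) p
              / qpoch_inf (1 * p) p))"
  proof
    fix r
    have e: "- q * p ^ r = - (1 * q ^ (2 * r + 1))" by (simp add: p_def power_mult)
    have 1: "qpoch_inf (- q) p = qpoch (- q) p r * qpoch_inf (- (1 * q ^ (2 * r + 1))) p"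
      by (subst qpoch_inf_split[OF p, of "- q" r], subst e) (rule refl)
    have 2: "c r = bailey_alpha 1 p r * q ^ (r\<^sup>2)"
    proof (cases r)
      case (Suc s)
      have "1 - p ^ r \<noteq> 0" using power_neq_1_of_norm_less_1[OF p, of r] Suc by auto
      moreover have "qpoch p p s \<noteq> 0" using p by simp
      moreover have "qpoch p p r = qpoch p p s * (1 - p ^ r)" by (simp add: Suc qpoch_Suc)
      moreover have "1 - p ^ (2 * r) = (1 - p ^ r) * (1 + p ^ r)"
        by (simp add: power_mult power2_eq_square algebra_simps power_even_eq)
      ultimately have al: "bailey_alpha 1 p r = (- 1) ^ r * p ^ ((r choose 2) + r ^ 2) * (1 + p ^ r)"
        by (simp add: bailey_alpha_def Suc divide_simps)
      define e where "e = (r choose 2) + r ^ 2"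
      have "(- 1) ^ r * p ^ e * (1 + p ^ r) * q ^ (r\<^sup>2) = (- 1) ^ r * (q ^ (2 * e + r\<^sup>2) + q ^ (2 * e + 2 * r + r\<^sup>2))"
        unfolding p_def power_mult[symmetric] by (simp add: ring_distribs power_add mult_ac)
      then have "bailey_alpha 1 p r * q ^ (r\<^sup>2) = (- 1) ^ r * (q ^ (2 * ((r choose 2) + r ^ 2) + r\<^sup>2) + q ^ (2 * ((r choose 2) + r ^ 2) + 2 * r + r\<^sup>2))"
        unfolding al e_def .
      also have "2 * ((r choose 2) + r ^ 2) + r\<^sup>2 = 3 * r + 8 * (r choose 2)"
        using choose_2_square[of r] by simp
      also have "2 * ((r choose 2) + r ^ 2) + 2 * r + r\<^sup>2 = 5 * r + 8 * (r choose 2)"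
        using choose_2_square[of r] by simp
      also have "(- 1) ^ r * (q ^ (3 * r + 8 * (r choose 2)) + q ^ (5 * r + 8 * (r choose 2))) = c r"
        unfolding c_def power_minus[of "_ ^ _"] power_add power_mult by (simp add: Suc ring_distribs)
      finally show ?thesis ..
    qed (simp add: c_def bailey_alpha_def)
    show "qpoch_inf (- q) p / qpoch_inf p p * c r =
         bailey_alpha 1 p r * (1 ^ r * q ^ (r\<^sup>2) * qpoch (- q) p r * qpoch_inf (- (1 * q ^ (2 * r + 1))) p / qpoch_inf (1 * p) p)"
      unfolding 1 2 by simp
  qed
  finally have "(\<lambda>n. 1 ^ n * q ^ (n\<^sup>2) * qpoch (- q) p n / qpoch p p n) sums
      (qpoch_inf (- q) p / qpoch_inf p p * P)"
    unfolding p_def by (intro bailey_goellnitz_gordon assms) simp_all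
  then show ?thesis by (simp add: p_def P_def)
qed

text \<open>For a = p the tail of (-q;q^2)_inf in the r-th term lacks the factor 1 + q^(2r+1). It is
  supplied by 1 - p^(2r+1) = (1 - q^(2r+1)) (1 + q^(2r+1)) from the Bailey pair. The remaining 1 -
  q^(2r+1) splits the term into the bilateral indices r and -r-1.\<close>

lemma goellnitz_gordon_2:
  assumes "norm q < 1" "q \<noteq> 0"
  shows "(\<lambda>n. q ^ (n\<^sup>2 + 2 * n) * qpoch (- q) (q\<^sup>2) n / qpoch (q\<^sup>2) (q\<^sup>2) n) sums
           (qpoch_inf (- q) (q\<^sup>2) / qpoch_inf (q\<^sup>2) (q\<^sup>2) *
             (qpoch_inf q (q ^ 8) * qpoch_inf (q ^ 7) (q ^ 8) * qpoch_inf (q ^ 8) (q ^ 8)))"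
proof -
  define P where "P = qpoch_inf q (q ^ 8) * qpoch_inf (q ^ 7) (q ^ 8) * qpoch_inf (q ^ 8) (q ^ 8)"
  define p where "p = q\<^sup>2"
  have p: "norm p < 1" unfolding p_def using norm_power_less_1[OF assms(1), of 2] by simp
  have p1: "1 - p \<noteq> 0" using p by auto
  define c where "c n = (- (q ^ 7)) ^ n * (q ^ 8) ^ (n choose 2) + (- q) ^ Suc n * (q ^ 8) ^ (Suc n choose 2)" for n
  have "c sums P"
    unfolding c_def P_def mult.commute[of "qpoch_inf q (q ^ 8)"] using assms norm_power_less_1[of q 8]
    by (intro jacobi_triple_product(1)) (auto simp: power_Suc2[symmetric] simp del: power_Suc)
  then have "(\<lambda>r. qpoch_inf (- q) p / qpoch_inf p p * c r) sums (qpoch_inf (- q) p / qpoch_inf p p * P)"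
    by (rule sums_mult)
  also have "(\<lambda>r. qpoch_inf (- q) p / qpoch_inf p p * c r) =
    (\<lambda>r. bailey_alpha p p r * (p ^ r * q ^ (r\<^sup>2) * qpoch (- q) p r * qpoch_inf (- (p * q ^ (2 * r + 1))) p
              / qpoch_inf (p * p) p))"
  proof
    fix r
    define x where "x = q ^ (2 * r + 1)"
    define X where "X = qpoch_inf (- (p * x)) p"
    have pr: "p ^ r = q ^ (2 * r)" by (simp add: p_def power_mult)
    have e: "- q * p ^ Suc r = - (p * x)" "1 - - q * p ^ r = 1 + x"
      unfolding power_Suc pr x_def by (simp_all add: mult_ac)
    have 1: "qpoch_inf (- q) p = qpoch (- q) p r * (1 + x) * X"
      unfolding X_def e[symmetric] qpoch_Suc[symmetric] by (rule qpoch_inf_split[OF p])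
    have 3: "qpoch_inf p p = (1 - p) * qpoch_inf (p * p) p" by (rule qpoch_inf_step[OF p])
    have nz: "qpoch_inf (p * p) p \<noteq> 0" using 3 p by auto
    have 2: "(1 + x) * c r = (1 - p) * (bailey_alpha p p r * (p ^ r * q ^ (r\<^sup>2)))"
    proof -
      have "(1 - p) * bailey_alpha p p r = (- p) ^ r * p ^ ((r choose 2) + r ^ 2) * (1 - p ^ (2 * r + 1))"
      proof (cases r)
        case (Suc s)
        have "qpoch p p r = (1 - p) * qpoch (p * p) p s" by (simp add: Suc qpoch_Suc_left)
        moreover have "qpoch p p r \<noteq> 0" using p by simp
        ultimately show ?thesis using p1 by (simp add: bailey_alpha_def Suc)
      qed (simp add: bailey_alpha_def numeral_2_eq_2)
      moreover have "1 - p ^ (2 * r + 1) = (1 - x) * (1 + x)"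
      proof -
        have "p ^ (2 * r + 1) = x * x" unfolding p_def x_def power_mult[symmetric] power_add[symmetric]
          by (rule arg_cong[of _ _ "\<lambda>m. q ^ m"]) simp
        then show ?thesis by (simp add: algebra_simps)
      qed
      ultimately have "(1 - p) * (bailey_alpha p p r * (p ^ r * q ^ (r\<^sup>2)))
         = (- 1) ^ r * (p ^ r * p ^ ((r choose 2) + r ^ 2) * p ^ r * q ^ (r\<^sup>2)) * (1 - x) * (1 + x)"
        by (simp add: mult.assoc[symmetric]) (simp add: power_minus[of p] mult_ac)
      also have "p ^ r * p ^ ((r choose 2) + r ^ 2) * p ^ r * q ^ (r\<^sup>2) = q ^ (2 * r + 2 * ((r choose 2) + r ^ 2) + 2 * r + r\<^sup>2)"
        unfolding p_def power_mult[symmetric] power_add[symmetric] ..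
      also have "2 * r + 2 * ((r choose 2) + r ^ 2) + 2 * r + r\<^sup>2 = 7 * r + 8 * (r choose 2)"
        using choose_2_square[of r] by simp
      also have "(- 1) ^ r * q ^ (7 * r + 8 * (r choose 2)) * (1 - x) = c r"
      proof -
        have "7 * r + 8 * (r choose 2) + (2 * r + 1) = Suc r + 8 * (Suc r choose 2)"
          by (simp add: Suc_choose_2)
        then have "q ^ (7 * r + 8 * (r choose 2)) * x = q ^ Suc r * (q ^ 8) ^ (Suc r choose 2)"
          unfolding x_def power_add[symmetric] power_mult[symmetric] by (rule arg_cong[of _ _ "\<lambda>m. q ^ m"])
        moreover have "q ^ (7 * r + 8 * (r choose 2)) = (q ^ 7) ^ r * (q ^ 8) ^ (r choose 2)"
          by (simp only: power_add power_mult)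
        ultimately show ?thesis
          unfolding c_def power_minus[of "q ^ 7"] power_minus[of q] right_diff_distrib mult.assoc by simp
      qed
      finally show ?thesis by (simp add: mult_ac)
    qed
    have "qpoch_inf (- q) p / qpoch_inf p p * c r =
        qpoch (- q) p r * X * ((1 + x) * c r) / ((1 - p) * qpoch_inf (p * p) p)"
      unfolding 1 3 by simp
    also have "\<dots> = bailey_alpha p p r * (p ^ r * q ^ (r\<^sup>2) * qpoch (- q) p r * X / qpoch_inf (p * p) p)"
      unfolding 2 using p1 by simp
    finally show "qpoch_inf (- q) p / qpoch_inf p p * c r =
         bailey_alpha p p r * (p ^ r * q ^ (r\<^sup>2) * qpoch (- q) p r * qpoch_inf (- (p * q ^ (2 * r + 1))) p / qpoch_inf (p * p) p)"
      unfolding X_def x_def .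
  qed
  finally have "(\<lambda>n. p ^ n * q ^ (n\<^sup>2) * qpoch (- q) p n / qpoch p p n) sums
      (qpoch_inf (- q) p / qpoch_inf p p * P)"
    unfolding p_def using p by (intro bailey_goellnitz_gordon assms) (simp_all add: p_def)
  moreover have "p ^ n * q ^ (n\<^sup>2) = q ^ (n\<^sup>2 + 2 * n)" for n
    by (subst mult.commute) (simp add: p_def power_add power_mult)
  ultimately show ?thesis by (simp only: p_def P_def)
qed

section \<open>Reduction of the five double sums to single sums\<close>

lemma double_sum_by_euler:
  assumes "norm Q < 1" "Q \<noteq> 0" "z \<noteq> 0" "norm (z * Q) \<le> 1" "norm x \<le> 1"
    and S: "(\<lambda>j. (x * z) ^ j * Q ^ (j choose 2) * qpoch (- (Q / z)) Q j / qpoch Q Q j) sums S"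
  shows "((\<lambda>(i, j). (z / Q ^ j) ^ i * Q ^ (i choose 2) * x ^ j * Q ^ (j\<^sup>2) / (qpoch Q Q i * qpoch Q Q j))
     has_sum (qpoch_inf (- z) Q * S)) UNIV"
proof -
  obtain C where C: "C > 0" "\<And>n. norm (1 / qpoch Q Q n) \<le> C"
    using inverse_qpoch_bounded[OF assms(1) qpoch_inf_nonzero[OF assms(1)]] by blast
  show ?thesis
  proof (rule double_sums(1))
    show "0 \<le> norm Q" "norm Q < 1" using assms by auto
    fix i j
    define r where "r = norm Q"
    have r: "0 < r" "r < 1" using assms by (auto simp: r_def)
    \<comment> \<open>Positive definiteness of the exponent form, by completing squares. Of the left
      side, i j is lost to 1 / Q^j, one i to the bound |z| <= 1 / |Q|, and i + j is the geometric
      decay; the constant 10 absorbs the linear terms.\<close>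
    have "2 * (i * j + 2 * i + j) \<le> 2 * ((i choose 2) + j\<^sup>2 + 10)"
    proof -
      have *: "2 * int (i choose 2) + int i = (int i)\<^sup>2"
        using arg_cong[OF choose_2_square[of i], of int] by simp
      have "0 \<le> (2 * (int i - int j) - 5)\<^sup>2 + (2 * int j - 7)\<^sup>2" by simp
      then have "int (2 * (i * j + 2 * i + j)) \<le> int (2 * ((i choose 2) + j\<^sup>2 + 10))"
        using * by (simp add: power2_eq_square algebra_simps)
      then show ?thesis by (simp only: of_nat_le_iff)
    qed
    then have "i * j + i + i + j \<le> (i choose 2) + j\<^sup>2 + 10" by simp
    then have "r ^ ((i choose 2) + j\<^sup>2 + 10) \<le> r ^ (i * j + i + i + j)"
      using r by (intro power_decreasing) auto
    then have le: "r ^ (i choose 2) * r ^ (j\<^sup>2) / (r ^ (i * j) * r ^ i) \<le> (1 / r ^ 10) * r ^ i * r ^ j"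
      using r by (simp add: divide_simps power_add mult_ac)
    have "norm ((z / Q ^ j) ^ i * Q ^ (i choose 2) * x ^ j * Q ^ (j\<^sup>2) / (qpoch Q Q i * qpoch Q Q j)) =
       norm ((z * Q) ^ i) * norm (x ^ j) * (r ^ (i choose 2) * r ^ (j\<^sup>2) / (r ^ (i * j) * r ^ i)) * norm (1 / qpoch Q Q i) * norm (1 / qpoch Q Q j)"
      using r by (simp add: norm_mult norm_divide norm_power r_def power_mult[symmetric] power_divide power_mult_distrib mult.commute[of j]) (simp add: mult_ac)
    also have "\<dots> \<le> 1 * 1 * ((1 / r ^ 10) * r ^ i * r ^ j) * C * C"
      using assms C r by (intro mult_mono norm_power_le_1 le) (auto intro: less_imp_le)
    finally show "norm ((z / Q ^ j) ^ i * Q ^ (i choose 2) * x ^ j * Q ^ (j\<^sup>2) / (qpoch Q Q i * qpoch Q Q j))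
        \<le> (1 / norm Q ^ 10 * C * C) * norm Q ^ i * norm Q ^ j"
      by (simp add: r_def mult_ac)
  next
    show "(\<lambda>j. qpoch_inf (- z) Q * ((x * z) ^ j * Q ^ (j choose 2) * qpoch (- (Q / z)) Q j / qpoch Q Q j)) sums
       (qpoch_inf (- z) Q * S)" by (intro sums_mult S)
    fix j
    have jj: "j\<^sup>2 = (j choose 2) + (Suc j choose 2)" using choose_2_square[of j] by (simp add: Suc_choose_2)
    have "- (z / Q ^ j) * Q ^ j = - z" using assms by simp
    \<comment> \<open>Euler's sum over i gives this product. Splitting off its first j factors and
      reversing them separates (-z;Q)_inf, which is independent of j, from the single sum over
      j.\<close>
    then have "qpoch_inf (- (z / Q ^ j)) Q = qpoch (- (z / Q ^ j)) Q j * qpoch_inf (- z) Q"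
      using qpoch_inf_split[OF assms(1), of "- (z / Q ^ j)" j] by metis
    also have "qpoch (- (z / Q ^ j)) Q j = z ^ j / Q ^ (Suc j choose 2) * qpoch (- (Q / z)) Q j"
      using qpoch_reverse[of Q "- z" j] assms by simp
    finally have e: "x ^ j * Q ^ (j\<^sup>2) / qpoch Q Q j * qpoch_inf (- (z / Q ^ j)) Q =
       qpoch_inf (- z) Q * ((x * z) ^ j * Q ^ (j choose 2) * qpoch (- (Q / z)) Q j / qpoch Q Q j)"
      using assms unfolding jj by (simp add: power_add power_mult_distrib mult_ac)
    have "(\<lambda>i. x ^ j * Q ^ (j\<^sup>2) / qpoch Q Q j * ((z / Q ^ j) ^ i * Q ^ (i choose 2) / qpoch Q Q i)) sums
       (x ^ j * Q ^ (j\<^sup>2) / qpoch Q Q j * qpoch_inf (- (z / Q ^ j)) Q)"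
      by (intro sums_mult euler_sums assms)
    then show "(\<lambda>i. (z / Q ^ j) ^ i * Q ^ (i choose 2) * x ^ j * Q ^ (j\<^sup>2) / (qpoch Q Q i * qpoch Q Q j)) sums
       (qpoch_inf (- z) Q * ((x * z) ^ j * Q ^ (j choose 2) * qpoch (- (Q / z)) Q j / qpoch Q Q j))"
      unfolding e by (simp add: mult_ac)
  qed
qed

lemma qpoch_inf_minus_q:
  assumes "norm q < 1"
  shows "qpoch_inf (- q) q = qpoch_inf (q^2) (q^2) / qpoch_inf q q"
  using qpoch_inf_minus[OF assms, of q] qpoch_inf_nonzero[OF assms] by (simp add: field_simps)

lemma qpoch_inf_minus_q_q2:
  assumes "norm q < 1"
  shows "qpoch_inf (- q) (q^2) = qpoch_inf (q^2) (q^2) ^ 2 / (qpoch_inf q q * qpoch_inf (q^4) (q^4))"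
proof -
  note 2 = norm_power_less_1[OF assms, of 2, simplified] and 4 = norm_power_less_1[OF assms, of 4, simplified]
  have a: "qpoch_inf x (y^2) * qpoch_inf (- x) (y^2) = qpoch_inf (x^2) (y^4)" if "norm y < 1" for x y
    using qpoch_inf_minus[OF norm_power_less_1[OF that, of 2], of x] by (simp add: power_mult[symmetric])
  have b: "qpoch_inf y y = qpoch_inf y (y^2) * qpoch_inf (y^2) (y^2)" if "norm y < 1" for y
    using qpoch_inf_dissect[OF that, of 2 y] by (simp add: numeral_2_eq_2)
  have c: "qpoch_inf (q^2) (q^2) = qpoch_inf (q^2) (q^4) * qpoch_inf (q^4) (q^4)"
    using b[OF 2] by (simp add: power_mult[symmetric])
  have nz: "qpoch_inf q q \<noteq> 0" "qpoch_inf (q^2) (q^2) \<noteq> 0" "qpoch_inf (q^4) (q^4) \<noteq> 0"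
    using assms 2 4 by auto
  then have "qpoch_inf q (q^2) \<noteq> 0" using b[OF assms] by auto
  then have "qpoch_inf (- q) (q^2) = qpoch_inf (q^2) (q^4) / qpoch_inf q (q^2)"
    using a[OF assms, of q] by (simp add: field_simps)
  also have "\<dots> = (qpoch_inf (q^2) (q^2) / qpoch_inf (q^4) (q^4)) / (qpoch_inf q q / qpoch_inf (q^2) (q^2))"
    using c b[OF assms] nz by simp
  finally show ?thesis by (simp add: power2_eq_square)
qed

lemma choose_2_div: "((int i)\<^sup>2 + k * int i) div 2 = int (i choose 2) + ((k + 1) * int i) div 2"
proof -
  have *: "2 * int (i choose 2) + int i = (int i)\<^sup>2"
    using arg_cong[OF choose_2_square[of i], of int] by simp
  have "(int i)\<^sup>2 + k * int i = int (i choose 2) * 2 + (k + 1) * int i"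
    using * by (simp add: algebra_simps)
  then show ?thesis by simp
qed

lemma qpoch_inf_minus_1:
  fixes q :: complex
  assumes "norm q < 1"
  shows "qpoch_inf (-1) q \<noteq> 0" "qpoch_inf (-1) q = 2 * qpoch_inf (- q) q"
proof -
  show "qpoch_inf (-1) q = 2 * qpoch_inf (- q) q" using qpoch_inf_step[OF assms, of "-1"] by simp
  then show "qpoch_inf (-1) q \<noteq> 0" using qpoch_inf_nonzero_small[OF assms, of "- q"] assms by simp
qed

lemma powi_diff_of_nat: "q \<noteq> 0 \<Longrightarrow> q powi (int m - int n) = q ^ m / q ^ n" for q :: complex
  by (simp add: power_int_diff)

text \<open>At base 0 the convention \<open>0 powi e = 0\<close> for e \<noteq> 0 and
  \<open>0 powi 0 = 1\<close> leaves only the pairs with exponent 0, each contributing 1. The value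
  at q = 0 is thus a count of zeros of the exponent.\<close>

lemma has_sum_zero_base:
  fixes e :: "nat \<Rightarrow> nat \<Rightarrow> int"
  assumes "finite F" "\<And>i j. e i j = 0 \<longleftrightarrow> (i, j) \<in> F"
  shows "((\<lambda>(i, j). (0::complex) powi e i j / (qpoch 0 0 i * qpoch 0 0 j)) has_sum (of_nat (card F))) UNIV"
proof -
  have "((\<lambda>(i, j). (0::complex) powi e i j / (qpoch 0 0 i * qpoch 0 0 j)) has_sum
     (\<Sum>(i, j)\<in>F. (0::complex) powi e i j / (qpoch 0 0 i * qpoch 0 0 j))) UNIV"
    by (rule has_sum_finite_neutralI[OF assms(1)]) (use assms(2) in \<open>auto simp: power_int_0_left_if\<close>)
  also have "(\<Sum>(i, j)\<in>F. (0::complex) powi e i j / (qpoch 0 0 i * qpoch 0 0 j)) = (\<Sum>x\<in>F. 1)"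
    by (rule sum.cong) (use assms(2) in \<open>auto simp: power_int_0_left_if\<close>)
  finally show ?thesis by simp
qed

lemma add_nonneg_half_eq_0: "2 * x = a + b \<Longrightarrow> a \<ge> 0 \<Longrightarrow> b \<ge> 0 \<Longrightarrow> x = 0 \<longleftrightarrow> a = 0 \<and> b = 0"
  for x a b :: int
  by linarith

text \<open>One family for identities 1, 3, 4, at s = -1, 0, 1. Euler's identity is applied with z =
  q^s; the weight of j is chosen as x = q^(1-s), so that Q / z = x and x z = q, and the remaining
  sum over j is exactly Lebesgue's.\<close>

lemma lebesgue_double_sum:
  assumes q: "norm (q::complex) < 1" and "q \<noteq> 0" and s: "-1 \<le> s" "s \<le> 1"
  shows "((\<lambda>(i, j). q powi (int (i choose 2) + s * int i - int i * int j + (int j)\<^sup>2 + (1 - s) * int j)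
             / (qpoch q q i * qpoch q q j))
          has_sum (qpoch_inf (- (q powi s)) q * (qpoch_inf (- (q powi (1 - s) * q)) (q\<^sup>2) * qpoch_inf (- q) q))) UNIV"
proof -
  define y where "y = q powi (1 - s)"
  have y1: "norm y \<le> 1"
    using q s by (simp add: y_def norm_power_int power_int_le_one)
  have y: "y = q / q powi s" "y * q powi s = q"
    using \<open>q \<noteq> 0\<close> by (simp_all add: y_def power_int_diff)
  have nz: "qpoch_inf (- y) q \<noteq> 0"
  proof (cases "s = 1")
    case False
    then have "norm q powi (1 - s) \<le> norm q powi 1"
      using s q \<open>q \<noteq> 0\<close> by (intro power_int_decreasing) auto
    then show ?thesis using q by (intro qpoch_inf_nonzero_small q) (simp add: y_def norm_power_int)
  qed (simp add: y_def qpoch_inf_minus_1(1)[OF q])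
  have "norm (q powi s * q) = norm q powi (s + 1)"
    using \<open>q \<noteq> 0\<close> by (simp add: norm_mult norm_power_int power_int_add)
  then have zq: "norm (q powi s * q) \<le> 1" using s q by (simp add: power_int_le_one)
  have "((\<lambda>(i, j). (q powi s / q ^ j) ^ i * q ^ (i choose 2) * y ^ j * q ^ (j\<^sup>2) / (qpoch q q i * qpoch q q j))
     has_sum (qpoch_inf (- (q powi s)) q * (qpoch_inf (- (y * q)) (q\<^sup>2) * qpoch_inf (- q) q))) UNIV"
  proof (rule double_sum_by_euler)
    show "(\<lambda>j. (y * q powi s) ^ j * q ^ (j choose 2) * qpoch (- (q / q powi s)) q j / qpoch q q j) sums
      (qpoch_inf (- (y * q)) (q\<^sup>2) * qpoch_inf (- q) q)"
      using lebesgue_sums[OF q nz] unfolding y(2) y(1)[symmetric] by (simp add: Suc_choose_2 power_add mult_ac)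
  qed (use \<open>q \<noteq> 0\<close> q y1 zq in auto)
  moreover have "q powi (int (i choose 2) + s * int i - int i * int j + (int j)\<^sup>2 + (1 - s) * int j) =
      (q powi s / q ^ j) ^ i * q ^ (i choose 2) * y ^ j * q ^ (j\<^sup>2)" for i j
  proof -
    have "(q powi s / q ^ j) ^ i * q ^ (i choose 2) * y ^ j * q ^ (j\<^sup>2) =
        q powi ((s - int j) * int i) * q powi int (i choose 2) * q powi ((1 - s) * int j) * q powi int (j\<^sup>2)"
      using \<open>q \<noteq> 0\<close> by (simp add: y_def power_int_mult power_int_diff del: of_nat_power)
    also have "\<dots> = q powi ((s - int j) * int i + int (i choose 2) + (1 - s) * int j + int (j\<^sup>2))"
      using \<open>q \<noteq> 0\<close> by (simp only: power_int_add simp_thms)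
    finally show ?thesis by (simp add: algebra_simps)
  qed
  ultimately show ?thesis by (simp add: y_def)
qed

lemma identity_1:
  assumes q: "norm (q::complex) < 1" and "q \<noteq> 0"
  shows "((\<lambda>(i, j). q powi (((int i)\<^sup>2 - 3 * int i) div 2 - int i * int j + (int j)\<^sup>2 + 2 * int j)
             / (qpoch q q i * qpoch q q j))
          has_sum
            (2 * inverse q * (qpoch_inf (q^2) (q^2) ^ 4
              / (qpoch_inf q q ^ 3 * qpoch_inf (q^4) (q^4))))) (UNIV :: (nat \<times> nat) set)"
proof -
  have q2: "norm (q\<^sup>2) < 1" using norm_power_less_1[OF q, of 2] by simp
  have "((int i)\<^sup>2 - 3 * int i) div 2 - int i * int j + (int j)\<^sup>2 + 2 * int j = int (i choose 2) + (-1) * int i - int i * int j + (int j)\<^sup>2 + (1 - (-1)) * int j" for i j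
    using choose_2_div[of i "-3"] by simp
  from lebesgue_double_sum[OF q \<open>q \<noteq> 0\<close>, of "(-1)", folded this]
  have "((\<lambda>(i, j). q powi (((int i)\<^sup>2 - 3 * int i) div 2 - int i * int j + (int j)\<^sup>2 + 2 * int j)
             / (qpoch q q i * qpoch q q j)) has_sum (qpoch_inf (- (1 / q)) q * (qpoch_inf (- (q\<^sup>2 * q)) (q\<^sup>2) * qpoch_inf (- q) q))) UNIV"
    by (simp add: power_int_minus divide_inverse)
  also have "qpoch_inf (- (1 / q)) q * (qpoch_inf (- (q\<^sup>2 * q)) (q\<^sup>2) * qpoch_inf (- q) q) =
     2 * inverse q * (qpoch_inf (q^2) (q^2) ^ 4 / (qpoch_inf q q ^ 3 * qpoch_inf (q^4) (q^4)))"
  proof -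
    \<comment> \<open>The two detached factors combine to (1 + 1/q) / (1 + q) = 1/q. Together with
      the first factor 2 of (-1;q)_inf this gives the prefactor 2 / q.\<close>
    have 1: "qpoch_inf (- (1 / q)) q = (1 + 1 / q) * qpoch_inf (-1) q"
      using qpoch_inf_step[OF q, of "- (1 / q)"] \<open>q \<noteq> 0\<close> by simp
    have 2: "qpoch_inf (- q) (q\<^sup>2) = (1 + q) * qpoch_inf (- (q\<^sup>2 * q)) (q\<^sup>2)"
      using qpoch_inf_step[OF q2, of "- q"] by (simp add: mult.commute)
    have "qpoch_inf (- (1 / q)) q * (qpoch_inf (- (q\<^sup>2 * q)) (q\<^sup>2) * qpoch_inf (- q) q)
        = 2 * inverse q * (qpoch_inf (- q) (q\<^sup>2) * qpoch_inf (- q) q * qpoch_inf (- q) q)"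
      unfolding 1 2 qpoch_inf_minus_1(2)[OF q] using \<open>q \<noteq> 0\<close> by (simp add: field_simps)
    then show ?thesis
      unfolding qpoch_inf_minus_q_q2[OF q] qpoch_inf_minus_q[OF q] by (simp add: eval_nat_numeral mult_ac)
  qed
  finally show ?thesis .
qed

lemma identity_3:
  assumes q: "norm (q::complex) < 1"
  shows "((\<lambda>(i, j). q powi (((int i)\<^sup>2 - int i) div 2 - int i * int j + (int j)\<^sup>2 + int j)
           / (qpoch q q i * qpoch q q j))
        has_sum
          (2 * (qpoch_inf (q^2) (q^2) * qpoch_inf (q^4) (q^4) / qpoch_inf q q ^ 2)))
          (UNIV :: (nat \<times> nat) set)"
proof (cases "q = 0")
  case True
  have "((int i)\<^sup>2 - int i) div 2 - int i * int j + (int j)\<^sup>2 + int j = 0 \<longleftrightarrow> (i, j) \<in> {(0, 0), (1, 0)}" for i j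
  proof -
    \<comment> \<open>In d = i - j and j, twice the exponent is a sum of two products of consecutive
      integers, each nonnegative. The solutions d = 0 and d = 1 with j = 0 account for the factor 2
      at q = 0.\<close>
    define d where "d = int i - int j"
    have "2 * (((int i)\<^sup>2 - int i) div 2) = (int i)\<^sup>2 - int i" by simp
    then have *: "2 * (((int i)\<^sup>2 - int i) div 2 - int i * int j + (int j)\<^sup>2 + int j) = d * (d - 1) + int j * (int j + 1)"
      by (simp add: d_def power2_eq_square algebra_simps)
    have d: "d * (d - 1) \<ge> 0" "d * (d - 1) = 0 \<longleftrightarrow> d = 0 \<or> d = 1"
      by (cases "d \<ge> 1"; simp add: zero_le_mult_iff; linarith?) auto
    have j: "int j * (int j + 1) \<ge> 0" "int j * (int j + 1) = 0 \<longleftrightarrow> j = 0" by auto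
    have "((int i)\<^sup>2 - int i) div 2 - int i * int j + (int j)\<^sup>2 + int j = 0 \<longleftrightarrow> d * (d - 1) = 0 \<and> int j * (int j + 1) = 0"
      by (rule add_nonneg_half_eq_0[OF * d(1) j(1)])
    also have "\<dots> \<longleftrightarrow> (i, j) \<in> {(0, 0), (1, 0)}"
      unfolding d(2) j(2) by (auto simp: d_def)
    finally show ?thesis .
  qed
  from has_sum_zero_base[of "{(0, 0), (1, 0)}", OF _ this] show ?thesis by (simp add: True)
next
  case False
  then have "q \<noteq> 0" .
  have q2: "norm (q\<^sup>2) < 1" using norm_power_less_1[OF q, of 2] by simp
  have "((int i)\<^sup>2 - int i) div 2 - int i * int j + (int j)\<^sup>2 + int j = int (i choose 2) + 0 * int i - int i * int j + (int j)\<^sup>2 + (1 - 0) * int j" for i j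
    using choose_2_div[of i "-1"] by simp
  from lebesgue_double_sum[OF q \<open>q \<noteq> 0\<close>, of "0", folded this]
  have "((\<lambda>(i, j). q powi (((int i)\<^sup>2 - int i) div 2 - int i * int j + (int j)\<^sup>2 + int j)
             / (qpoch q q i * qpoch q q j)) has_sum (qpoch_inf (- 1) q * (qpoch_inf (- (q * q)) (q\<^sup>2) * qpoch_inf (- q) q))) UNIV"
    by simp
  also have "qpoch_inf (- 1) q * (qpoch_inf (- (q * q)) (q\<^sup>2) * qpoch_inf (- q) q) =
     2 * (qpoch_inf (q^2) (q^2) * qpoch_inf (q^4) (q^4) / qpoch_inf q q ^ 2)"
  proof -
    have "qpoch_inf (- (q * q)) (q\<^sup>2) = qpoch_inf (q^4) (q^4) / qpoch_inf (q^2) (q^2)"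
      using qpoch_inf_minus_q[OF q2] by (simp add: power2_eq_square[symmetric] power_mult[symmetric])
    then show ?thesis
      unfolding qpoch_inf_minus_1(2)[OF q] qpoch_inf_minus_q[OF q] using qpoch_inf_nonzero[OF q2]
      by (simp add: eval_nat_numeral mult_ac)
  qed
  finally show ?thesis .
qed

lemma identity_4:
  assumes q: "norm (q::complex) < 1"
  shows "((\<lambda>(i, j). q powi (((int i)\<^sup>2 + int i) div 2 - int i * int j + (int j)\<^sup>2)
           / (qpoch q q i * qpoch q q j))
        has_sum
          (qpoch_inf (q^2) (q^2) ^ 4 / (qpoch_inf q q ^ 3 * qpoch_inf (q^4) (q^4))))
          (UNIV :: (nat \<times> nat) set)"
proof (cases "q = 0")
  case True
  have "((int i)\<^sup>2 + int i) div 2 - int i * int j + (int j)\<^sup>2 = 0 \<longleftrightarrow> (i, j) \<in> {(0, 0)}" for i j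
  proof -
    \<comment> \<open>The same diagonalisation; here d = -1 with j = 0 would mean i = -1, so only
      the origin remains.\<close>
    define d where "d = int i - int j"
    have "2 * (((int i)\<^sup>2 + int i) div 2) = (int i)\<^sup>2 + int i" by simp
    then have *: "2 * (((int i)\<^sup>2 + int i) div 2 - int i * int j + (int j)\<^sup>2) = d * (d + 1) + int j * (int j + 1)"
      by (simp add: d_def power2_eq_square algebra_simps)
    have d: "d * (d + 1) \<ge> 0" "d * (d + 1) = 0 \<longleftrightarrow> d = 0 \<or> d = -1"
      by (cases "d \<ge> 0"; simp add: zero_le_mult_iff; linarith?) auto
    have j: "int j * (int j + 1) \<ge> 0" "int j * (int j + 1) = 0 \<longleftrightarrow> j = 0" by auto
    have "((int i)\<^sup>2 + int i) div 2 - int i * int j + (int j)\<^sup>2 = 0 \<longleftrightarrow> d * (d + 1) = 0 \<and> int j * (int j + 1) = 0"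
      by (rule add_nonneg_half_eq_0[OF * d(1) j(1)])
    also have "\<dots> \<longleftrightarrow> (i, j) \<in> {(0, 0)}"
      unfolding d(2) j(2) by (auto simp: d_def)
    finally show ?thesis .
  qed
  from has_sum_zero_base[of "{(0, 0)}", OF _ this] show ?thesis by (simp add: True)
next
  case False
  then have "q \<noteq> 0" .
  have q2: "norm (q\<^sup>2) < 1" using norm_power_less_1[OF q, of 2] by simp
  have "((int i)\<^sup>2 + int i) div 2 - int i * int j + (int j)\<^sup>2 = int (i choose 2) + 1 * int i - int i * int j + (int j)\<^sup>2 + (1 - 1) * int j" for i j
    using choose_2_div[of i "1"] by simp
  from lebesgue_double_sum[OF q \<open>q \<noteq> 0\<close>, of "1", folded this]
  have "((\<lambda>(i, j). q powi (((int i)\<^sup>2 + int i) div 2 - int i * int j + (int j)\<^sup>2)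
             / (qpoch q q i * qpoch q q j)) has_sum (qpoch_inf (- q) q * (qpoch_inf (- (1 * q)) (q\<^sup>2) * qpoch_inf (- q) q))) UNIV"
    by simp
  also have "qpoch_inf (- q) q * (qpoch_inf (- (1 * q)) (q\<^sup>2) * qpoch_inf (- q) q) =
     qpoch_inf (q^2) (q^2) ^ 4 / (qpoch_inf q q ^ 3 * qpoch_inf (q^4) (q^4))"
    unfolding mult_1 qpoch_inf_minus_q_q2[OF q] qpoch_inf_minus_q[OF q] by (simp add: eval_nat_numeral mult_ac)
  finally show ?thesis .
qed

text \<open>Euler's identity in base q^2 with z = q, so that Q / z = q and the sum over j has the
  Goellnitz-Gordon form; k is 0 or 2 for identities 2 and 5. One (-q;q^2)_inf comes from the sum
  over i, the other from the sum over j.\<close>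

lemma goellnitz_gordon_double_sum:
  assumes q: "norm (q::complex) < 1" and "q \<noteq> 0"
    and S: "(\<lambda>n. q ^ (n\<^sup>2 + k * n) * qpoch (- q) (q\<^sup>2) n / qpoch (q\<^sup>2) (q\<^sup>2) n) sums
           (qpoch_inf (- q) (q\<^sup>2) / qpoch_inf (q\<^sup>2) (q\<^sup>2) * P)"
  shows "((\<lambda>(i, j). q powi ((int i)\<^sup>2 - 2 * int i * int j + 2 * (int j)\<^sup>2 + int k * int j)
           / (qpoch (q^2) (q^2) i * qpoch (q^2) (q^2) j))
        has_sum
          (qpoch_inf (q^2) (q^2) ^ 3 * P / (qpoch_inf q q ^ 2 * qpoch_inf (q^4) (q^4) ^ 2))) UNIV"
proof -
  have q2: "norm (q\<^sup>2) < 1" using norm_power_less_1[OF q, of 2] by simp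
  have c: "2 * (j choose 2) + j = j\<^sup>2" for j by (rule choose_2_square)
  have "((\<lambda>(i, j). (q / (q\<^sup>2) ^ j) ^ i * (q\<^sup>2) ^ (i choose 2) * (q ^ k) ^ j * (q\<^sup>2) ^ (j\<^sup>2) / (qpoch (q\<^sup>2) (q\<^sup>2) i * qpoch (q\<^sup>2) (q\<^sup>2) j))
     has_sum (qpoch_inf (- q) (q\<^sup>2) * (qpoch_inf (- q) (q\<^sup>2) / qpoch_inf (q\<^sup>2) (q\<^sup>2) * P))) UNIV"
  proof (rule double_sum_by_euler)
    have "(q ^ k * q) ^ j * (q\<^sup>2) ^ (j choose 2) = q ^ (j\<^sup>2 + k * j)" for j
    proof -
      have "(q ^ k * q) ^ j * (q\<^sup>2) ^ (j choose 2) = q ^ ((k + 1) * j + 2 * (j choose 2))"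
        unfolding power_add power_mult by simp
      also have "(k + 1) * j + 2 * (j choose 2) = j\<^sup>2 + k * j"
        using c[of j] by (simp add: algebra_simps)
      finally show ?thesis .
    qed
    then show "(\<lambda>j. (q ^ k * q) ^ j * (q\<^sup>2) ^ (j choose 2) * qpoch (- (q\<^sup>2 / q)) (q\<^sup>2) j / qpoch (q\<^sup>2) (q\<^sup>2) j) sums
      (qpoch_inf (- q) (q\<^sup>2) / qpoch_inf (q\<^sup>2) (q\<^sup>2) * P)"
      using S \<open>q \<noteq> 0\<close> by (simp add: power2_eq_square)
    show "norm (q * q\<^sup>2) \<le> 1" using norm_power_less_1[OF q, of 3] by (simp add: eval_nat_numeral)
    show "norm (q ^ k) \<le> 1" using q by (intro norm_power_le_1) simp
  qed (use assms q2 in auto)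
  also have "(\<lambda>(i, j). (q / (q\<^sup>2) ^ j) ^ i * (q\<^sup>2) ^ (i choose 2) * (q ^ k) ^ j * (q\<^sup>2) ^ (j\<^sup>2) / (qpoch (q\<^sup>2) (q\<^sup>2) i * qpoch (q\<^sup>2) (q\<^sup>2) j)) =
    (\<lambda>(i, j). q powi ((int i)\<^sup>2 - 2 * int i * int j + 2 * (int j)\<^sup>2 + int k * int j) / (qpoch (q^2) (q^2) i * qpoch (q^2) (q^2) j))"
  proof -
    have "q powi ((int i)\<^sup>2 - 2 * int i * int j + 2 * (int j)\<^sup>2 + int k * int j) = (q / (q\<^sup>2) ^ j) ^ i * (q\<^sup>2) ^ (i choose 2) * (q ^ k) ^ j * (q\<^sup>2) ^ (j\<^sup>2)" for i j
    proof -
      have e: "(int i)\<^sup>2 - 2 * int i * int j + 2 * (int j)\<^sup>2 + int k * int j =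
         int (2 * (i choose 2) + i + 2 * j\<^sup>2 + k * j) - int (2 * j * i)"
        unfolding c[of i] by (simp add: mult_ac)
      show ?thesis unfolding e powi_diff_of_nat[OF \<open>q \<noteq> 0\<close>]
        by (simp add: power_add power_mult power_divide power_mult_distrib)
    qed
    then show ?thesis by simp
  qed
  also have "qpoch_inf (- q) (q\<^sup>2) * (qpoch_inf (- q) (q\<^sup>2) / qpoch_inf (q\<^sup>2) (q\<^sup>2) * P) =
     qpoch_inf (q^2) (q^2) ^ 3 * P / (qpoch_inf q q ^ 2 * qpoch_inf (q^4) (q^4) ^ 2)"
    unfolding qpoch_inf_minus_q_q2[OF q] using qpoch_inf_nonzero[OF q2] by (simp add: eval_nat_numeral mult_ac)
  finally show ?thesis .
qed

lemma identity_2: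
  assumes q: "norm (q::complex) < 1"
  shows "((\<lambda>(i, j). q powi ((int i)\<^sup>2 - 2 * int i * int j + 2 * (int j)\<^sup>2)
           / (qpoch (q^2) (q^2) i * qpoch (q^2) (q^2) j))
        has_sum
          (qpoch_inf (q^2) (q^2) ^ 3
            * (qpoch_inf (q^3) (q^8) * qpoch_inf (q^5) (q^8) * qpoch_inf (q^8) (q^8))
            / (qpoch_inf q q ^ 2 * qpoch_inf (q^4) (q^4) ^ 2))) (UNIV :: (nat \<times> nat) set)"
proof (cases "q = 0")
  case True
  have "(int i)\<^sup>2 - 2 * int i * int j + 2 * (int j)\<^sup>2 = 0 \<longleftrightarrow> (i, j) \<in> {(0, 0)}" for i j
    using sum_squares_eq_zero_iff[of "int i - int j" "int j"] by (auto simp: power2_eq_square algebra_simps)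
  from has_sum_zero_base[of "{(0, 0)}", OF _ this] show ?thesis by (simp add: True)
next
  case False
  then show ?thesis
    using goellnitz_gordon_double_sum[OF q, of 0] goellnitz_gordon_1[OF q] by simp
qed

lemma identity_5:
  assumes q: "norm (q::complex) < 1"
  shows "((\<lambda>(i, j). q powi ((int i)\<^sup>2 - 2 * int i * int j + 2 * (int j)\<^sup>2 + 2 * int j)
           / (qpoch (q^2) (q^2) i * qpoch (q^2) (q^2) j))
        has_sum
          (qpoch_inf (q^2) (q^2) ^ 3
            * (qpoch_inf q (q^8) * qpoch_inf (q^7) (q^8) * qpoch_inf (q^8) (q^8))
            / (qpoch_inf q q ^ 2 * qpoch_inf (q^4) (q^4) ^ 2))) (UNIV :: (nat \<times> nat) set)"
proof (cases "q = 0")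
  case True
  have "(int i)\<^sup>2 - 2 * int i * int j + 2 * (int j)\<^sup>2 + 2 * int j = 0 \<longleftrightarrow> (i, j) \<in> {(0, 0)}" for i j
  proof -
    have e: "(int i)\<^sup>2 - 2 * int i * int j + 2 * (int j)\<^sup>2 = (int i - int j) * (int i - int j) + int j * int j"
      by (simp add: power2_eq_square algebra_simps)
    have "(int i - int j) * (int i - int j) + int j * int j \<ge> 0" by simp
    then have "(int i - int j) * (int i - int j) + int j * int j + 2 * int j = 0 \<longleftrightarrow>
        (int i - int j) * (int i - int j) + int j * int j = 0 \<and> int j = 0"
      by linarith
    then show ?thesis unfolding e sum_squares_eq_zero_iff by auto
  qed
  from has_sum_zero_base[of "{(0, 0)}", OF _ this] show ?thesis by (simp add: True)
next
  case False
  then show ?thesis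
    using goellnitz_gordon_double_sum[OF q, of 2] goellnitz_gordon_2[OF q] by simp
qed

section \<open>A function with simple zeros on a lattice\<close>

definition e2pi :: "complex \<Rightarrow> complex" where
  "e2pi z = exp (2 * of_real pi * \<i> * z)"

lemma e2pi_add: "e2pi (z + w) = e2pi z * e2pi w"
  by (simp add: e2pi_def ring_distribs exp_add)

lemma e2pi_diff: "e2pi (z - w) = e2pi z / e2pi w"
  by (simp add: e2pi_def ring_distribs exp_diff)

lemma e2pi_minus: "e2pi (- z) = inverse (e2pi z)"
  by (simp add: e2pi_def exp_minus)

lemma e2pi_nonzero [simp]: "e2pi z \<noteq> 0"
  by (simp add: e2pi_def)

lemma e2pi_0 [simp]: "e2pi 0 = 1"
  by (simp add: e2pi_def)

lemma e2pi_power: "e2pi z ^ n = e2pi (of_nat n * z)"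
  by (simp add: e2pi_def exp_of_nat_mult[symmetric] mult_ac)

lemma e2pi_powi: "e2pi z powi n = e2pi (of_int n * z)"
proof (cases "n \<ge> 0")
  case True
  then show ?thesis using e2pi_power[of z "nat n"] by (simp add: power_int_def)
next
  case False
  then show ?thesis using e2pi_power[of z "nat (- n)"] e2pi_minus[of "of_int n * z"]
    by (simp add: power_int_def power_inverse e2pi_minus)
qed

lemma norm_e2pi: "norm (e2pi z) = exp (- 2 * pi * Im z)"
  by (simp add: e2pi_def)

lemma norm_e2pi_less_1: "Im z > 0 \<Longrightarrow> norm (e2pi z) < 1"
  by (simp add: norm_e2pi)

lemma e2pi_eq_1_iff: "e2pi z = 1 \<longleftrightarrow> z \<in> \<int>"
proof
  assume "e2pi z = 1"
  then obtain n :: int where "Re (2 * of_real pi * \<i> * z) = 0" "Im (2 * of_real pi * \<i> * z) = of_int (2 * n) * pi"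
    unfolding e2pi_def exp_eq_1 by blast
  then have "z = of_int n" by (simp add: complex_eq_iff)
  then show "z \<in> \<int>" by simp
qed (auto simp: e2pi_def elim!: Ints_cases simp: exp_eq_1)

lemma e2pi_of_int [simp]: "e2pi (of_int n) = 1"
  by (simp add: e2pi_eq_1_iff)

lemma e2pi_1 [simp]: "e2pi 1 = 1"
  using e2pi_of_int[of 1] by simp

lemma qpow_eq_e2pi: "qpow \<tau> x = e2pi (of_rat x * \<tau>)"
  by (simp add: qpow_def e2pi_def mult_ac)

lemma e2pi_half: "e2pi (1 / 2) = -1"
  by (simp add: e2pi_def)

text \<open>This is \<open>\<theta>\<^sub>1(z) / \<theta>\<^sub>1'(0)\<close>, in product form.\<close>
definition lattice_fun :: "complex \<Rightarrow> complex \<Rightarrow> complex" where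
  "lattice_fun z \<tau> = \<i> / (2 * of_real pi) * e2pi (- (z / 2)) * qpoch_inf (e2pi z) (e2pi \<tau>) * qpoch_inf (e2pi (\<tau> - z)) (e2pi \<tau>)
     / qpoch_inf (e2pi \<tau>) (e2pi \<tau>) ^ 2"

lemma lattice_fun_plus_1: "lattice_fun (z + 1) \<tau> = - lattice_fun z \<tau>"
proof -
  have "e2pi (- ((z + 1) / 2)) = - e2pi (- (z / 2))"
    by (simp add: add_divide_distrib e2pi_diff e2pi_half)
  moreover have "e2pi (\<tau> - (z + 1)) = e2pi (\<tau> - z)" "e2pi (z + 1) = e2pi z"
    by (simp_all add: e2pi_diff e2pi_add)
  ultimately show ?thesis by (simp add: lattice_fun_def)
qed

lemma lattice_fun_plus_tau:
  assumes "Im \<tau> > 0"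
  shows "lattice_fun (z + \<tau>) \<tau> = - e2pi (- \<tau> / 2 - z) * lattice_fun z \<tau>"
proof -
  define q w where "q = e2pi \<tau>" and "w = e2pi z"
  have q: "norm q < 1" "q \<noteq> 0" using norm_e2pi_less_1[OF assms] by (auto simp: q_def)
  have w: "w \<noteq> 0" by (simp add: w_def)
  have 1: "qpoch_inf w q = (1 - w) * qpoch_inf (w * q) q" by (rule qpoch_inf_step[OF q(1)])
  have 2: "qpoch_inf (1 / w) q = (1 - 1 / w) * qpoch_inf (q / w) q"
    using qpoch_inf_step[OF q(1), of "1 / w"] by simp
  have 3: "qpoch_inf (w * q) q * qpoch_inf (1 / w) q = - (1 / w) * (qpoch_inf w q * qpoch_inf (q / w) q)"
    unfolding 1 2 using w by (simp add: field_simps)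
  have 4: "e2pi (- ((z + \<tau>) / 2)) = e2pi (- (z / 2)) * e2pi (- \<tau> / 2)"
    unfolding e2pi_add[symmetric] by (rule arg_cong[of _ _ e2pi]) (simp add: field_simps)
  have 5: "e2pi (- \<tau> / 2 - z) = e2pi (- \<tau> / 2) * (1 / w)" by (simp add: e2pi_diff w_def)
  have 6: "e2pi (\<tau> - (z + \<tau>)) = 1 / w" by (simp add: w_def e2pi_minus inverse_eq_divide)
  have "lattice_fun (z + \<tau>) \<tau> = \<i> / (2 * of_real pi) * (e2pi (- (z / 2)) * e2pi (- \<tau> / 2)) * (qpoch_inf (w * q) q * qpoch_inf (1 / w) q)
     / qpoch_inf q q ^ 2"
    unfolding lattice_fun_def 4 6 by (simp add: e2pi_add q_def w_def mult.assoc)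
  also have "\<dots> = - e2pi (- \<tau> / 2 - z) * lattice_fun z \<tau>"
    unfolding 3 5 lattice_fun_def by (simp add: e2pi_diff q_def[symmetric] w_def[symmetric] mult_ac)
  finally show ?thesis .
qed

lemma lattice_fun_plus_int: "lattice_fun (z + of_int n) \<tau> = e2pi (of_int n / 2) * lattice_fun z \<tau>"
proof (induction n rule: int_induct[of _ 0])
  case (step1 i)
  have "lattice_fun (z + of_int (i + 1)) \<tau> = - lattice_fun (z + of_int i) \<tau>"
    using lattice_fun_plus_1[of "z + of_int i" \<tau>] by (simp add: add.assoc)
  then show ?case using step1 by (simp add: add_divide_distrib e2pi_add e2pi_half)
next
  case (step2 i)
  have "lattice_fun (z + of_int i) \<tau> = - lattice_fun (z + of_int (i - 1)) \<tau>"
    using lattice_fun_plus_1[of "z + of_int (i - 1)" \<tau>] by (simp add: algebra_simps)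
  then show ?case using step2 by (simp add: diff_divide_distrib e2pi_diff e2pi_half minus_equation_iff[of "lattice_fun _ _"])
qed simp

lemma lattice_fun_plus_tau_int:
  assumes "Im \<tau> > 0"
  shows "lattice_fun (z + of_int m * \<tau>) \<tau> = e2pi (of_int m / 2 - of_int m ^ 2 * \<tau> / 2 - of_int m * z) * lattice_fun z \<tau>"
proof (induction m rule: int_induct[of _ 0])
  case (step1 i)
  have "lattice_fun (z + of_int (i + 1) * \<tau>) \<tau> = e2pi (1 / 2) * e2pi (- \<tau> / 2 - (z + of_int i * \<tau>)) * lattice_fun (z + of_int i * \<tau>) \<tau>"
    using lattice_fun_plus_tau[OF assms, of "z + of_int i * \<tau>"] by (simp add: ring_distribs add_ac e2pi_half)
  also have "\<dots> = e2pi (1 / 2 + (- \<tau> / 2 - (z + of_int i * \<tau>)) + (of_int i / 2 - of_int i ^ 2 * \<tau> / 2 - of_int i * z)) * lattice_fun z \<tau>"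
    unfolding step1 e2pi_add by (simp only: mult.assoc)
  also have "1 / 2 + (- \<tau> / 2 - (z + of_int i * \<tau>)) + (of_int i / 2 - of_int i ^ 2 * \<tau> / 2 - of_int i * z) =
    of_int (i + 1) / 2 - of_int (i + 1) ^ 2 * \<tau> / 2 - of_int (i + 1) * z"
    by (simp add: field_simps power2_eq_square)
  finally show ?case .
next
  case (step2 i)
  have "e2pi (1 / 2) * e2pi (- \<tau> / 2 - (z + of_int (i - 1) * \<tau>)) * lattice_fun (z + of_int (i - 1) * \<tau>) \<tau> = lattice_fun (z + of_int i * \<tau>) \<tau>"
    using lattice_fun_plus_tau[OF assms, of "z + of_int (i - 1) * \<tau>"] by (simp add: algebra_simps e2pi_half)
  then have "lattice_fun (z + of_int (i - 1) * \<tau>) \<tau> = e2pi (- (1 / 2 + (- \<tau> / 2 - (z + of_int (i - 1) * \<tau>)))) * lattice_fun (z + of_int i * \<tau>) \<tau>"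
    unfolding e2pi_minus e2pi_add[symmetric] by (metis e2pi_nonzero mult.left_neutral left_inverse mult.assoc)
  also have "\<dots> = e2pi (- (1 / 2 + (- \<tau> / 2 - (z + of_int (i - 1) * \<tau>))) + (of_int i / 2 - of_int i ^ 2 * \<tau> / 2 - of_int i * z)) * lattice_fun z \<tau>"
    unfolding step2 e2pi_add by (simp only: mult.assoc)
  also have "- (1 / 2 + (- \<tau> / 2 - (z + of_int (i - 1) * \<tau>))) + (of_int i / 2 - of_int i ^ 2 * \<tau> / 2 - of_int i * z) =
    of_int (i - 1) / 2 - of_int (i - 1) ^ 2 * \<tau> / 2 - of_int (i - 1) * z"
    by (simp add: field_simps power2_eq_square)
  finally show ?case .
qed simp

text \<open>Composing m translations by tau turns the single factors into a Gaussian in m; all signs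
  are collected in e((m + n) / 2).\<close>

lemma lattice_fun_shift:
  assumes "Im \<tau> > 0"
  shows "lattice_fun (z + of_int m * \<tau> + of_int n) \<tau> =
           e2pi (of_int (m + n) / 2 - of_int m ^ 2 * \<tau> / 2 - of_int m * z) * lattice_fun z \<tau>"
proof -
  have "of_int (m + n) / 2 - of_int m ^ 2 * \<tau> / 2 - of_int m * z =
      of_int n / 2 + (of_int m / 2 - of_int m ^ 2 * \<tau> / 2 - of_int m * z)"
    by (simp add: field_simps)
  then show ?thesis
    unfolding lattice_fun_plus_int lattice_fun_plus_tau_int[OF assms] by (simp only: e2pi_add mult.assoc)
qed

lemma lattice_fun_0 [simp]:
  assumes "Im \<tau> > 0"
  shows "lattice_fun 0 \<tau> = 0"
  using qpoch_inf_step[OF norm_e2pi_less_1[OF assms], of 1] by (simp add: lattice_fun_def)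

lemma lattice_fun_eq_0_iff:
  assumes "Im \<tau> > 0"
  shows "lattice_fun z \<tau> = 0 \<longleftrightarrow> (\<exists>m n. z = of_int m * \<tau> + of_int n)"
proof
  assume "\<exists>m n. z = of_int m * \<tau> + of_int n"
  then obtain m n where "z = 0 + of_int m * \<tau> + of_int n" by auto
  then show "lattice_fun z \<tau> = 0"
    using lattice_fun_shift[OF assms, of 0 m n] assms by simp
next
  note q = norm_e2pi_less_1[OF assms]
  assume "lattice_fun z \<tau> = 0"
  then have "qpoch_inf (e2pi z) (e2pi \<tau>) = 0 \<or> qpoch_inf (e2pi (\<tau> - z)) (e2pi \<tau>) = 0"
    using q by (auto simp: lattice_fun_def)
  then obtain k where "e2pi z * e2pi \<tau> ^ k = 1 \<or> e2pi (\<tau> - z) * e2pi \<tau> ^ k = 1"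
    unfolding qpoch_inf_eq_0_iff[OF q] by blast
  then have "z + of_nat k * \<tau> \<in> \<int> \<or> \<tau> - z + of_nat k * \<tau> \<in> \<int>"
    by (simp add: e2pi_power e2pi_add[symmetric] e2pi_eq_1_iff)
  then show "\<exists>m n. z = of_int m * \<tau> + of_int n"
  proof
    assume "z + of_nat k * \<tau> \<in> \<int>"
    then obtain n where "z + of_nat k * \<tau> = of_int n" by (elim Ints_cases)
    then have "z = of_int (- int k) * \<tau> + of_int n" by (simp add: algebra_simps)
    then show ?thesis by blast
  next
    assume "\<tau> - z + of_nat k * \<tau> \<in> \<int>"
    then obtain n where "\<tau> - z + of_nat k * \<tau> = of_int n" by (elim Ints_cases)
    then have "z = of_int (1 + int k) * \<tau> + of_int (- n)" by (simp add: algebra_simps)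
    then show ?thesis by blast
  qed
qed

lemma holomorphic_e2pi [holomorphic_intros]: "f holomorphic_on S \<Longrightarrow> (\<lambda>z. e2pi (f z)) holomorphic_on S"
  unfolding e2pi_def by (intro holomorphic_intros)

lemma holomorphic_lattice_fun:
  assumes "open S" "f holomorphic_on S" "g holomorphic_on S" "\<And>z. z \<in> S \<Longrightarrow> Im (g z) > 0"
  shows "(\<lambda>z. lattice_fun (f z) (g z)) holomorphic_on S"
  unfolding lattice_fun_def
  using assms norm_e2pi_less_1
  by (intro holomorphic_intros holomorphic_qpoch_inf) auto

text \<open>Splitting off the first factor of (e(z);q)_inf leaves sin(pi z) / pi times a function
  with value 1 at 0. This is what the constant i / (2 pi) is chosen for.\<close>

lemma DERIV_lattice_fun_0:
  assumes "Im \<tau> > 0"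
  shows "((\<lambda>z. lattice_fun z \<tau>) has_field_derivative 1) (at 0)"
proof -
  note q = norm_e2pi_less_1[OF assms]
  define R where "R z = qpoch_inf (e2pi z * e2pi \<tau>) (e2pi \<tau>) * qpoch_inf (e2pi (\<tau> - z)) (e2pi \<tau>) / qpoch_inf (e2pi \<tau>) (e2pi \<tau>) ^ 2" for z
  have "R holomorphic_on UNIV"
    unfolding R_def using q by (intro holomorphic_intros holomorphic_qpoch_inf) auto
  then obtain R' where R': "(R has_field_derivative R') (at 0)"
    unfolding holomorphic_on_def field_differentiable_def by auto
  have R0: "R 0 = 1" using q by (simp add: R_def power2_eq_square)
  have eq: "lattice_fun z \<tau> = sin (of_real pi * z) / of_real pi * R z" for z
  proof -
    have "\<i> / (2 * of_real pi) * e2pi (- (z / 2)) * (1 - e2pi z) = sin (of_real pi * z) / of_real pi"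
    proof -
      have "e2pi (- (z / 2)) * e2pi z = e2pi (z / 2)" unfolding e2pi_add[symmetric] by simp
      then have A: "\<i> / (2 * of_real pi) * e2pi (- (z / 2)) * (1 - e2pi z) = \<i> / (2 * of_real pi) * (e2pi (- (z / 2)) - e2pi (z / 2))"
        by (simp add: right_diff_distrib mult.assoc)
      have B: "sin (of_real pi * z) = - (e2pi (- (z / 2)) - e2pi (z / 2)) / (2 * \<i>)"
        unfolding sin_exp_eq e2pi_def by (simp add: mult_ac)
      have C: "\<i> / (2 * of_real pi) * u = (- u) / (2 * \<i>) / of_real pi" for u
        by (simp add: field_simps)
      show ?thesis unfolding A B by (rule C)
    qed
    then show ?thesis
      unfolding lattice_fun_def R_def qpoch_inf_step[OF q, of "e2pi z"] by (metis (no_types, opaque_lifting) mult.assoc times_divide_eq_right)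
  qed
  have "((\<lambda>z. sin (of_real pi * z) / of_real pi * R z) has_field_derivative 1) (at 0)"
    by (rule derivative_eq_intros R' refl | simp add: R0)+
  then show ?thesis unfolding eq[abs_def] .
qed

section \<open>Entire functions with lattice periods\<close>

lemma periodic_of_int:
  fixes h :: "complex \<Rightarrow> 'a"
  assumes "\<And>z. h (z + w) = h z"
  shows "h (z + of_int m * w) = h z"
proof (induction m rule: int_induct[of _ 0])
  case (step1 i)
  then show ?case using assms[of "z + of_int i * w"] by (simp add: ring_distribs add_ac)
next
  case (step2 i)
  then show ?case using assms[of "z + of_int (i - 1) * w"] by (simp add: algebra_simps)
qed simp

lemma elliptic_entire_constant:
  assumes hol: "h holomorphic_on UNIV" and per: "\<And>z. h (z + 1) = h z" "\<And>z. h (z + \<tau>) = h z"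
    and \<tau>: "Im \<tau> > 0"
  shows "h z = h 0"
proof -
  define K where "K = (\<lambda>(s, t). of_real s * \<tau> + of_real t) ` ({0..1} \<times> {0..1::real})"
  have "compact K" unfolding K_def
    by (intro compact_continuous_image compact_Times compact_Icc)
       (auto simp: case_prod_unfold intro!: continuous_intros)
  then have "bounded (h ` K)"
    using hol by (intro compact_imp_bounded compact_continuous_image holomorphic_on_imp_continuous_on)
      (auto intro: holomorphic_on_subset)
  moreover have "range h \<subseteq> h ` K"
  proof safe
    fix z
    define s where "s = Im z / Im \<tau>"
    define t where "t = Re z - s * Re \<tau>"
    have z: "z = of_real s * \<tau> + of_real t"
      using \<tau> by (simp add: complex_eq_iff s_def t_def)
    define u where "u = of_real (frac s) * \<tau> + of_real (frac t)"
    have "u \<in> K" unfolding K_def u_def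
      by (rule image_eqI[of _ _ "(frac s, frac t)"]) (auto simp: frac_lt_1 less_imp_le)
    have "z = u + of_int \<lfloor>s\<rfloor> * \<tau> + of_int \<lfloor>t\<rfloor> * 1"
      by (simp add: z u_def frac_def algebra_simps)
    then have "h z = h u"
      using periodic_of_int[of h, OF per(1)] periodic_of_int[of h, OF per(2)] by metis
    then show "h z \<in> h ` K" using \<open>u \<in> K\<close> by auto
  qed
  ultimately have "bounded (range h)" by (rule bounded_subset)
  with hol have "h constant_on UNIV" by (rule Liouville_theorem)
  then show ?thesis by (auto simp: constant_on_def)
qed

lemma quasi_periodic_unique:
  assumes hol: "f holomorphic_on UNIV" "g holomorphic_on UNIV" and \<tau>: "Im \<tau> > 0"
    and f1: "\<And>z. f (z + 1) = - f z" and f2: "\<And>z. f (z + \<tau>) = \<mu> z * f z"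
    and g1: "\<And>z. g (z + 1) = - g z" and g2: "\<And>z. g (z + \<tau>) = \<mu> z * g z"
    and \<mu>: "\<And>z. \<mu> z \<noteq> 0"
    and zeros: "\<And>z. g z = 0 \<longleftrightarrow> (\<exists>m n. z = of_int m * \<tau> + of_int n)"
    and f0: "f 0 = 0" and deriv: "(f has_field_derivative c) (at 0)" "(g has_field_derivative 1) (at 0)"
  shows "f z = c * g z"
proof -
  define D where "D z = f z - c * g z" for z
  text \<open>On the lattice \<open>h\<close> has the junk value 0, which is also the limit there, since \<open>D\<close> has a double zero.\<close>
  define h where "h z = D z / g z" for z
  have h1: "h (z + 1) = h z" for z by (simp add: h_def D_def f1 g1) (simp add: minus_divide_left diff_divide_distrib)
  have h2: "h (z + \<tau>) = h z" for z
  proof -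
    have "D (z + \<tau>) = \<mu> z * D z" unfolding D_def f2 g2 by (simp add: algebra_simps)
    then show ?thesis using \<mu>[of z] by (simp add: h_def g2)
  qed
  have g0: "g 0 = 0" unfolding zeros by (rule exI[of _ 0], rule exI[of _ 0]) simp
  have holD: "D holomorphic_on UNIV" unfolding D_def[abs_def] by (intro holomorphic_intros hol)
  \<comment> \<open>A disc about 0 of this radius contains no other lattice point: the imaginary
    part forces m = 0, then the modulus forces n = 0.\<close>
  define \<epsilon> where "\<epsilon> = min 1 (Im \<tau>)"
  have \<epsilon>: "\<epsilon> > 0" using \<tau> by (simp add: \<epsilon>_def)
  have nz: "g z \<noteq> 0" if "z \<in> ball 0 \<epsilon> - {0}" for z
  proof
    assume "g z = 0"
    then obtain m n :: int where z: "z = of_int m * \<tau> + of_int n" unfolding zeros by blast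
    have "\<bar>Im z\<bar> < Im \<tau>" using that abs_Im_le_cmod[of z] by (simp add: \<epsilon>_def)
    then have "\<bar>of_int m\<bar> * Im \<tau> < 1 * Im \<tau>" using \<tau> by (simp add: z abs_mult)
    then have "\<bar>of_int m\<bar> < (1::real)" using \<tau> by (simp only: mult_less_cancel_right)
    then have "m = 0" by linarith
    then have "norm z = \<bar>of_int n\<bar>" by (simp add: z)
    moreover have "norm z < 1" using that by (simp add: \<epsilon>_def)
    ultimately have "n = 0" by linarith
    then show False using that \<open>m = 0\<close> z by simp
  qed
  have "((\<lambda>z. (D z - D 0) / (z - 0)) \<longlongrightarrow> c - c * 1) (at 0)"
    using DERIV_diff[OF deriv(1) DERIV_cmult[OF deriv(2), of c]]
    unfolding D_def[symmetric] has_field_derivative_iff by simp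
  then have lD: "((\<lambda>z. D z / z) \<longlongrightarrow> 0) (at 0)" by (simp add: D_def f0 g0)
  have lg: "((\<lambda>z. g z / z) \<longlongrightarrow> 1) (at 0)"
    using deriv(2) unfolding has_field_derivative_iff by (simp add: g0)
  have "((\<lambda>z. (D z / z) / (g z / z)) \<longlongrightarrow> 0 / 1) (at 0)"
    by (intro tendsto_divide lD lg) simp
  then have "(h \<longlongrightarrow> 0 / 1) (at 0)"
    by (rule Lim_transform_eventually) (auto simp: h_def eventually_at_filter)
  then have cont0: "isCont h 0" by (simp add: isCont_def h_def g0)
  have holU: "h holomorphic_on ball 0 \<epsilon> - {0}"
    unfolding h_def[abs_def] using nz
    by (intro holomorphic_intros holomorphic_on_subset[OF holD] holomorphic_on_subset[OF hol(2)]) auto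
  have "continuous_on (ball 0 \<epsilon>) h"
  proof (rule continuous_at_imp_continuous_on, safe)
    fix z :: complex assume z: "z \<in> ball 0 \<epsilon>"
    show "isCont h z"
    proof (cases "z = 0")
      case False
      have "open (ball (0::complex) \<epsilon> - {0})" by (intro open_Diff) auto
      then show ?thesis
        using holomorphic_on_imp_continuous_on[OF holU] z False by (auto simp: continuous_on_eq_continuous_at)
    qed (use cont0 in simp)
  qed
  then have "h holomorphic_on ball 0 \<epsilon>"
    by (rule no_isolated_singularity[OF _ holU]) auto
  then have d0: "h field_differentiable (at 0)"
    using \<epsilon> by (intro holomorphic_on_imp_differentiable_at[of h "ball 0 \<epsilon>"]) auto
  have per: "h (z + of_int m * \<tau> + of_int n * 1) = h z" for z m n
    using periodic_of_int[of h, OF h1] periodic_of_int[of h, OF h2] by metis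
  have "h field_differentiable (at p)" for p
  proof (cases "g p = 0")
    case True
    then obtain m n where p: "p = of_int m * \<tau> + of_int n" unfolding zeros by blast
    have "(\<lambda>z. h (z - p)) = h"
    proof
      fix z show "h (z - p) = h z" using per[of "z - p" m n] by (simp add: p)
    qed
    moreover have "(h \<circ> (\<lambda>z. z - p)) field_differentiable (at p)"
      using d0 by (intro field_differentiable_compose derivative_intros) auto
    ultimately show ?thesis by (simp add: o_def)
  next
    case False
    then show ?thesis unfolding h_def[abs_def]
      using holD hol(2) by (intro field_differentiable_divide) (auto simp: holomorphic_on_def)
  qed
  then have "h holomorphic_on UNIV" by (simp add: holomorphic_on_def)
  then have h0: "h z = h 0" for z by (rule elliptic_entire_constant[OF _ h1 h2 \<tau>])
  have "D z = 0" if "g z \<noteq> 0" for z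
    using h0[of z] that by (simp add: h_def g0)
  moreover have "f z = 0" if "g z = 0" for z
  proof -
    obtain m n where z: "z = 0 + of_int m * \<tau> + of_int n * 1" using \<open>g z = 0\<close> unfolding zeros by auto
    \<comment> \<open>The vanishing of f is itself a doubly periodic predicate, so f 0 = 0 yields
      zeros at all lattice points, where the quotient carries no information about f.\<close>
    have "(f (z + \<tau>) = 0) = (f z = 0)" "(f (z + 1) = 0) = (f z = 0)" for z
      using \<mu>[of z] by (simp_all add: f1 f2)
    then have "(f z = 0) = (f 0 = 0)"
      using periodic_of_int[of "\<lambda>z. f z = 0" 1 "0 + of_int m * \<tau>" n] periodic_of_int[of "\<lambda>z. f z = 0" \<tau> 0 m]
      unfolding z by blast
    then show ?thesis using f0 by simp
  qed
  ultimately show ?thesis by (cases "g z = 0") (auto simp: D_def)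
qed

section \<open>Klein forms\<close>

lemma e2pi_odd_half:
  assumes "odd n"
  shows "e2pi (of_int n / 2) = -1"
proof -
  obtain k where "n = 2 * k + 1" using assms by (elim oddE)
  then have "of_int n / 2 = (of_int k + 1 / 2 :: complex)" by (simp add: field_simps)
  then show ?thesis by (simp only: e2pi_add e2pi_half e2pi_of_int) simp
qed

lemma Im_moebius_pos:
  fixes a b c d :: int
  assumes "a * d - b * c = 1" "Im \<tau> > 0"
  shows "of_int c * \<tau> + of_int d \<noteq> 0" "Im ((of_int a * \<tau> + of_int b) / (of_int c * \<tau> + of_int d)) > 0"
proof -
  define j where "j = of_int c * \<tau> + of_int d"
  show j: "of_int c * \<tau> + of_int d \<noteq> 0"
  proof
    assume *: "of_int c * \<tau> + of_int d = 0"
    then have "of_int c * Im \<tau> = 0" by (simp add: complex_eq_iff)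
    then have "c = 0" using assms by simp
    then have "d = 0" using * by simp
    then show False using assms \<open>c = 0\<close> by simp
  qed
  have "Im ((of_int a * \<tau> + of_int b) * cnj j) = of_int (a * d - b * c) * Im \<tau>"
    by (simp add: j_def algebra_simps)
  also have "\<dots> > 0" using assms by simp
  finally show "Im ((of_int a * \<tau> + of_int b) / (of_int c * \<tau> + of_int d)) > 0"
    unfolding j_def[symmetric] Im_complex_div_gt_0 .
qed

text \<open>The Gaussian e(- c z^2 / (2 j)) corrects the quasi-periods of the left side to those of
  \<open>lattice_fun z \<tau>\<close>, because 1 / j = a - c \<tau>' and \<tau> / j = d \<tau>' - b.
  The constant is fixed by the derivative 1 / j at 0, so no root of unity can appear.\<close>

lemma lattice_fun_modular:
  fixes a b c d :: int
  assumes det: "a * d - b * c = 1" and \<tau>: "Im \<tau> > 0"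
  defines "j \<equiv> of_int c * \<tau> + of_int d"
  defines "\<tau>' \<equiv> (of_int a * \<tau> + of_int b) / j"
  shows "lattice_fun (z / j) \<tau>' = e2pi (of_int c * z\<^sup>2 / (2 * j)) / j * lattice_fun z \<tau>"
proof -
  have j: "j \<noteq> 0" and \<tau>': "Im \<tau>' > 0"
    using Im_moebius_pos[OF det \<tau>] by (simp_all add: j_def \<tau>'_def)
  define f where "f z = lattice_fun (z / j) \<tau>' * e2pi (- (of_int c * z\<^sup>2 / (2 * j)))" for z
  have detC: "of_int a * of_int d = 1 + of_int b * (of_int c :: complex)"
    using arg_cong[OF det, of "of_int :: int \<Rightarrow> complex"] by (simp add: algebra_simps)
  have j\<tau>': "\<tau>' * j = of_int a * \<tau> + of_int b" using j by (simp add: \<tau>'_def)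
  \<comment> \<open>These are the exponents of the signs in the two quasi-periods. They are odd
    since neither a, c nor b, d are both even.\<close>
  have odd: "odd (a - c - a * c)" "odd (d - b - b * d)"
  proof -
    have "odd (a * d - b * c)" using det by simp
    then show "odd (a - c - a * c)" "odd (d - b - b * d)" by auto
  qed
  have 1: "f (z + 1) = - f z" for z
  proof -
    have inv: "1 / j = of_int a - of_int c * \<tau>'"
    proof -
      have "(of_int a - of_int c * \<tau>') * j = of_int a * j - of_int c * (\<tau>' * j)" by (simp add: algebra_simps)
      also have "\<dots> = 1" unfolding j\<tau>' using detC by (simp add: j_def algebra_simps)
      finally show ?thesis using j by (simp add: field_simps)
    qed
    have "(z + 1) / j = z / j + of_int (- c) * \<tau>' + of_int a"
      using inv by (simp add: add_divide_distrib)
    then have "f (z + 1) = e2pi (of_int (- c + a) / 2 - of_int (- c) ^ 2 * \<tau>' / 2 - of_int (- c) * (z / j)) *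
        lattice_fun (z / j) \<tau>' * e2pi (- (of_int c * (z + 1)\<^sup>2 / (2 * j)))"
      unfolding f_def by (simp only: lattice_fun_shift[OF \<tau>'])
    also have "\<dots> = lattice_fun (z / j) \<tau>' * e2pi (of_int (- c + a) / 2 - of_int (- c) ^ 2 * \<tau>' / 2 - of_int (- c) * (z / j) + - (of_int c * (z + 1)\<^sup>2 / (2 * j)))"
      by (simp only: e2pi_add mult_ac)
    also have "of_int (- c + a) / 2 - of_int (- c) ^ 2 * \<tau>' / 2 - of_int (- c) * (z / j) + - (of_int c * (z + 1)\<^sup>2 / (2 * j))
       = of_int (a - c - a * c) / 2 + - (of_int c * z\<^sup>2 / (2 * j))"
    proof -
      have "- (of_int c * (z + 1)\<^sup>2 / (2 * j)) = - (of_int c * z\<^sup>2 / (2 * j)) - of_int c * (z / j) - of_int c / 2 * (1 / j)"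
        using j by (simp add: field_simps power2_eq_square)
      also have "1 / j = of_int a - of_int c * \<tau>'" by (rule inv)
      finally have E: "- (of_int c * (z + 1)\<^sup>2 / (2 * j)) =
        - (of_int c * z\<^sup>2 / (2 * j)) - of_int c * (z / j) - of_int c / 2 * (of_int a - of_int c * \<tau>')" .
      have "of_int (- c + a) / 2 - of_int (- c) ^ 2 * T / 2 - of_int (- c) * Y + (- X - of_int c * Y - of_int c / 2 * (of_int a - of_int c * T))
          = of_int (a - c - a * c) / 2 + - X" for X Y T :: complex
        by (simp add: field_simps power2_eq_square)
      then show ?thesis unfolding E .
    qed
    also have "e2pi (of_int (a - c - a * c) / 2 + - (of_int c * z\<^sup>2 / (2 * j))) = - e2pi (- (of_int c * z\<^sup>2 / (2 * j)))"
      unfolding e2pi_add e2pi_odd_half[OF odd(1)] by simp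
    finally show ?thesis by (simp add: f_def)
  qed
  have 2: "f (z + \<tau>) = - e2pi (- \<tau> / 2 - z) * f z" for z
  proof -
    have \<tau>j: "\<tau> / j = of_int d * \<tau>' - of_int b"
    proof -
      have "(of_int d * \<tau>' - of_int b) * j = of_int d * (\<tau>' * j) - of_int b * j" by (simp add: algebra_simps)
      also have "\<dots> = of_int a * of_int d * \<tau> - of_int b * of_int c * \<tau>"
        unfolding j\<tau>' by (simp add: j_def algebra_simps)
      also have "\<dots> = \<tau>" unfolding detC by (simp add: algebra_simps)
      finally show ?thesis using j by (simp add: field_simps)
    qed
    have "(z + \<tau>) / j = z / j + of_int d * \<tau>' + of_int (- b)"
      using \<tau>j by (simp add: add_divide_distrib)
    then have "f (z + \<tau>) = e2pi (of_int (d + - b) / 2 - of_int d ^ 2 * \<tau>' / 2 - of_int d * (z / j)) *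
        lattice_fun (z / j) \<tau>' * e2pi (- (of_int c * (z + \<tau>)\<^sup>2 / (2 * j)))"
      unfolding f_def by (simp only: lattice_fun_shift[OF \<tau>'])
    also have "\<dots> = lattice_fun (z / j) \<tau>' * e2pi (of_int (d + - b) / 2 - of_int d ^ 2 * \<tau>' / 2 - of_int d * (z / j) + - (of_int c * (z + \<tau>)\<^sup>2 / (2 * j)))"
      by (simp only: e2pi_add mult_ac)
    also have "of_int (d + - b) / 2 - of_int d ^ 2 * \<tau>' / 2 - of_int d * (z / j) + - (of_int c * (z + \<tau>)\<^sup>2 / (2 * j))
       = of_int (d - b - b * d) / 2 + (- \<tau> / 2 - z) + - (of_int c * z\<^sup>2 / (2 * j))"
    proof -
      have e1: "of_int d ^ 2 * \<tau>' + of_int c * \<tau>\<^sup>2 / j = \<tau> + of_int b * of_int d"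
      proof -
        have "(of_int d ^ 2 * \<tau>' + of_int c * \<tau>\<^sup>2 / j) * j = of_int d ^ 2 * (\<tau>' * j) + of_int c * \<tau>\<^sup>2"
          using j by (simp add: algebra_simps)
        also have "\<dots> = (of_int a * of_int d) * of_int d * \<tau> + of_int b * of_int d ^ 2 + of_int c * \<tau>\<^sup>2"
          unfolding j\<tau>' by (simp add: algebra_simps power2_eq_square)
        also have "\<dots> = (\<tau> + of_int b * of_int d) * j"
          unfolding detC by (simp add: j_def algebra_simps power2_eq_square)
        finally show ?thesis using j by simp
      qed
      have e2: "of_int d * (z / j) + of_int c * \<tau> * z / j = z"
      proof -
        have "of_int d * (z / j) + of_int c * \<tau> * z / j = j * z / j"
          by (simp add: j_def algebra_simps add_divide_distrib)
        then show ?thesis using j by simp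
      qed
      have "- (of_int c * (z + \<tau>)\<^sup>2 / (2 * j)) = - (of_int c * z\<^sup>2 / (2 * j)) - of_int c * \<tau> * z / j - (of_int c * \<tau>\<^sup>2 / j) / 2"
        using j by (simp add: field_simps power2_eq_square)
      also have "of_int c * \<tau>\<^sup>2 / j = \<tau> + of_int b * of_int d - of_int d ^ 2 * \<tau>'" using e1 by (simp add: algebra_simps)
      also have "of_int c * \<tau> * z / j = z - of_int d * (z / j)" using e2 by (simp add: algebra_simps)
      finally have E: "- (of_int c * (z + \<tau>)\<^sup>2 / (2 * j)) = - (of_int c * z\<^sup>2 / (2 * j)) - (z - of_int d * (z / j)) -
         (\<tau> + of_int b * of_int d - of_int d ^ 2 * \<tau>') / 2" .
      have "of_int (d + - b) / 2 - of_int d ^ 2 * T / 2 - of_int d * Y + (- X - (z - of_int d * Y) - (\<tau> + of_int b * of_int d - of_int d ^ 2 * T) / 2)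
          = of_int (d - b - b * d) / 2 + (- \<tau> / 2 - z) + - X" for X Y T :: complex
        by (simp add: field_simps power2_eq_square)
      then show ?thesis unfolding E .
    qed
    also have "e2pi (of_int (d - b - b * d) / 2 + (- \<tau> / 2 - z) + - (of_int c * z\<^sup>2 / (2 * j))) = - e2pi (- \<tau> / 2 - z) * e2pi (- (of_int c * z\<^sup>2 / (2 * j)))"
      unfolding e2pi_add e2pi_odd_half[OF odd(2)] by simp
    finally show ?thesis by (simp add: f_def)
  qed
  have "f z = 1 / j * lattice_fun z \<tau>"
  proof (rule quasi_periodic_unique[of f "\<lambda>z. lattice_fun z \<tau>" \<tau> "\<lambda>z. - e2pi (- \<tau> / 2 - z)"])
    show "f holomorphic_on UNIV" unfolding f_def using j \<tau>'
      by (intro holomorphic_intros holomorphic_lattice_fun) auto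
    show "(\<lambda>z. lattice_fun z \<tau>) holomorphic_on UNIV" using \<tau>
      by (intro holomorphic_intros holomorphic_lattice_fun) auto
    show "f 0 = 0" using \<tau>' by (simp add: f_def)
    have "((\<lambda>z. lattice_fun z \<tau>') has_field_derivative 1) (at (0 / j))"
      using DERIV_lattice_fun_0[OF \<tau>'] by simp
    then have d: "((\<lambda>z. lattice_fun (z / j) \<tau>') has_field_derivative (1 * (1 / j))) (at 0)"
      by (rule DERIV_chain2) (use j in \<open>auto intro!: derivative_eq_intros\<close>)
    have e: "((\<lambda>z. e2pi (- (of_int c * z\<^sup>2 / (2 * j)))) has_field_derivative 0) (at 0)"
      unfolding e2pi_def using j by (auto intro!: derivative_eq_intros)
    show "(f has_field_derivative 1 / j) (at 0)"
      using DERIV_mult[OF d e] unfolding f_def[symmetric] by simp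
  qed (use \<tau> 1 2 lattice_fun_plus_1 lattice_fun_plus_tau lattice_fun_eq_0_iff DERIV_lattice_fun_0 in auto)
  then show ?thesis
    using j by (simp add: f_def e2pi_minus field_simps)
qed

text \<open>The usual Klein form with characteristic (r, s); its expansion starts with the power r
  (r - 1) / 2 of the nome. The exponential factor is the one that absorbs the Gaussian in the
  modular law of \<open>lattice_fun\<close>.\<close>

definition klein :: "rat \<Rightarrow> rat \<Rightarrow> complex \<Rightarrow> complex" where
  "klein r s \<tau> = e2pi (of_rat r * (of_rat r * \<tau> + of_rat s) / 2) * lattice_fun (of_rat r * \<tau> + of_rat s) \<tau>"

text \<open>The characteristic moves as a row vector multiplied by the matrix. The exponents merge
  because R + c z = R' j, which turns R z / (2 j) + c z^2 / (2 j) into R' z / 2.\<close>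

lemma klein_modular:
  fixes a b c d :: int
  assumes det: "a * d - b * c = 1" and \<tau>: "Im \<tau> > 0"
  defines "j \<equiv> of_int c * \<tau> + of_int d"
  shows "klein r s ((of_int a * \<tau> + of_int b) / j) =
           klein (r * of_int a + s * of_int c) (r * of_int b + s * of_int d) \<tau> / j"
proof -
  define \<tau>' where "\<tau>' = (of_int a * \<tau> + of_int b) / j"
  define R S :: complex where "R = of_rat r" and "S = of_rat s"
  define R' S' where "R' = R * of_int a + S * of_int c" and "S' = R * of_int b + S * of_int d"
  define z where "z = R' * \<tau> + S'"
  have j: "j \<noteq> 0" and \<tau>': "Im \<tau>' > 0"
    using Im_moebius_pos[OF det \<tau>] by (simp_all add: j_def \<tau>'_def)
  have detC: "of_int a * of_int d = 1 + of_int b * (of_int c :: complex)"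
    using arg_cong[OF det, of "of_int :: int \<Rightarrow> complex"] by (simp add: algebra_simps)
  have zj: "R * \<tau>' + S = z / j"
    using j by (simp add: \<tau>'_def z_def R'_def S'_def j_def field_simps)
  have Rj: "R + of_int c * z = R' * j"
  proof -
    have "R' * j = R * (of_int a * of_int d) + R * of_int a * of_int c * \<tau> + S * of_int c * j"
      by (simp add: R'_def j_def algebra_simps)
    then show ?thesis unfolding detC by (simp add: z_def R'_def S'_def j_def algebra_simps)
  qed
  have e: "R * (z / j) / 2 + of_int c * z\<^sup>2 / (2 * j) = R' * z / 2"
  proof -
    have "R * (z / j) / 2 + of_int c * z\<^sup>2 / (2 * j) = (R + of_int c * z) * z / (2 * j)"
      using j by (simp add: field_simps power2_eq_square)
    then show ?thesis unfolding Rj using j by simp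
  qed
  have "klein r s \<tau>' = e2pi (R * (z / j) / 2) * lattice_fun (z / j) \<tau>'"
    unfolding klein_def R_def[symmetric] S_def[symmetric] zj ..
  also have "\<dots> = e2pi (R * (z / j) / 2 + of_int c * z\<^sup>2 / (2 * j)) * lattice_fun z \<tau> / j"
    using lattice_fun_modular[OF det \<tau>, of z] by (simp add: j_def[symmetric] \<tau>'_def e2pi_add)
  also have "\<dots> = klein (r * of_int a + s * of_int c) (r * of_int b + s * of_int d) \<tau> / j"
    unfolding e klein_def by (simp add: z_def R'_def S'_def R_def S_def of_rat_add of_rat_mult)
  finally show ?thesis by (simp add: \<tau>'_def)
qed

text \<open>The dependence on tau cancels between the Gaussian of \<open>lattice_fun_shift\<close>
  and the exponential of the Klein form. What is left is the sign (-1)^(m + n + m n) and the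
  symplectic pairing r n - s m.\<close>

lemma klein_shift:
  assumes "Im \<tau> > 0"
  shows "klein (r + of_int m) (s + of_int n) \<tau> =
    e2pi (of_int (m + n + m * n) / 2 + (of_rat r * of_int n - of_rat s * of_int m) / 2) * klein r s \<tau>"
proof -
  define R S :: complex where "R = of_rat r" and "S = of_rat s"
  define z where "z = R * \<tau> + S"
  have z': "(R + of_int m) * \<tau> + (S + of_int n) = z + of_int m * \<tau> + of_int n"
    by (simp add: z_def algebra_simps)
  have "klein (r + of_int m) (s + of_int n) \<tau> = e2pi ((R + of_int m) * (z + of_int m * \<tau> + of_int n) / 2) *
     (e2pi (of_int (m + n) / 2 - of_int m ^ 2 * \<tau> / 2 - of_int m * z) * lattice_fun z \<tau>)"
    unfolding klein_def of_rat_add of_rat_of_int_eq R_def[symmetric] S_def[symmetric] z' lattice_fun_shift[OF assms] ..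
  also have "\<dots> = e2pi ((R + of_int m) * (z + of_int m * \<tau> + of_int n) / 2 + (of_int (m + n) / 2 - of_int m ^ 2 * \<tau> / 2 - of_int m * z)) * lattice_fun z \<tau>"
    by (simp add: e2pi_add)
  also have "(R + of_int m) * (z + of_int m * \<tau> + of_int n) / 2 + (of_int (m + n) / 2 - of_int m ^ 2 * \<tau> / 2 - of_int m * z)
    = of_int (m + n + m * n) / 2 + (R * of_int n - S * of_int m) / 2 + R * z / 2"
    by (simp add: z_def field_simps power2_eq_square)
  finally show ?thesis
    by (simp add: e2pi_add klein_def R_def[symmetric] S_def[symmetric] z_def)
qed

lemma klein_nonzero:
  assumes "Im \<tau> > 0" "0 < r \<and> r < 1 \<or> 0 < s \<and> s < 1"
  shows "klein r s \<tau> \<noteq> 0"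
proof
  assume "klein r s \<tau> = 0"
  then obtain m n :: int where *: "of_rat r * \<tau> + of_rat s = of_int m * \<tau> + of_int n"
    using lattice_fun_eq_0_iff[OF assms(1)] by (auto simp: klein_def)
  have Im_rat: "Im (of_rat x) = 0" "Re (of_rat x) = of_rat x" for x
  proof -
    have "of_rat x = complex_of_real (of_rat x)" by (induction x) (simp add: of_rat_rat)
    then show "Im (of_rat x) = 0" "Re (of_rat x) = of_rat x" by simp_all
  qed
  have "of_rat r * Im \<tau> = of_int m * Im \<tau>" using arg_cong[OF *, of Im] by (simp add: Im_rat)
  then have "of_rat r = (of_rat (of_int m) :: real)" using assms by simp
  then have r: "r = of_int m" unfolding of_rat_eq_iff .
  then have "of_rat s = (of_rat (of_int n) :: complex)" using * by simp
  then have s: "s = of_int n" unfolding of_rat_eq_iff .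
  have "\<not> ((0::rat) < of_int k \<and> of_int k < (1::rat))" for k :: int by simp
  then show False using assms(2) r s by blast
qed

lemma holomorphic_klein:
  assumes "open S" "f holomorphic_on S" "\<And>z. z \<in> S \<Longrightarrow> Im (f z) > 0"
  shows "(\<lambda>z. klein r s (f z)) holomorphic_on S"
  unfolding klein_def using assms by (intro holomorphic_intros holomorphic_lattice_fun) auto

section \<open>Modularity of products of Klein forms\<close>

lemma meromorphic_at_ii_inf_cong:
  assumes "meromorphic_at_ii_inf f" "\<And>\<tau>. Im \<tau> > 0 \<Longrightarrow> g \<tau> = f \<tau>"
  shows "meromorphic_at_ii_inf g"
proof -
  from assms(1) obtain h F Y where *: "h > 0" "F meromorphic_on {0}" "Y > 0"
      "\<And>\<tau>. Im \<tau> > Y \<Longrightarrow> f \<tau> = F (qpow \<tau> (1 / of_nat h))"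
    unfolding meromorphic_at_ii_inf_def by blast
  then have "\<forall>\<tau>. Im \<tau> > Y \<longrightarrow> g \<tau> = F (qpow \<tau> (1 / of_nat h))" using assms(2) by force
  then show ?thesis unfolding meromorphic_at_ii_inf_def using * by blast
qed

lemma meromorphic_at_ii_inf_const: "meromorphic_at_ii_inf (\<lambda>_. c)"
  unfolding meromorphic_at_ii_inf_def
  by (rule exI[of _ 1], simp, rule exI[of _ "\<lambda>_. c"]) (auto intro: exI[of _ 1])

lemma qpow_power: "qpow \<tau> x ^ n = qpow \<tau> (of_nat n * x)"
  by (simp add: qpow_eq_e2pi e2pi_power of_rat_mult mult_ac)

text \<open>Local parameters of widths h and k are both powers of the one of width h k.\<close>

lemma meromorphic_at_ii_inf_mult:
  assumes "meromorphic_at_ii_inf f" "meromorphic_at_ii_inf g"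
  shows "meromorphic_at_ii_inf (\<lambda>\<tau>. f \<tau> * g \<tau>)"
proof -
  from assms(1) obtain h F Y where 1: "h > 0" "F meromorphic_on {0}" "Y > 0"
      "\<And>\<tau>. Im \<tau> > Y \<Longrightarrow> f \<tau> = F (qpow \<tau> (1 / of_nat h))"
    unfolding meromorphic_at_ii_inf_def by blast
  from assms(2) obtain k G Z where 2: "k > 0" "G meromorphic_on {0}" "Z > 0"
      "\<And>\<tau>. Im \<tau> > Z \<Longrightarrow> g \<tau> = G (qpow \<tau> (1 / of_nat k))"
    unfolding meromorphic_at_ii_inf_def by blast
  have "(\<lambda>Q. F (Q ^ k) * G (Q ^ h)) meromorphic_on {0}"
    using 1(1) 2(1)
    by (intro meromorphic_intros meromorphic_on_compose[OF 1(2)] meromorphic_on_compose[OF 2(2)] analytic_intros)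
       (auto simp: power_0_left)
  moreover have "f \<tau> * g \<tau> = F (qpow \<tau> (1 / of_nat (h * k)) ^ k) * G (qpow \<tau> (1 / of_nat (h * k)) ^ h)"
    if "Im \<tau> > max Y Z" for \<tau>
    using that 1(1,4) 2(1,4) by (simp add: qpow_power)
  ultimately show ?thesis
    unfolding meromorphic_at_ii_inf_def using 1(1,3) 2(1,3)
    by (intro exI[of _ "h * k"] conjI exI[of _ "\<lambda>Q. F (Q ^ k) * G (Q ^ h)"] exI[of _ "max Y Z"]) auto
qed

lemma meromorphic_at_ii_inf_powi:
  assumes "meromorphic_at_ii_inf f"
  shows "meromorphic_at_ii_inf (\<lambda>\<tau>. f \<tau> powi n)"
proof -
  from assms obtain h F Y where 1: "h > 0" "F meromorphic_on {0}" "Y > 0"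
      "\<And>\<tau>. Im \<tau> > Y \<Longrightarrow> f \<tau> = F (qpow \<tau> (1 / of_nat h))"
    unfolding meromorphic_at_ii_inf_def by blast
  then show ?thesis unfolding meromorphic_at_ii_inf_def
    by (intro exI[of _ h] conjI exI[of _ "\<lambda>Q. F Q powi n"] exI[of _ Y]) (auto intro!: meromorphic_intros)
qed

lemma meromorphic_at_ii_inf_prod_list:
  assumes "\<And>x. x \<in> set xs \<Longrightarrow> meromorphic_at_ii_inf (f x)"
  shows "meromorphic_at_ii_inf (\<lambda>\<tau>. \<Prod>x\<leftarrow>xs. f x \<tau>)"
  using assms by (induction xs) (auto intro!: meromorphic_at_ii_inf_const meromorphic_at_ii_inf_mult)

lemma norm_e2pi_of_real: "norm (e2pi (of_real x)) = 1"
  by (simp add: norm_e2pi)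

lemma of_rat_eq_of_real: "(of_rat x :: complex) = of_real (of_rat x)"
  by (induction x) (simp add: of_rat_rat)

text \<open>For 0 <= r < 1 both theta factors involve only nonnegative powers of the local parameter
  Q and are analytic at Q = 0. The only possible pole comes from the explicit power
  \<open>Q powi k3\<close>.\<close>

lemma meromorphic_at_ii_inf_klein_reduced:
  fixes A D :: nat and B :: int
  assumes "0 \<le> r" "r < 1" "A > 0" "D > 0"
  shows "meromorphic_at_ii_inf (\<lambda>\<tau>. klein r s ((of_nat A * \<tau> + of_int B) / of_nat D))"
proof -
  obtain p' n' where pn: "r = of_int p' / of_int n'" "n' > 0"
    using quotient_of_div[of r] quotient_of_denom_pos[of r] by (cases "quotient_of r") blast
  define p n where "p = nat p'" and "n = nat n'"
  have p'n': "p' \<ge> 0" "p' \<le> n'"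
    using assms(1,2) pn by (simp_all add: zero_le_divide_iff divide_less_eq)
  have r: "r = of_nat p / of_nat n" and n: "n > 0" and pn': "p \<le> n"
    using pn p'n' by (simp_all add: p_def n_def)
  define R S :: complex where "R = of_rat r" and "S = of_rat s"
  have R: "R = of_nat p / of_nat n" by (simp add: R_def r of_rat_divide)
  \<comment> \<open>The exponent r (r - 1) / 2 * A / D has denominator dividing 2 n^2 D, and the
    other exponents need less.\<close>
  define h where "h = 2 * n\<^sup>2 * D"
  have h: "h > 0" using n assms by (simp add: h_def)
  define c0 c1 c2 c3 where "c0 = e2pi (of_int B / of_nat D)"
    and "c1 = e2pi (R * (of_int B / of_nat D) + S)"
    and "c2 = e2pi (of_int B / of_nat D - (R * (of_int B / of_nat D) + S))"
    and "c3 = e2pi ((R - 1) * (R * (of_int B / of_nat D) + S) / 2)"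
  define k0 k1 k2 where "k0 = 2 * n\<^sup>2 * A" and "k1 = 2 * n * p * A" and "k2 = 2 * n * (n - p) * A"
  define k3 where "k3 = (int p - int n) * int p * int A"
  define F where "F Q = \<i> / (2 * of_real pi) * (c3 * Q powi k3) * qpoch_inf (c1 * Q ^ k1) (c0 * Q ^ k0) *
     qpoch_inf (c2 * Q ^ k2) (c0 * Q ^ k0) / qpoch_inf (c0 * Q ^ k0) (c0 * Q ^ k0) ^ 2" for Q
  have "norm c0 = 1"
    unfolding c0_def using norm_e2pi_of_real[of "of_int B / of_nat D"] by simp
  then have c0: "norm (c0 * Q ^ k0) < 1" if "norm Q < 1" for Q
    using norm_power_less_1[OF that, of k0] n assms by (simp add: norm_mult k0_def)
  have "F meromorphic_on {0}"
  proof -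
    have "(\<lambda>Q. qpoch_inf (c * Q ^ k) (c0 * Q ^ k0)) analytic_on {0}" for c k
      unfolding analytic_at
      by (rule exI[of _ "ball 0 1"]) (use c0 in \<open>auto intro!: holomorphic_qpoch_inf holomorphic_intros\<close>)
    note analytic_on_imp_meromorphic_on[OF this]
    then show ?thesis unfolding F_def[abs_def] by (intro meromorphic_intros)
  qed
  moreover have "klein r s ((of_nat A * \<tau> + of_int B) / of_nat D) = F (qpow \<tau> (1 / of_nat h))" for \<tau>
  proof -
    define Q where "Q = qpow \<tau> (1 / of_nat h)"
    have Q: "Q = e2pi (\<tau> / of_nat h)" by (simp add: Q_def qpow_eq_e2pi of_rat_divide)
    define T where "T = (of_nat A * \<tau> + of_int B) / of_nat D"
    have nz: "of_nat n \<noteq> (0::complex)" "of_nat D \<noteq> (0::complex)" using n assms by auto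
    have T: "T = of_nat A * \<tau> / of_nat D + of_int B / of_nat D" by (simp add: T_def add_divide_distrib)
    have e0: "e2pi T = c0 * Q ^ k0"
      unfolding Q e2pi_power c0_def e2pi_add[symmetric]
      by (rule arg_cong[of _ _ e2pi]) (use nz in \<open>simp add: T k0_def h_def field_simps\<close>)
    have e1: "e2pi (R * T + S) = c1 * Q ^ k1"
      unfolding Q e2pi_power c1_def e2pi_add[symmetric]
      by (rule arg_cong[of _ _ e2pi]) (use nz in \<open>simp add: T k1_def h_def R field_simps power2_eq_square\<close>)
    have e2: "e2pi (T - (R * T + S)) = c2 * Q ^ k2"
      unfolding Q e2pi_power c2_def e2pi_add[symmetric]
      by (rule arg_cong[of _ _ e2pi]) (use nz pn' in \<open>simp add: T k2_def h_def R of_nat_diff field_simps power2_eq_square\<close>)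
    have e3: "e2pi (R * (R * T + S) / 2) * e2pi (- ((R * T + S) / 2)) = c3 * Q powi k3"
      unfolding Q e2pi_powi c3_def e2pi_add[symmetric]
      by (rule arg_cong[of _ _ e2pi]) (use nz in \<open>simp add: T k3_def h_def R field_simps power2_eq_square\<close>)
    have "klein r s T = \<i> / (2 * of_real pi) * (e2pi (R * (R * T + S) / 2) * e2pi (- ((R * T + S) / 2))) *
      qpoch_inf (e2pi (R * T + S)) (e2pi T) * qpoch_inf (e2pi (T - (R * T + S))) (e2pi T) / qpoch_inf (e2pi T) (e2pi T) ^ 2"
      by (simp add: klein_def lattice_fun_def R_def S_def)
    then show ?thesis unfolding e0 e1 e2 e3 by (simp add: F_def Q_def T_def)
  qed
  ultimately show ?thesis
    unfolding meromorphic_at_ii_inf_def using h by (intro exI[of _ h] conjI exI[of _ F] exI[of _ 1]) auto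
qed

text \<open>The integer part of r is translated away at the cost of a constant; s affects only
  constant coefficients of the expansion.\<close>

lemma meromorphic_at_ii_inf_klein:
  fixes A D :: nat and B :: int
  assumes "A > 0" "D > 0"
  shows "meromorphic_at_ii_inf (\<lambda>\<tau>. klein r s ((of_nat A * \<tau> + of_int B) / of_nat D))"
proof -
  define c where "c = e2pi (of_int (\<lfloor>r\<rfloor> + 0 + \<lfloor>r\<rfloor> * 0) / 2 + (of_rat (frac r) * of_int 0 - of_rat s * of_int \<lfloor>r\<rfloor>) / 2)"
  have "meromorphic_at_ii_inf (\<lambda>\<tau>. c * klein (frac r) s ((of_nat A * \<tau> + of_int B) / of_nat D))"
    by (intro meromorphic_at_ii_inf_mult meromorphic_at_ii_inf_const meromorphic_at_ii_inf_klein_reduced assms frac_lt_1 frac_ge_0)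
  then show ?thesis
  proof (rule meromorphic_at_ii_inf_cong)
    fix \<tau> :: complex assume "Im \<tau> > 0"
    then have "Im ((of_nat A * \<tau> + of_int B) / of_nat D) > 0"
      using assms by (simp add: Im_divide_of_nat)
    from klein_shift[OF this, of "frac r" "\<lfloor>r\<rfloor>" s 0]
    show "klein r s ((of_nat A * \<tau> + of_int B) / of_nat D) = c * klein (frac r) s ((of_nat A * \<tau> + of_int B) / of_nat D)"
      by (simp add: frac_def c_def)
  qed
qed

definition klein_prod :: "(rat \<times> rat \<times> int) list \<Rightarrow> complex \<Rightarrow> complex" where
  "klein_prod L \<tau> = (\<Prod>(r, s, e)\<leftarrow>L. klein r s \<tau> powi e)"

lemma klein_prod_modular:
  fixes a b c d :: int
  assumes det: "a * d - b * c = 1" and \<tau>: "Im \<tau> > 0" and L: "(\<Sum>(r, s, e)\<leftarrow>L. e) = 0"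
  shows "klein_prod L ((of_int a * \<tau> + of_int b) / (of_int c * \<tau> + of_int d)) =
    klein_prod (map (\<lambda>(r, s, e). (r * of_int a + s * of_int c, r * of_int b + s * of_int d, e)) L) \<tau>"
proof -
  define j where "j = of_int c * \<tau> + of_int d"
  have j: "j \<noteq> 0" using Im_moebius_pos[OF det \<tau>] by (simp add: j_def)
  have "klein_prod L ((of_int a * \<tau> + of_int b) / j) =
    j powi (- (\<Sum>(r, s, e)\<leftarrow>L. e)) * klein_prod (map (\<lambda>(r, s, e). (r * of_int a + s * of_int c, r * of_int b + s * of_int d, e)) L) \<tau>"
  proof (induction L)
    case (Cons x L)
    obtain r s e where x: "x = (r, s, e)" by (cases x)
    have "klein r s ((of_int a * \<tau> + of_int b) / j) powi e =
        klein (r * of_int a + s * of_int c) (r * of_int b + s * of_int d) \<tau> powi e * j powi (- e)"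
      unfolding j_def klein_modular[OF det \<tau>] by (simp add: power_int_divide_distrib power_int_minus) (simp add: divide_inverse)
    moreover have "j powi (- e - S) = j powi (- e) * j powi (- S)" for S
      using j power_int_add[of j "- e" "- S"] by simp
    ultimately show ?case using Cons unfolding klein_prod_def x by (simp add: mult_ac)
  qed (simp add: klein_prod_def)
  then show ?thesis using L by (simp add: j_def)
qed

text \<open>Even m and n remove the sign of \<open>klein_shift\<close>, and the pairing r n - s m
  then matters only modulo 2. The representative \<theta> is left to the caller, who takes one that
  is quadratic in (r, s), so that its weighted sum is easy to evaluate.\<close>

lemma klein_prod_shift:
  assumes \<tau>: "Im \<tau> > 0"
    and mn: "\<And>r s e. (r, s, e) \<in> set L \<Longrightarrow> \<exists>m n. even m \<and> even n \<and> f r s = (r + of_int m, s + of_int n) \<and>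
        (\<exists>k::int. (r * of_int n - s * of_int m) = \<theta> r s + 2 * of_int k)"
  shows "klein_prod (map (\<lambda>(r, s, e). (fst (f r s), snd (f r s), e)) L) \<tau> =
      e2pi (of_rat (\<Sum>(r, s, e)\<leftarrow>L. of_int e * \<theta> r s) / 2) * klein_prod L \<tau>"
  using mn
proof (induction L)
  case (Cons x L)
  obtain r s e where x: "x = (r, s, e)" by (cases x)
  obtain m n k :: int where mn: "even m" "even n" "f r s = (r + of_int m, s + of_int n)"
    "r * of_int n - s * of_int m = \<theta> r s + 2 * of_int k"
    using Cons.prems[of r s e] x by auto
  have th: "of_rat r * of_int n - of_rat s * of_int m = (of_rat (\<theta> r s) + 2 * of_int k :: complex)"
    using arg_cong[OF mn(4), of "of_rat :: rat \<Rightarrow> complex"] by (simp add: of_rat_diff of_rat_mult of_rat_add)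
  have "even (m + n + m * n)" using mn(1,2) by simp
  then obtain l where l: "m + n + m * n = 2 * l" by (rule evenE)
  have "klein (fst (f r s)) (snd (f r s)) \<tau> = e2pi (of_rat (\<theta> r s) / 2) * klein r s \<tau>"
  proof -
    have "of_int (m + n + m * n) / 2 + (of_rat r * of_int n - of_rat s * of_int m) / 2 = (of_int (l + k) + of_rat (\<theta> r s) / 2 :: complex)"
      unfolding l th by (simp add: field_simps)
    then have "e2pi (of_int (m + n + m * n) / 2 + (of_rat r * of_int n - of_rat s * of_int m) / 2) = e2pi (of_rat (\<theta> r s) / 2)"
      by (simp only: e2pi_add e2pi_of_int mult_1)
    then show ?thesis unfolding mn(3) by (simp add: klein_shift[OF \<tau>])
  qed
  then have 1: "klein (fst (f r s)) (snd (f r s)) \<tau> powi e = e2pi (of_rat (of_int e * \<theta> r s) / 2) * klein r s \<tau> powi e"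
    by (simp add: power_int_mult_distrib e2pi_powi of_rat_mult)
  have 2: "e2pi (of_rat (x + y) / 2) = e2pi (of_rat x / 2) * e2pi (of_rat y / 2)" for x y
    by (simp add: of_rat_add add_divide_distrib e2pi_add)
  have "klein_prod (map (\<lambda>(r, s, e). (fst (f r s), snd (f r s), e)) L) \<tau> =
      e2pi (of_rat (\<Sum>(r, s, e)\<leftarrow>L. of_int e * \<theta> r s) / 2) * klein_prod L \<tau>"
    by (rule Cons.IH, erule Cons.prems[OF list.set_intros(2)])
  then show ?case using 1 unfolding x
    by (simp add: klein_prod_def 2 mult_ac)
qed (simp add: klein_prod_def)

text \<open>The matrix \<open>(D a, D b; c, d)\<close> factors as \<open>(a', -v; c', u) (g, B; 0, D')\<close> with the first factor in \<open>SL\<^sub>2(\<int>)\<close>.\<close>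
lemma klein_prod_cusp:
  fixes a b c d :: int and D :: nat
  assumes det: "a * d - b * c = 1" and D: "D > 0" and L: "(\<Sum>(r, s, e)\<leftarrow>L. e) = 0"
  shows "meromorphic_at_ii_inf (\<lambda>\<tau>. klein_prod L (of_nat D * ((of_int a * \<tau> + of_int b) / (of_int c * \<tau> + of_int d))))"
proof -
  \<comment> \<open>The gcd of the first column (D a, c). Dividing by it gives a primitive column,
    which Bezout coefficients complete to a matrix of determinant 1.\<close>
  define g where "g = gcd (int D * a) c"
  have ne: "int D * a \<noteq> 0 \<or> c \<noteq> 0" using det D by auto
  then have g: "g > 0" by (auto simp: g_def)
  obtain a' c' where ac: "int D * a = a' * g" "c = c' * g" "coprime a' c'"
    using gcd_coprime_exists[of "int D * a" c] ne unfolding g_def by auto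
  obtain u v where uv: "u * a' + v * c' = 1"
    using bezout_int[of a' c'] ac(3) by (auto simp: coprime_iff_gcd_eq_1)
  \<comment> \<open>B and D' form the second column after multiplication by the inverse (u, v; -c',
    a'). Determinants give g D' = D.\<close>
  define B where "B = u * int D * b + v * d"
  define D' where "D' = a' * d - c' * int D * b"
  have "g * D' = int D * (a * d - b * c)"
    unfolding D'_def using ac by (simp add: algebra_simps)
  then have gD: "g * D' = int D" using det by simp
  then have D': "D' > 0" using g D by (metis of_nat_0_less_iff zero_less_mult_pos)
  have gauss: "int D * b = a' * B - v * D'" "d = c' * B + u * D'"
  proof -
    have "a' * B - v * D' = (u * a' + v * c') * (int D * b)" "c' * B + u * D' = (u * a' + v * c') * d"
      by (simp_all add: B_def D'_def algebra_simps)
    then show "int D * b = a' * B - v * D'" "d = c' * B + u * D'" using uv by simp_all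
  qed
  define L' where "L' = map (\<lambda>(r, s, e). (r * of_int a' + s * of_int c', r * of_int (- v) + s * of_int u, e)) L"
  have "meromorphic_at_ii_inf (\<lambda>\<tau>. klein_prod L' ((of_nat (nat g) * \<tau> + of_int B) / of_nat (nat D')))"
    unfolding klein_prod_def
  proof (rule meromorphic_at_ii_inf_prod_list)
    fix x assume "x \<in> set L'"
    obtain r s e where x: "x = (r, s, e)" by (cases x)
    have "meromorphic_at_ii_inf (\<lambda>\<tau>. klein r s ((of_nat (nat g) * \<tau> + of_int B) / of_nat (nat D')) powi e)"
      by (intro meromorphic_at_ii_inf_powi meromorphic_at_ii_inf_klein) (use g D' in simp_all)
    then show "meromorphic_at_ii_inf (\<lambda>\<tau>. case x of (r, s, e) \<Rightarrow> klein r s ((of_nat (nat g) * \<tau> + of_int B) / of_nat (nat D')) powi e)"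
      by (simp only: x prod.case)
  qed
  then show ?thesis
  proof (rule meromorphic_at_ii_inf_cong)
    fix \<tau> :: complex assume \<tau>: "Im \<tau> > 0"
    define T where "T = (of_int g * \<tau> + of_int B) / of_int D'"
    have T: "Im T > 0"
    proof -
      have "of_int D' = (of_nat (nat D') :: complex)" using D' by simp
      then show ?thesis unfolding T_def using \<tau> g D' by (simp only: Im_divide_of_nat) simp
    qed
    have gT: "of_int g * \<tau> = of_int D' * T - of_int B" using D' by (simp add: T_def)
    have n: "of_nat D * (of_int a * \<tau> + of_int b) = of_int D' * (of_int a' * T - of_int v)"
    proof -
      have "of_nat D * (of_int a * \<tau> + of_int b) = of_int (int D * a) * \<tau> + of_int (int D * b)"
        by (simp add: algebra_simps)
      also have "\<dots> = of_int a' * (of_int g * \<tau>) + of_int a' * of_int B - of_int v * of_int D'"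
        unfolding gauss(1) ac(1) by (simp add: algebra_simps)
      finally show ?thesis unfolding gT by (simp add: algebra_simps)
    qed
    have d: "of_int c * \<tau> + of_int d = of_int D' * (of_int c' * T + of_int u)"
    proof -
      have "of_int c * \<tau> + of_int d = of_int c' * (of_int g * \<tau>) + of_int c' * of_int B + of_int u * of_int D'"
        by (subst ac(2), subst gauss(2)) (simp add: algebra_simps)
      then show ?thesis unfolding gT by (simp add: algebra_simps)
    qed
    have "of_nat D * ((of_int a * \<tau> + of_int b) / (of_int c * \<tau> + of_int d)) =
        (of_int a' * T + of_int (- v)) / (of_int c' * T + of_int u)"
      unfolding times_divide_eq_right n d using D' by simp
    also have "klein_prod L \<dots> = klein_prod L' T"
      unfolding L'_def by (rule klein_prod_modular) (use uv T L in \<open>auto simp: algebra_simps\<close>)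
    finally show "klein_prod L (of_nat D * ((of_int a * \<tau> + of_int b) / (of_int c * \<tau> + of_int d))) =
        klein_prod L' ((of_nat (nat g) * \<tau> + of_int B) / of_nat (nat D'))"
      using g D' by (simp add: T_def)
  qed
qed

lemma holomorphic_klein_prod:
  assumes "open S" "f holomorphic_on S" "\<And>z. z \<in> S \<Longrightarrow> Im (f z) > 0"
    and "\<And>r s e. (r, s, e) \<in> set L \<Longrightarrow> 0 < r \<and> r < 1 \<or> 0 < s \<and> s < 1"
  shows "(\<lambda>z. klein_prod L (f z)) holomorphic_on S"
  using assms(4)
proof (induction L)
  case (Cons x L)
  obtain r s e where x: "x = (r, s, e)" by (cases x)
  have "(\<lambda>z. klein r s (f z)) holomorphic_on S" by (intro holomorphic_klein assms)
  moreover have "klein r s (f z) \<noteq> 0" if "z \<in> S" for z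
    using klein_nonzero[of "f z" r s] assms(3) Cons.prems[of r s e] that by (simp add: x)
  ultimately have "(\<lambda>z. klein r s (f z) powi e) holomorphic_on S" by (intro holomorphic_intros) auto
  moreover have "(\<lambda>z. klein_prod L (f z)) holomorphic_on S" using Cons by auto
  ultimately show ?case unfolding x klein_prod_def by (simp add: holomorphic_on_mult)
qed (simp add: klein_prod_def)

text \<open>
  An element of \<open>\<Gamma>\<^sub>1(N)\<close>, conjugated by \<open>\<tau> \<mapsto> D \<tau>\<close>, moves a point \<open>(r, s)\<close> by an even integer vector
  \<open>(m, n)\<close>, at the cost of the phase \<open>exp (\<pi>i (r n - s m))\<close>. Modulo even integers, \<open>r n - s m\<close> is
  \<open>r\<^sup>2 D b - 12 s\<^sup>2 c'\<close> with \<open>b\<close>, \<open>c'\<close> independent of the point, so that only the two sums below matter.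
\<close>
lemma modular_function_klein_prod:
  fixes D :: nat
  assumes D: "D > 0" and N: "N = 12 * D"
    and f: "\<And>\<tau>. Im \<tau> > 0 \<Longrightarrow> f \<tau> = C * klein_prod L (of_nat D * \<tau>)"
    and L: "\<forall>(r, s, e)\<in>set L. (0 < r \<and> r < 1 \<or> 0 < s \<and> s < 1) \<and> r * of_nat N / 2 \<in> \<int> \<and> s * 12 / 2 \<in> \<int> \<and>
        r * of_nat D / 2 \<in> \<int> \<and> s * of_nat N / 2 \<in> \<int> \<and> r * s * of_nat N / 2 \<in> \<int>"
    and weight: "(\<Sum>(r, s, e)\<leftarrow>L. e) = 0"
    and sum_r: "(\<Sum>(r, s, e)\<leftarrow>L. of_int e * r\<^sup>2) * of_nat D / 2 \<in> \<int>"
    and sum_s: "(\<Sum>(r, s, e)\<leftarrow>L. of_int e * s\<^sup>2) * 12 / 2 \<in> \<int>"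
  shows "modular_function (Gamma1 N) f"
  unfolding modular_function_def
proof (intro conjI ballI allI impI)
  have opn: "open {\<tau>. Im \<tau> > 0}" by (rule open_halfspace_Im_gt)
  have "(\<lambda>\<tau>. C * klein_prod L (of_nat D * \<tau>)) holomorphic_on {\<tau>. Im \<tau> > 0}"
    using D L by (intro holomorphic_intros holomorphic_klein_prod opn) (auto simp del: times_divide_eq_right)
  then have "f holomorphic_on {\<tau>. Im \<tau> > 0}"
    by (rule holomorphic_transform) (use f in auto)
  then show "f nicely_meromorphic_on {\<tau>. Im \<tau> > 0}"
    by (intro analytic_on_imp_nicely_meromorphic_on) (simp add: analytic_on_open[OF opn])
next
  fix \<gamma> \<tau> assume \<gamma>: "\<gamma> \<in> Gamma1 N" and \<tau>: "Im \<tau> > 0"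
  define a b c d where "a = \<gamma> $ 1 $ 1" and "b = \<gamma> $ 1 $ 2" and "c = \<gamma> $ 2 $ 1" and "d = \<gamma> $ 2 $ 2"
  have det: "a * d - b * c = 1" using \<gamma> by (simp add: Gamma1_def SL2Z_def det_2 a_def b_def c_def d_def)
  have "int N dvd a - 1" "int N dvd c" "int N dvd d - 1"
    using \<gamma> by (auto simp: Gamma1_def a_def c_def d_def cong_iff_dvd_diff)
  then obtain a' c' d' where "a - 1 = int N * a'" and c': "c = int N * c'" and "d - 1 = int N * d'"
    by (auto elim!: dvdE)
  then have a': "a = 1 + int N * a'" and d': "d = 1 + int N * d'" by simp_all
  define T where "T = of_nat D * \<tau>"
  have T: "Im T > 0" using \<tau> D by (simp add: T_def)
  have j: "of_int c * \<tau> + of_int d \<noteq> 0" "Im ((of_int a * \<tau> + of_int b) / (of_int c * \<tau> + of_int d)) > 0"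
    using Im_moebius_pos[OF det \<tau>] by auto
  have act: "mat_act \<gamma> \<tau> = (of_int a * \<tau> + of_int b) / (of_int c * \<tau> + of_int d)"
    by (simp add: mat_act_def moebius_def a_def b_def c_def d_def)
  \<comment> \<open>Conjugation by tau -> D tau sends (a, b; c, d) to (a, b D; c / D, d), and c / D
    = 12 c' since c = 12 D c'.\<close>
  have DT: "of_nat D * mat_act \<gamma> \<tau> = (of_int a * T + of_int (b * int D)) / (of_int (12 * c') * T + of_int d)"
  proof -
    have "of_int c * \<tau> = of_int (12 * c') * T" by (simp add: c' N T_def)
    then show ?thesis unfolding act by (simp add: T_def algebra_simps)
  qed
  have det': "a * d - (b * int D) * (12 * c') = 1" using det by (simp add: c' N algebra_simps)
  define F where "F r s = (r * of_int a + s * of_int (12 * c'), r * of_int (b * int D) + s * of_int d)" for r s :: rat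
  define \<theta> where "\<theta> r s = r\<^sup>2 * of_nat D * of_int b - 12 * s\<^sup>2 * of_int c'" for r s :: rat
  have "klein_prod L (of_nat D * mat_act \<gamma> \<tau>) = klein_prod (map (\<lambda>(r, s, e). (fst (F r s), snd (F r s), e)) L) T"
    unfolding DT klein_prod_modular[OF det' T weight] F_def fst_conv snd_conv ..
  also have "\<dots> = e2pi (of_rat (\<Sum>(r, s, e)\<leftarrow>L. of_int e * \<theta> r s) / 2) * klein_prod L T"
  proof (rule klein_prod_shift[OF T])
    fix r s e assume "(r, s, e) \<in> set L"
    with L obtain x1 x2 x3 x4 x5 :: int where x:
      "r * of_nat N / 2 = of_int x1" "s * 12 / 2 = of_int x2" "r * of_nat D / 2 = of_int x3"
      "s * of_nat N / 2 = of_int x4" "r * s * of_nat N / 2 = of_int x5"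
      by (fastforce elim!: Ints_cases)
    then have x': "r * of_nat N = 2 * of_int x1" "s * 12 = 2 * of_int x2" "r * of_nat D = 2 * of_int x3"
      "s * of_nat N = 2 * of_int x4" "r * s * of_nat N = 2 * of_int x5"
      by (simp_all add: field_simps)
    \<comment> \<open>(m, n) is (r, s) times the conjugated matrix minus the identity. The
      integrality hypotheses on (r, s) make both entries even.\<close>
    define m n where "m = 2 * (x1 * a' + x2 * c')" and "n = 2 * (x3 * b + x4 * d')"
    have m: "of_int m = (r * of_nat N) * of_int a' + (s * 12) * of_int c'"
      unfolding m_def x' by (simp add: algebra_simps)
    have n: "of_int n = (r * of_nat D) * of_int b + (s * of_nat N) * of_int d'"
      unfolding n_def x' by (simp add: algebra_simps)
    have "even m" "even n" by (simp_all add: m_def n_def)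
    moreover have "F r s = (r + of_int m, s + of_int n)"
      unfolding F_def m n a' d' by (simp add: algebra_simps)
    moreover have "r * of_int n - s * of_int m = \<theta> r s + 2 * of_int (x5 * (d' - a'))"
    proof -
      have "2 * of_int (x5 * (d' - a')) = (r * s * of_nat N) * (of_int d' - of_int a')"
        unfolding x' by simp
      then show ?thesis unfolding m n \<theta>_def by (simp add: algebra_simps power2_eq_square)
    qed
    ultimately show "\<exists>m n. even m \<and> even n \<and> F r s = (r + of_int m, s + of_int n) \<and>
        (\<exists>k::int. (r * of_int n - s * of_int m) = \<theta> r s + 2 * of_int k)" by blast
  qed
  also have "e2pi (of_rat (\<Sum>(r, s, e)\<leftarrow>L. of_int e * \<theta> r s) / 2) = 1"
  proof -
    have sum: "(\<Sum>(r, s, e)\<leftarrow>L. of_int e * \<theta> r s) =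
       (\<Sum>(r, s, e)\<leftarrow>L. of_int e * r\<^sup>2) * of_nat D * of_int b - (\<Sum>(r, s, e)\<leftarrow>L. of_int e * s\<^sup>2) * 12 * of_int c'"
      by (induction L) (auto simp: \<theta>_def algebra_simps)
    obtain k1 k2 :: int where "(\<Sum>(r, s, e)\<leftarrow>L. of_int e * r\<^sup>2) * of_nat D / 2 = of_int k1"
        "(\<Sum>(r, s, e)\<leftarrow>L. of_int e * s\<^sup>2) * 12 / 2 = of_int k2"
      using sum_r sum_s by (auto elim!: Ints_cases)
    then have k: "(\<Sum>(r, s, e)\<leftarrow>L. of_int e * r\<^sup>2) * of_nat D = 2 * of_int k1"
        "(\<Sum>(r, s, e)\<leftarrow>L. of_int e * s\<^sup>2) * 12 = 2 * of_int k2"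
      by (simp_all only: divide_eq_eq)
    have "(\<Sum>(r, s, e)\<leftarrow>L. of_int e * \<theta> r s) = 2 * of_int (k1 * b - k2 * c')"
      unfolding sum k by (simp add: algebra_simps)
    then have "of_rat (\<Sum>(r, s, e)\<leftarrow>L. of_int e * \<theta> r s) / 2 = (of_int (k1 * b - k2 * c') :: complex)"
      by (simp add: of_rat_mult of_rat_diff)
    then show ?thesis by (simp only: e2pi_of_int)
  qed
  finally show "f (mat_act \<gamma> \<tau>) = f \<tau>"
    using f[OF \<tau>] f[of "mat_act \<gamma> \<tau>"] j by (simp add: act T_def)
next
  fix \<gamma> assume "\<gamma> \<in> SL2Z"
  then have det: "\<gamma> $ 1 $ 1 * \<gamma> $ 2 $ 2 - \<gamma> $ 1 $ 2 * \<gamma> $ 2 $ 1 = 1" by (simp add: SL2Z_def det_2)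
  show "meromorphic_at_ii_inf (\<lambda>\<tau>. f (mat_act \<gamma> \<tau>))"
  proof (rule meromorphic_at_ii_inf_cong[OF meromorphic_at_ii_inf_mult[OF meromorphic_at_ii_inf_const klein_prod_cusp[OF det D weight]]])
    fix \<tau> assume "Im \<tau> > 0"
    from Im_moebius_pos(2)[OF det this]
    show "f (mat_act \<gamma> \<tau>) = C * klein_prod L (of_nat D * ((of_int (\<gamma> $ 1 $ 1) * \<tau> + of_int (\<gamma> $ 1 $ 2)) / (of_int (\<gamma> $ 2 $ 1) * \<tau> + of_int (\<gamma> $ 2 $ 2))))"
      unfolding mat_act_def moebius_def by (rule f)
  qed
qed

section \<open>The power of eta and theta quotients as products of Klein forms\<close>

lemma klein_expand:
  "klein r s T = \<i> / (2 * of_real pi) * e2pi ((of_rat r - 1) * (of_rat r * T + of_rat s) / 2) *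
     qpoch_inf (e2pi (of_rat r * T + of_rat s)) (e2pi T) * qpoch_inf (e2pi (T - (of_rat r * T + of_rat s))) (e2pi T) /
     qpoch_inf (e2pi T) (e2pi T) ^ 2"
proof -
  define z where "z = of_rat r * T + of_rat s"
  have "e2pi (of_rat r * z / 2) * e2pi (- (z / 2)) = e2pi ((of_rat r - 1) * z / 2)"
    unfolding e2pi_add[symmetric] by (rule arg_cong[of _ _ e2pi]) (simp add: field_simps)
  then show ?thesis unfolding klein_def lattice_fun_def z_def[symmetric] by simp
qed

text \<open>At a 2-torsion point the two theta factors coincide, up to the factor 2 in (-1;Q)_inf =
  2 (-Q;Q)_inf. The three squares that remain multiply to 1 by Euler's (Q;Q^2)_inf (-Q;Q)_inf =
  1.\<close>

lemma klein_2_torsion: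
  assumes "Im T > 0"
  shows "klein (1/2) 0 T * klein 0 (1/2) T * klein (1/2) (1/2) T =
     2 * (\<i> / (2 * of_real pi)) ^ 3 * e2pi (- 3 / 8) * e2pi (- T / 4) / qpoch_inf (e2pi T) (e2pi T) ^ 6"
proof -
  define Q h where "Q = e2pi T" and "h = e2pi (T / 2)"
  have Q: "norm Q < 1" using norm_e2pi_less_1[OF assms] by (simp add: Q_def)
  define q where "q = qpoch_inf Q Q"
  have q0: "q \<noteq> 0" using Q by (simp add: q_def)
  have hQ: "h\<^sup>2 = Q" by (simp add: h_def Q_def e2pi_power)
  have half: "e2pi (- (1 / 2)) = -1" by (simp add: e2pi_minus e2pi_half)
  have minus: "e2pi (T / 2 + 1 / 2) = - h" "e2pi (T - 1 / 2) = - Q" "e2pi (T - (T / 2 + 1 / 2)) = - h"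
  proof -
    have "T - (T / 2 + 1 / 2) = T / 2 + - (1 / 2)" "T - 1 / 2 = T + - (1 / 2)" by (simp_all add: field_simps)
    then show "e2pi (T - 1 / 2) = - Q" "e2pi (T - (T / 2 + 1 / 2)) = - h"
      by (simp_all only: e2pi_add half h_def Q_def) simp_all
  qed (simp add: e2pi_add e2pi_half h_def)
  have "q * qpoch_inf (- Q) Q = qpoch_inf (Q\<^sup>2) (Q\<^sup>2)" unfolding q_def by (rule qpoch_inf_minus[OF Q])
  moreover have "qpoch_inf h Q * qpoch_inf (- h) Q = qpoch_inf Q (Q\<^sup>2)" using qpoch_inf_minus[OF Q, of h] hQ by simp
  moreover have "q = qpoch_inf Q (Q\<^sup>2) * qpoch_inf (Q\<^sup>2) (Q\<^sup>2)"
    using qpoch_inf_dissect[OF Q, of 2 Q] by (simp add: q_def numeral_2_eq_2)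
  ultimately have one: "qpoch_inf h Q * qpoch_inf (- h) Q * qpoch_inf (- Q) Q = 1"
    using q0 by (metis (no_types, lifting) mult.assoc mult.commute mult_cancel_left1)
  define k where "k = \<i> / (2 * of_real pi)"
  have 1: "klein (1/2) 0 T = k * e2pi (- T / 8) * qpoch_inf h Q ^ 2 / q ^ 2"
    unfolding klein_expand k_def[symmetric] Q_def[symmetric] q_def[symmetric]
    by (simp add: of_rat_divide h_def power2_eq_square)
  have 2: "klein 0 (1/2) T = k * e2pi (- 1 / 4) * 2 * qpoch_inf (- Q) Q ^ 2 / q ^ 2"
    unfolding klein_expand k_def[symmetric] Q_def[symmetric] q_def[symmetric]
    using qpoch_inf_minus_1(2)[OF Q]
    by (simp add: of_rat_divide minus e2pi_half power2_eq_square)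
  have 3: "klein (1/2) (1/2) T = k * e2pi (- T / 8 - 1 / 8) * qpoch_inf (- h) Q ^ 2 / q ^ 2"
  proof -
    have e: "of_rat (1 / 2) * T + of_rat (1 / 2) = T / 2 + 1 / 2" "(of_rat (1 / 2) - 1) * (T / 2 + 1 / 2) / 2 = - T / 8 - 1 / 8"
      by (simp_all add: of_rat_divide field_simps)
    show ?thesis
      unfolding klein_expand e minus k_def[symmetric] Q_def[symmetric] q_def[symmetric] by (simp add: power2_eq_square)
  qed
  have "e2pi (- T / 8) * e2pi (- 1 / 4) * e2pi (- T / 8 - 1 / 8) = e2pi (- 3 / 8) * e2pi (- T / 4)"
    unfolding e2pi_add[symmetric] by (rule arg_cong[of _ _ e2pi]) (simp add: field_simps)
  moreover have "klein (1/2) 0 T * klein 0 (1/2) T * klein (1/2) (1/2) T =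
    2 * k ^ 3 * (e2pi (- T / 8) * e2pi (- 1 / 4) * e2pi (- T / 8 - 1 / 8)) *
     (qpoch_inf h Q * qpoch_inf (- h) Q * qpoch_inf (- Q) Q) ^ 2 / q ^ 6"
    unfolding 1 2 3 by (simp add: eval_nat_numeral mult_ac)
  ultimately show ?thesis unfolding one by (simp add: k_def q_def Q_def mult.assoc)
qed

text \<open>One point is taken from each pair z, -z of nonzero 3-torsion points. Multiplied by
  (Q;Q)_inf, the theta factors regroup over cube roots of unity to (Q, Q^2, Q^3; Q^3)_inf, which is
  (Q;Q)_inf again, so they contribute 1. The constant 1 - e(1/3) is the first factor of
  (w;Q)_inf.\<close>

lemma klein_3_torsion:
  assumes "Im T > 0"
  shows "klein 0 (1/3) T * klein (1/3) 0 T * klein (1/3) (1/3) T * klein (1/3) (2/3) T =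
     (1 - e2pi (1 / 3)) * (\<i> / (2 * of_real pi)) ^ 4 * e2pi (- 1 / 2) * e2pi (- T / 3) / qpoch_inf (e2pi T) (e2pi T) ^ 8"
proof -
  define Q x w where "Q = e2pi T" and "x = e2pi (T / 3)" and "w = e2pi (1 / 3)"
  have Q: "norm Q < 1" using norm_e2pi_less_1[OF assms] by (simp add: Q_def)
  define q where "q = qpoch_inf Q Q"
  have q0: "q \<noteq> 0" using Q by (simp add: q_def)
  have xQ: "x ^ 3 = Q" "(x\<^sup>2) ^ 3 = Q\<^sup>2" by (simp_all add: x_def Q_def e2pi_power)
  have w3: "w ^ 3 = 1" by (simp add: w_def e2pi_power)
  have w1: "w \<noteq> 1"
  proof
    assume "w = 1"
    then obtain n :: int where "(1 / 3 :: complex) = of_int n" unfolding w_def e2pi_eq_1_iff by (elim Ints_cases)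
    then have "(of_int (3 * n) :: complex) = of_int 1" by (simp add: field_simps)
    then have "3 * n = 1" by (simp only: of_int_eq_iff)
    then show False by presburger
  qed
  have w: "1 + w + w\<^sup>2 = 0"
  proof -
    have "(1 - w) * (1 + w + w\<^sup>2) = 1 - w ^ 3" by (simp add: algebra_simps power2_eq_square power3_eq_cube)
    then show ?thesis using w1 w3 by simp
  qed
  have winv: "e2pi (- (1 / 3)) = w\<^sup>2" "e2pi (- (2 / 3)) = w"
  proof -
    have "w * w\<^sup>2 = 1" using w3 by (simp add: power3_eq_cube power2_eq_square mult.assoc)
    moreover have "w \<noteq> 0" by (simp add: w_def)
    ultimately have "inverse w = w\<^sup>2" "inverse (w\<^sup>2) = w" by (simp_all add: field_simps)
    moreover have "e2pi (2 / 3) = w\<^sup>2" by (simp add: w_def e2pi_power)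
    ultimately show "e2pi (- (1 / 3)) = w\<^sup>2" "e2pi (- (2 / 3)) = w"
      by (simp_all add: e2pi_minus w_def)
  qed
  have w2: "e2pi (2 / 3) = w\<^sup>2" by (simp add: w_def e2pi_power)
  have x2: "e2pi (2 * T / 3) = x\<^sup>2" by (simp add: x_def e2pi_power)
  define k where "k = \<i> / (2 * of_real pi)"
  have 0: "klein 0 (1/3) T = k * e2pi (- 1 / 6) * ((1 - w) * qpoch_inf (w * Q) Q) * qpoch_inf (w\<^sup>2 * Q) Q / q ^ 2"
  proof -
    have "T - 1 / 3 = - (1 / 3) + T" by simp
    then have "e2pi (T - 1 / 3) = w\<^sup>2 * Q" by (simp only: e2pi_add winv Q_def)
    then show ?thesis
      unfolding klein_expand k_def[symmetric] Q_def[symmetric] q_def[symmetric]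
      using qpoch_inf_step[OF Q, of w] by (simp add: of_rat_divide w_def[symmetric])
  qed
  have 1: "klein (1/3) 0 T = k * e2pi (- T / 9) * qpoch_inf x Q * qpoch_inf (x\<^sup>2) Q / q ^ 2"
  proof -
    have e: "of_rat (1 / 3) * T + of_rat 0 = T / 3" "(of_rat (1 / 3) - 1) * (T / 3) / 2 = - T / 9" "T - T / 3 = 2 * T / 3"
      by (simp_all add: of_rat_divide field_simps)
    show ?thesis
      unfolding klein_expand e x2 k_def[symmetric] Q_def[symmetric] q_def[symmetric] x_def ..
  qed
  have 2: "klein (1/3) (1/3) T = k * e2pi (- T / 9 - 1 / 9) * qpoch_inf (w * x) Q * qpoch_inf (w\<^sup>2 * x\<^sup>2) Q / q ^ 2"
  proof -
    have e: "of_rat (1 / 3) * T + of_rat (1 / 3) = 1 / 3 + T / 3" "(of_rat (1 / 3) - 1) * (1 / 3 + T / 3) / 2 = - T / 9 - 1 / 9"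
      "T - (1 / 3 + T / 3) = - (1 / 3) + 2 * T / 3"
      by (simp_all add: of_rat_divide field_simps)
    show ?thesis
      unfolding klein_expand e k_def[symmetric] Q_def[symmetric] q_def[symmetric] e2pi_add x2 winv
      by (simp add: w_def x_def)
  qed
  have 3: "klein (1/3) (2/3) T = k * e2pi (- T / 9 - 2 / 9) * qpoch_inf (w\<^sup>2 * x) Q * qpoch_inf (w * x\<^sup>2) Q / q ^ 2"
  proof -
    have e: "of_rat (1 / 3) * T + of_rat (2 / 3) = 2 / 3 + T / 3" "(of_rat (1 / 3) - 1) * (2 / 3 + T / 3) / 2 = - T / 9 - 2 / 9"
      "T - (2 / 3 + T / 3) = - (2 / 3) + 2 * T / 3"
      by (simp_all add: of_rat_divide field_simps)
    show ?thesis
      unfolding klein_expand e k_def[symmetric] Q_def[symmetric] q_def[symmetric] e2pi_add x2 winv w2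
      by (simp add: x_def)
  qed
  have ex: "e2pi (- 1 / 6) * e2pi (- T / 9) * e2pi (- T / 9 - 1 / 9) * e2pi (- T / 9 - 2 / 9) = e2pi (- 1 / 2) * e2pi (- T / 3)"
    unfolding e2pi_add[symmetric] by (rule arg_cong[of _ _ e2pi]) (simp add: field_simps)
  have c0: "q * (qpoch_inf (w * Q) Q * qpoch_inf (w\<^sup>2 * Q) Q) = qpoch_inf (Q ^ 3) (Q ^ 3)"
    using qpoch_inf_cube_root[OF Q w, of Q] by (simp add: q_def mult.assoc)
  have c1: "qpoch_inf x Q * qpoch_inf (w * x) Q * qpoch_inf (w\<^sup>2 * x) Q = qpoch_inf Q (Q ^ 3)"
    using qpoch_inf_cube_root[OF Q w, of x] xQ by simp
  have c2: "qpoch_inf (x\<^sup>2) Q * qpoch_inf (w * x\<^sup>2) Q * qpoch_inf (w\<^sup>2 * x\<^sup>2) Q = qpoch_inf (Q\<^sup>2) (Q ^ 3)"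
    using qpoch_inf_cube_root[OF Q w, of "x\<^sup>2"] xQ by simp
  have c3: "q = qpoch_inf Q (Q ^ 3) * qpoch_inf (Q\<^sup>2) (Q ^ 3) * qpoch_inf (Q ^ 3) (Q ^ 3)"
    using qpoch_inf_dissect[OF Q, of 3 Q] by (simp add: q_def eval_nat_numeral mult.assoc)
  define X where "X = (qpoch_inf (w * Q) Q * qpoch_inf (w\<^sup>2 * Q) Q) * (qpoch_inf x Q * qpoch_inf (w * x) Q * qpoch_inf (w\<^sup>2 * x) Q) *
     (qpoch_inf (x\<^sup>2) Q * qpoch_inf (w * x\<^sup>2) Q * qpoch_inf (w\<^sup>2 * x\<^sup>2) Q)"
  have "q * X = q * 1"
    unfolding X_def c1 c2 using c0 c3 by (simp add: mult_ac)
  then have one: "X = 1"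
    using q0 by (simp only: mult_cancel_left) simp
  have "klein 0 (1/3) T * klein (1/3) 0 T * klein (1/3) (1/3) T * klein (1/3) (2/3) T =
    (1 - w) * k ^ 4 * (e2pi (- 1 / 6) * e2pi (- T / 9) * e2pi (- T / 9 - 1 / 9) * e2pi (- T / 9 - 2 / 9)) *
     X / q ^ 8"
    unfolding 0 1 2 3 X_def by (simp add: eval_nat_numeral mult_ac)
  then show ?thesis unfolding one ex by (simp add: k_def q_def Q_def w_def mult.assoc)
qed

text \<open>Up to a constant, the product of these Klein forms is \<open>\<eta>\<close> to the power \<open>-10\<close>.\<close>
definition eta_list :: "(rat \<times> rat \<times> int) list" where
  "eta_list = [(1/2, 0, -1), (0, 1/2, -1), (1/2, 1/2, -1), (0, 1/3, 2), (1/3, 0, 2), (1/3, 1/3, 2), (1/3, 2/3, 2)]"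

lemma klein_prod_eta_list:
  obtains K where "K \<noteq> 0"
    "\<And>T. Im T > 0 \<Longrightarrow> klein_prod eta_list T = K * e2pi (- 5 / 12 * T) / qpoch_inf (e2pi T) (e2pi T) ^ 10"
proof -
  define k where "k = \<i> / (2 * of_real pi)"
  define A where "A = 2 * k ^ 3 * e2pi (- 3 / 8)"
  define B where "B = (1 - e2pi (1 / 3)) * k ^ 4 * e2pi (- 1 / 2)"
  have k0: "k \<noteq> 0" by (simp add: k_def)
  \<comment> \<open>That the constant B is nonzero is read off at the single point tau = i, where
    Klein forms off the lattice do not vanish.\<close>
  have "klein 0 (1/3) \<i> * klein (1/3) 0 \<i> * klein (1/3) (1/3) \<i> * klein (1/3) (2/3) \<i> \<noteq> 0"
    by (simp add: klein_nonzero)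
  then have "B \<noteq> 0" using klein_3_torsion[of \<i>] by (simp add: B_def k_def)
  have "A \<noteq> 0" using k0 by (simp add: A_def)
  have "klein_prod eta_list T = (B ^ 2 / A) * e2pi (- 5 / 12 * T) / qpoch_inf (e2pi T) (e2pi T) ^ 10" if T: "Im T > 0" for T
  proof -
    define q where "q = qpoch_inf (e2pi T) (e2pi T)"
    have q: "q \<noteq> 0" using norm_e2pi_less_1[OF T] by (simp add: q_def)
    have e: "e2pi (- T / 3) ^ 2 / e2pi (- T / 4) = e2pi (- 5 / 12 * T)"
      unfolding e2pi_power e2pi_diff[symmetric] by (rule arg_cong[of _ _ e2pi]) (simp add: field_simps)
    have "klein_prod eta_list T = (klein 0 (1/3) T * klein (1/3) 0 T * klein (1/3) (1/3) T * klein (1/3) (2/3) T) ^ 2 /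
       (klein (1/2) 0 T * klein 0 (1/2) T * klein (1/2) (1/2) T)"
      by (simp add: klein_prod_def eta_list_def power_int_minus field_simps)
    also have "\<dots> = (B * e2pi (- T / 3) / q ^ 8) ^ 2 / (A * e2pi (- T / 4) / q ^ 6)"
      unfolding klein_2_torsion[OF T] klein_3_torsion[OF T] by (simp add: A_def B_def k_def q_def)
    also have "\<dots> = (B ^ 2 / A) * (e2pi (- T / 3) ^ 2 / e2pi (- T / 4)) / q ^ 10"
      using q \<open>A \<noteq> 0\<close> by (simp add: field_simps power_mult_distrib power_divide)
    finally show ?thesis unfolding e q_def .
  qed
  moreover have "B ^ 2 / A \<noteq> 0" using \<open>A \<noteq> 0\<close> \<open>B \<noteq> 0\<close> by simp
  ultimately show ?thesis using that by blast
qed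

definition theta_pair :: "nat \<Rightarrow> complex \<Rightarrow> nat \<Rightarrow> complex" where
  "theta_pair m x g = qpoch_inf (x ^ g) (x ^ m) * qpoch_inf (x ^ (m - g)) (x ^ m)"

lemma klein_prod_append: "klein_prod (L1 @ L2) T = klein_prod L1 T * klein_prod L2 T"
  by (simp add: klein_prod_def)

text \<open>With r = p / m, each form contributes the exponent (r^2 - r) / 2. The common base e(T /
  m) is used because its m-th power is the nome e(T).\<close>

lemma klein_prod_theta:
  fixes m :: nat
  assumes T: "Im T > 0" and m: "m > 0" and es: "\<And>p e. (p, e) \<in> set es \<Longrightarrow> p < m"
  shows "klein_prod (map (\<lambda>(p, e). (of_nat p / of_nat m, 0, e)) es) T =
    (\<i> / (2 * of_real pi) / qpoch_inf (e2pi T) (e2pi T) ^ 2) powi (\<Sum>(p, e)\<leftarrow>es. e) *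
    e2pi (of_rat (\<Sum>(p, e)\<leftarrow>es. of_int e * ((of_nat p / of_nat m) ^ 2 - of_nat p / of_nat m) / 2) * T) *
    (\<Prod>(p, e)\<leftarrow>es. theta_pair m (e2pi (T / of_nat m)) p powi e)"
  using es
proof (induction es)
  case (Cons y es)
  obtain p e where y: "y = (p, e)" by (cases y)
  have pm: "p < m" using Cons.prems[of p e] y by simp
  define R where "R = (of_nat p / of_nat m :: complex)"
  define c where "c = \<i> / (2 * of_real pi) / qpoch_inf (e2pi T) (e2pi T) ^ 2"
  have c: "c \<noteq> 0" using norm_e2pi_less_1[OF T] by (simp add: c_def)
  define x where "x = (of_nat p / of_nat m) ^ 2 - (of_nat p / of_nat m :: rat)"
  have xm: "e2pi (T / of_nat m) ^ m = e2pi T" using m by (simp add: e2pi_power)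
  define P where "P = theta_pair m (e2pi (T / of_nat m)) p"
  have r: "of_rat (of_nat p / of_nat m) = R" by (simp add: R_def of_rat_divide)
  have e1: "e2pi (R * T) = e2pi (T / of_nat m) ^ p" by (simp add: e2pi_power R_def)
  have e2: "e2pi (T - R * T) = e2pi (T / of_nat m) ^ (m - p)"
    unfolding e2pi_power by (rule arg_cong[of _ _ e2pi]) (use m pm in \<open>simp add: R_def of_nat_diff field_simps\<close>)
  have e3: "(R - 1) * (R * T) / 2 = of_rat x / 2 * T"
  proof -
    have "of_rat x = R ^ 2 - R" by (simp only: x_def of_rat_diff of_rat_power r)
    then show ?thesis by (simp only:) (simp add: field_simps power2_eq_square)
  qed
  have "klein (of_nat p / of_nat m) 0 T = c * e2pi (of_rat x / 2 * T) * P"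
    unfolding klein_expand r of_rat_0 add_0_right e1 e2 e3 by (simp add: c_def P_def theta_pair_def xm)
  then have k: "klein (of_nat p / of_nat m) 0 T powi e = c powi e * e2pi (of_rat (of_int e * x / 2) * T) * P powi e"
    by (simp add: power_int_mult_distrib e2pi_powi of_rat_mult of_rat_divide mult.assoc)
  have IH: "klein_prod (map (\<lambda>(p, e). (of_nat p / of_nat m, 0, e)) es) T =
    c powi (\<Sum>(p, e)\<leftarrow>es. e) *
    e2pi (of_rat (\<Sum>(p, e)\<leftarrow>es. of_int e * ((of_nat p / of_nat m) ^ 2 - of_nat p / of_nat m) / 2) * T) *
    (\<Prod>(p, e)\<leftarrow>es. theta_pair m (e2pi (T / of_nat m)) p powi e)"
    unfolding c_def by (rule Cons.IH, erule Cons.prems[OF list.set_intros(2)])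
  have 2: "e2pi (of_rat (u + v) * T) = e2pi (of_rat u * T) * e2pi (of_rat v * T)" for u v
    by (simp add: of_rat_add ring_distribs e2pi_add)
  have "klein_prod (map (\<lambda>(p, e). (of_nat p / of_nat m, 0, e)) (y # es)) T =
     klein (of_nat p / of_nat m) 0 T powi e * klein_prod (map (\<lambda>(p, e). (of_nat p / of_nat m, 0, e)) es) T"
    by (simp add: klein_prod_def y)
  then show ?case unfolding k IH unfolding c_def[symmetric] using c
    by (simp add: y 2 power_int_add P_def x_def)
qed (simp add: klein_prod_def)

lemma klein_prod_theta_eta:
  fixes m :: nat
  assumes m: "m > 0" and es: "\<forall>(p, e)\<in>set es. p < m" and sum: "(\<Sum>(p, e)\<leftarrow>es. e) = -5"
  obtains K where "K \<noteq> 0" "\<And>T. Im T > 0 \<Longrightarrow>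
    klein_prod (map (\<lambda>(p, e). (of_nat p / of_nat m, 0, e)) es @ eta_list) T =
    K * e2pi (of_rat ((\<Sum>(p, e)\<leftarrow>es. of_int e * ((of_nat p / of_nat m) ^ 2 - of_nat p / of_nat m) / 2) - 5 / 12) * T) *
    (\<Prod>(p, e)\<leftarrow>es. theta_pair m (e2pi (T / of_nat m)) p powi e)"
proof -
  obtain K where K: "K \<noteq> 0"
    "\<And>T. Im T > 0 \<Longrightarrow> klein_prod eta_list T = K * e2pi (- 5 / 12 * T) / qpoch_inf (e2pi T) (e2pi T) ^ 10"
    using klein_prod_eta_list by blast
  define k where "k = \<i> / (2 * of_real pi)"
  have k0: "k \<noteq> 0" by (simp add: k_def)
  show ?thesis
  proof (rule that[of "K / k ^ 5"])
    show "K / k ^ 5 \<noteq> 0" using K k0 by simp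
    fix T assume T: "Im T > 0"
    define q where "q = qpoch_inf (e2pi T) (e2pi T)"
    have q: "q \<noteq> 0" using norm_e2pi_less_1[OF T] by (simp add: q_def)
    \<comment> \<open>Here the exponent sum -5 meets eta^(-10): all powers of (Q;Q)_inf
      disappear.\<close>
    have kq: "(k / q ^ 2) powi (-5) / q ^ 10 = 1 / k ^ 5"
      using q k0 by (simp add: power_int_minus power_divide power_mult[symmetric])
    define s where "s = (\<Sum>(p, e)\<leftarrow>es. of_int e * ((of_nat p / of_nat m) ^ 2 - of_nat p / of_nat m) / (2::rat))"
    have e: "e2pi (of_rat (s - 5 / 12) * T) = e2pi (of_rat s * T) * e2pi (- 5 / 12 * T)"
      unfolding e2pi_add[symmetric] by (rule arg_cong[of _ _ e2pi]) (simp add: of_rat_diff of_rat_divide algebra_simps)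
    show "klein_prod (map (\<lambda>(p, e). (of_nat p / of_nat m, 0, e)) es @ eta_list) T =
      K / k ^ 5 * e2pi (of_rat ((\<Sum>(p, e)\<leftarrow>es. of_int e * ((of_nat p / of_nat m) ^ 2 - of_nat p / of_nat m) / 2) - 5 / 12) * T) *
      (\<Prod>(p, e)\<leftarrow>es. theta_pair m (e2pi (T / of_nat m)) p powi e)"
      (is "_ = _ * ?P")
    proof -
      have "klein_prod (map (\<lambda>(p, e). (of_nat p / of_nat m, 0, e)) es @ eta_list) T =
        ((k / q ^ 2) powi (-5) / q ^ 10) * K * (e2pi (of_rat s * T) * e2pi (- 5 / 12 * T)) * ?P"
        unfolding klein_prod_append K(2)[OF T]
        by (subst klein_prod_theta[OF T m], use es in fast) (simp add: sum s_def q_def k_def)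
      then show ?thesis unfolding s_def[symmetric] kq e by simp
    qed
  qed
qed

section \<open>Nahm sums as products of Klein forms\<close>

lemma nahm_exponent_eq:
  "nahm_exponent (vector [vector [1, -1], vector [-1, 2]]) (vector [u, v]) C (vector [of_nat i, of_nat j]) =
     of_nat i ^ 2 / 2 - of_nat i * of_nat j + of_nat j ^ 2 + of_nat i * u + of_nat j * v + C"
  by (simp add: nahm_exponent_def sum_2 vector_2 power2_eq_square algebra_simps)

text \<open>The step x is 1 for identities 1, 3, 4, and 1/2 for identities 2 and 5, whose Pochhammer
  symbols have base q^2, so that they are applied at q^(1/2).\<close>

lemma nahm_sum_eqI:
  assumes "((\<lambda>(i, j). qpow \<tau> x powi e i j / (qpoch (qpow \<tau> 1) (qpow \<tau> 1) i * qpoch (qpow \<tau> 1) (qpow \<tau> 1) j)) has_sum S) UNIV"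
    and "\<And>i j. nahm_exponent A B C (vector [of_nat i, of_nat j]) = x * of_int (e i j) + C"
  shows "nahm_sum A B C \<tau> = qpow \<tau> C * S"
proof -
  have "((\<lambda>n. qpow \<tau> C * (case n of (i, j) \<Rightarrow> qpow \<tau> x powi e i j / (qpoch (qpow \<tau> 1) (qpow \<tau> 1) i * qpoch (qpow \<tau> 1) (qpow \<tau> 1) j)))
      has_sum (qpow \<tau> C * S)) UNIV"
    by (rule has_sum_cmult_right[OF assms(1)])
  also have "(\<lambda>n. qpow \<tau> C * (case n of (i, j) \<Rightarrow> qpow \<tau> x powi e i j / (qpoch (qpow \<tau> 1) (qpow \<tau> 1) i * qpoch (qpow \<tau> 1) (qpow \<tau> 1) j)))
     = (\<lambda>(i, j). qpow \<tau> (nahm_exponent A B C (vector [of_nat i, of_nat j])) / (qpoch (qpow \<tau> 1) (qpow \<tau> 1) i * qpoch (qpow \<tau> 1) (qpow \<tau> 1) j))"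
    by (auto simp: fun_eq_iff assms(2) qpow_eq_e2pi e2pi_powi e2pi_add[symmetric] of_rat_add of_rat_mult algebra_simps)
  finally show ?thesis unfolding nahm_sum_def by (rule infsumI)
qed

lemma half_int_div:
  assumes "odd k"
  shows "(of_int (((int i)\<^sup>2 + k * int i) div 2) :: rat) = (of_nat i ^ 2 + of_int k * of_nat i) / 2"
proof -
  have "even ((int i)\<^sup>2 + k * int i)" using assms by simp
  then obtain l where l: "(int i)\<^sup>2 + k * int i = 2 * l" by (rule evenE)
  have "(of_int ((int i)\<^sup>2 + k * int i) :: rat) = of_nat i ^ 2 + of_int k * of_nat i" by simp
  then show ?thesis unfolding l by simp
qed

lemma denom_eqI:
  assumes "C = of_int p / of_int n" "n > 0" "u * p + v * n = 1"
  shows "denom C = n"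
proof -
  have "coprime p n"
    by (rule coprimeI) (metis assms(3) dvd_add dvd_mult)
  then show ?thesis
    using assms quotient_of_rat_of_int
    by (simp add: denom_def Fract_of_int_quotient[symmetric] quotient_of_Fract Rat.normalize_def coprime_iff_gcd_eq_1)
qed

section \<open>Infinite products modulo 8 and 16\<close>

context
  fixes q :: complex
  assumes q: "norm q < 1"
begin

lemma qpoch_inf_q4_mod_8:
  "qpoch_inf (q^4) (q^4) = qpoch_inf (q^4) (q^8) * qpoch_inf (q^8) (q^8)"
  using qpoch_inf_dissect[OF norm_power_less_1[OF q, of 4], of 2 "q^4"]
  by (simp add: numeral_2_eq_2 power_add[symmetric] power_mult[symmetric])

lemma qpoch_inf_q2_mod_8:
  "qpoch_inf (q^2) (q^2) = theta_pair 8 q 2 * qpoch_inf (q^4) (q^4)"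
proof -
  have "{..<4::nat} = {0, 1, 2, 3}" by auto
  moreover have "q ^ 2 * (q ^ 2) ^ r = q ^ (2 + 2 * r)" for r by (simp only: power_add power_mult)
  ultimately show ?thesis
    using qpoch_inf_dissect[OF norm_power_less_1[OF q, of 2], of 4 "q^2"]
    by (simp add: power_mult[symmetric] qpoch_inf_q4_mod_8 theta_pair_def mult_ac)
qed

lemma qpoch_inf_q_mod_8:
  "qpoch_inf q q = theta_pair 8 q 1 * theta_pair 8 q 3 * qpoch_inf (q^2) (q^2)"
proof -
  have "{..<8::nat} = {0, 1, 2, 3, 4, 5, 6, 7}" by auto
  then show ?thesis
    using qpoch_inf_dissect[OF q, of 8 q]
    by (simp add: qpoch_inf_q4_mod_8 qpoch_inf_q2_mod_8 theta_pair_def mult_ac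
          power_Suc[symmetric] numeral_2_eq_2[symmetric] del: power_Suc)
qed

lemma qpoch_inf_mod_16:
  "qpoch_inf (q ^ k) (q ^ 8) = qpoch_inf (q ^ k) (q ^ 16) * qpoch_inf (q ^ (k + 8)) (q ^ 16)"
  using qpoch_inf_dissect[OF norm_power_less_1[OF q, of 8], of 2 "q ^ k"]
  by (simp add: numeral_2_eq_2 power_add[symmetric] power_mult[symmetric])

lemma theta_pair_nonzero: "g \<in> {1, 2, 3} \<Longrightarrow> theta_pair 8 q g \<noteq> 0"
  using qpoch_inf_nonzero_power[OF q, of _ 8] by (auto simp: theta_pair_def)

lemma eta_quotient_theta_pair_a:
  "qpoch_inf (q^2) (q^2) ^ 4 / (qpoch_inf q q ^ 3 * qpoch_inf (q^4) (q^4)) =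
   theta_pair 8 q 2 * inverse (theta_pair 8 q 1 ^ 3) * inverse (theta_pair 8 q 3 ^ 3)"
proof -
  have "(u * v) ^ 4 / ((x * y * (u * v)) ^ 3 * v) = u * inverse (x ^ 3) * inverse (y ^ 3)"
    if "x \<noteq> 0" "y \<noteq> 0" "u \<noteq> 0" "v \<noteq> 0" for x y u v :: complex
    using that by (simp add: field_simps eval_nat_numeral)
  then show ?thesis
    unfolding qpoch_inf_q_mod_8 qpoch_inf_q2_mod_8
    using theta_pair_nonzero qpoch_inf_nonzero_power[OF q, of 4 4] by simp
qed

lemma eta_quotient_theta_pair_b:
  "qpoch_inf (q^2) (q^2) * qpoch_inf (q^4) (q^4) / qpoch_inf q q ^ 2 =
   inverse (theta_pair 8 q 1 ^ 2) * inverse (theta_pair 8 q 3 ^ 2) * inverse (theta_pair 8 q 2)"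
proof -
  have "(u * v) * v / (x * y * (u * v)) ^ 2 = inverse (x ^ 2) * inverse (y ^ 2) * inverse u"
    if "x \<noteq> 0" "y \<noteq> 0" "u \<noteq> 0" "v \<noteq> 0" for x y u v :: complex
    using that by (simp add: field_simps eval_nat_numeral)
  then show ?thesis
    unfolding qpoch_inf_q_mod_8 qpoch_inf_q2_mod_8
    using theta_pair_nonzero qpoch_inf_nonzero_power[OF q, of 4 4] by simp
qed

text \<open>Here (q^4;q^8)_inf survives. Residue 4 is its own partner modulo 8, so this is only half
  of a theta pair; modulo 16 it becomes the pair of 4 and 12. Therefore identities 2 and 5 are
  treated with m = 16.\<close>

lemma eta_quotient_theta_pair_c:
  "qpoch_inf (q^2) (q^2) ^ 3 * (t * qpoch_inf (q^8) (q^8)) / (qpoch_inf q q ^ 2 * qpoch_inf (q^4) (q^4) ^ 2) =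
   t * theta_pair 8 q 2 * inverse (theta_pair 8 q 1 ^ 2) * inverse (theta_pair 8 q 3 ^ 2) * inverse (qpoch_inf (q^4) (q^8))"
proof -
  have "(u * (a * b)) ^ 3 * (t * b) / ((x * y * (u * (a * b))) ^ 2 * (a * b) ^ 2) =
      t * u * inverse (x ^ 2) * inverse (y ^ 2) * inverse a"
    if "x \<noteq> 0" "y \<noteq> 0" "u \<noteq> 0" "a \<noteq> 0" "b \<noteq> 0" for x y u a b :: complex
    using that by (simp add: field_simps eval_nat_numeral)
  then show ?thesis
    unfolding qpoch_inf_q_mod_8 qpoch_inf_q2_mod_8 qpoch_inf_q4_mod_8
    using theta_pair_nonzero qpoch_inf_nonzero_power[OF q, of 4 8] qpoch_inf_nonzero_power[OF q, of 8 8] by simp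
qed

end

section \<open>Modularity of the five Nahm sums\<close>

lemma qpow_add: "qpow \<tau> (x + y) = qpow \<tau> x * qpow \<tau> y"
  by (simp add: qpow_eq_e2pi of_rat_add ring_distribs e2pi_add)

lemma norm_qpow_less_1: "Im \<tau> > 0 \<Longrightarrow> x > 0 \<Longrightarrow> norm (qpow \<tau> x) < 1"
  unfolding qpow_eq_e2pi by (intro norm_e2pi_less_1) (simp add: of_rat_eq_of_real)

lemma qpow_nonzero [simp]: "qpow \<tau> x \<noteq> 0"
  by (simp add: qpow_eq_e2pi)

definition klein_list :: "nat \<Rightarrow> (nat \<times> int) list \<Rightarrow> (rat \<times> rat \<times> int) list" where
  "klein_list m es = map (\<lambda>(p, e). (of_nat p / of_nat m, 0, e)) es @ eta_list"

text \<open>The equation for E matches powers: at T = 8 \<tau> the Klein product carries q^E, as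
  does the Nahm sum. Replacing q by its \<open>denom C\<close>-th power turns 8 \<tau> into 8
  \<delta> \<tau>, hence D = 8 \<delta> and N = 12 D. The other conditions are rational arithmetic
  on an explicit list.\<close>

lemma Gamma1_modular_nahm_sum:
  assumes \<delta>: "denom C = int \<delta>" "\<delta> > 0" "N = 96 * \<delta>"
    and nahm: "\<And>\<tau>. Im \<tau> > 0 \<Longrightarrow> nahm_sum A B C \<tau> = c * qpow \<tau> E * (\<Prod>(p, e)\<leftarrow>es. theta_pair m (qpow \<tau> (8 / of_nat m)) p powi e)"
    and m: "m > 0" "\<forall>(p, e)\<in>set es. p < m" and sum: "(\<Sum>(p, e)\<leftarrow>es. e) = -5"
    and E: "(\<Sum>(p, e)\<leftarrow>es. of_int e * ((of_nat p / of_nat m) ^ 2 - of_nat p / of_nat m) / 2) - 5 / 12 = E / 8"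
    and L: "\<forall>(r, s, e)\<in>set (klein_list m es). (0 < r \<and> r < 1 \<or> 0 < s \<and> s < 1) \<and> r * of_nat N / 2 \<in> \<int> \<and> s * 12 / 2 \<in> \<int> \<and>
        r * of_nat (8 * \<delta>) / 2 \<in> \<int> \<and> s * of_nat N / 2 \<in> \<int> \<and> r * s * of_nat N / 2 \<in> \<int>"
    and "(\<Sum>(r, s, e)\<leftarrow>klein_list m es. e) = 0"
    and "(\<Sum>(r, s, e)\<leftarrow>klein_list m es. of_int e * r\<^sup>2) * of_nat (8 * \<delta>) / 2 \<in> \<int>"
    and "(\<Sum>(r, s, e)\<leftarrow>klein_list m es. of_int e * s\<^sup>2) * 12 / 2 \<in> \<int>"
  shows "modular_function (Gamma1 N) (\<lambda>\<tau>. nahm_sum A B C (of_int (denom C) * \<tau>))"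
proof -
  obtain K where K: "K \<noteq> 0" "\<And>T. Im T > 0 \<Longrightarrow> klein_prod (klein_list m es) T =
    K * e2pi (of_rat (E / 8) * T) * (\<Prod>(p, e)\<leftarrow>es. theta_pair m (e2pi (T / of_nat m)) p powi e)"
    using klein_prod_theta_eta[OF m sum] unfolding E klein_list_def by auto
  have nahm': "nahm_sum A B C \<tau> = c / K * klein_prod (klein_list m es) (8 * \<tau>)" if \<tau>: "Im \<tau> > 0" for \<tau>
  proof -
    have "e2pi (8 * \<tau> / of_nat m) = qpow \<tau> (8 / of_nat m)" "e2pi (of_rat (E / 8) * (8 * \<tau>)) = qpow \<tau> E"
      by (simp_all add: qpow_eq_e2pi of_rat_divide)
    then show ?thesis using K(1) K(2)[of "8 * \<tau>"] nahm[OF \<tau>] \<tau> by simp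
  qed
  show ?thesis
  proof (rule modular_function_klein_prod[of "8 * \<delta>" N _ "c / K" "klein_list m es"])
    fix \<tau> :: complex assume "Im \<tau> > 0"
    then have "Im (of_nat \<delta> * \<tau>) > 0" using \<delta> by simp
    from nahm'[OF this] show "nahm_sum A B C (of_int (denom C) * \<tau>) = c / K * klein_prod (klein_list m es) (of_nat (8 * \<delta>) * \<tau>)"
      by (simp add: \<delta> mult.assoc)
  next
    show "0 < 8 * \<delta>" "N = 12 * (8 * \<delta>)" using \<delta> by simp_all
  qed fact+
qed

abbreviation (input) nahm_matrix :: "rat^2^2" where
  "nahm_matrix \<equiv> vector [vector [1, -1], vector [-1, 2]]"

lemma nahm_sum_modular_1:
  "modular_function (Gamma1 2304) (\<lambda>\<tau>. nahm_sum nahm_matrix (vector [-3/2, 2]) (25/24) (of_int (denom (25/24)) * \<tau>))"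
proof (rule Gamma1_modular_nahm_sum[where \<delta> = 24 and m = 8 and c = 2 and E = "1/24" and es = "[(2, 1), (1, -3), (3, -3)]"])
  fix \<tau> :: complex assume \<tau>: "Im \<tau> > 0"
  define q where "q = qpow \<tau> 1"
  have q: "norm q < 1" "q \<noteq> 0" using norm_qpow_less_1[OF \<tau>, of 1] by (simp_all add: q_def)
  have half: "(of_int (((int i)\<^sup>2 - 3 * int i) div 2) :: rat) = (of_nat i ^ 2 - 3 * of_nat i) / 2" for i
    using half_int_div[of "-3" i] by simp
  have "nahm_sum nahm_matrix (vector [-3/2, 2]) (25/24) \<tau> = qpow \<tau> (25/24) *
      (2 * inverse q * (qpoch_inf (q^2) (q^2) ^ 4 / (qpoch_inf q q ^ 3 * qpoch_inf (q^4) (q^4))))"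
    using identity_1[OF q] unfolding q_def
    by (rule nahm_sum_eqI) (simp add: nahm_exponent_eq half)
  \<comment> \<open>The factor 1/q of the first identity lowers 25/24 to 1/24, so this sum is twice
    the one for C = 1/24 and has the same list of exponents.\<close>
  also have "qpow \<tau> (25 / 24) = qpow \<tau> (1 / 24) * q"
    using qpow_add[of \<tau> "1/24" 1] by (simp add: q_def)
  finally show "nahm_sum nahm_matrix (vector [-3/2, 2]) (25/24) \<tau> =
      2 * qpow \<tau> (1/24) * (\<Prod>(p, e)\<leftarrow>[(2, 1), (1, -3), (3, -3)]. theta_pair 8 (qpow \<tau> (8 / of_nat 8)) p powi e)"
    unfolding eta_quotient_theta_pair_a[OF q(1)] using q by (simp add: power_int_minus q_def)
next
  show "denom (25/24) = int 24" by (rule denom_eqI[of _ 25 _ "1" "-1"]) auto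
qed (simp_all add: klein_list_def eta_list_def power2_eq_square)

lemma nahm_sum_modular_2:
  "modular_function (Gamma1 9216) (\<lambda>\<tau>. nahm_sum nahm_matrix (vector [0, 0]) (-5/96) (of_int (denom (-5/96)) * \<tau>))"
proof (rule Gamma1_modular_nahm_sum[where \<delta> = 96 and m = 16 and c = 1 and E = "-5/96" and es = "[(2, 1), (6, 1), (1, -2), (7, -2), (3, -1), (5, -1), (4, -1)]"])
  fix \<tau> :: complex assume \<tau>: "Im \<tau> > 0"
  \<comment> \<open>The square root of the nome: identity 2 is applied to it, and modulus 16 in this
    variable is q^8 in the original one.\<close>
  define q where "q = qpow \<tau> (1 / 2)"
  have q: "norm q < 1" "q \<noteq> 0" using norm_qpow_less_1[OF \<tau>, of "1 / 2"] by (simp_all add: q_def)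
  have q2: "qpow \<tau> 1 = q ^ 2" by (simp add: q_def qpow_power)
  have "nahm_sum nahm_matrix (vector [0, 0]) (-5/96) \<tau> = qpow \<tau> (-5/96) * (qpoch_inf (q^2) (q^2) ^ 3 * (qpoch_inf (q^3) (q^8) * qpoch_inf (q^5) (q^8) * qpoch_inf (q^8) (q^8))
      / (qpoch_inf q q ^ 2 * qpoch_inf (q^4) (q^4) ^ 2))"
    using identity_2[OF q(1)] unfolding q2[symmetric] unfolding q_def
    by (rule nahm_sum_eqI) (simp add: nahm_exponent_eq field_simps)
  then show "nahm_sum nahm_matrix (vector [0, 0]) (-5/96) \<tau> =
      1 * qpow \<tau> (-5/96) * (\<Prod>(p, e)\<leftarrow>[(2, 1), (6, 1), (1, -2), (7, -2), (3, -1), (5, -1), (4, -1)]. theta_pair 16 (qpow \<tau> (8 / of_nat 16)) p powi e)"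
    unfolding eta_quotient_theta_pair_c[OF q(1)]
    \<comment> \<open>The instance at exponent 1 is given separately because q ^ 1 appears
      simplified to q and no longer matches the general rule.\<close>
    using q qpoch_inf_mod_16[OF q(1), of 1] qpoch_inf_nonzero_power[OF q(1), of _ 16]
    by (simp add: power_int_minus q_def[symmetric] theta_pair_def qpoch_inf_mod_16[OF q(1)])
      (simp add: divide_simps power_mult_distrib power2_eq_square)
next
  show "denom (-5/96) = int 96" by (rule denom_eqI[of _ "-5" _ "19" "1"]) auto
qed (simp_all add: klein_list_def eta_list_def power2_eq_square)

lemma nahm_sum_modular_3:
  "modular_function (Gamma1 576) (\<lambda>\<tau>. nahm_sum nahm_matrix (vector [-1/2, 1]) (1/6) (of_int (denom (1/6)) * \<tau>))"
proof (rule Gamma1_modular_nahm_sum[where \<delta> = 6 and m = 8 and c = 2 and E = "1/6" and es = "[(1, -2), (3, -2), (2, -1)]"])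
  fix \<tau> :: complex assume \<tau>: "Im \<tau> > 0"
  define q where "q = qpow \<tau> 1"
  have q: "norm q < 1" "q \<noteq> 0" using norm_qpow_less_1[OF \<tau>, of 1] by (simp_all add: q_def)
  have half: "(of_int (((int i)\<^sup>2 - int i) div 2) :: rat) = (of_nat i ^ 2 - of_nat i) / 2" for i
    using half_int_div[of "-1" i] by simp
  have "nahm_sum nahm_matrix (vector [-1/2, 1]) (1/6) \<tau> = qpow \<tau> (1/6) *
      (2 * (qpoch_inf (q^2) (q^2) * qpoch_inf (q^4) (q^4) / qpoch_inf q q ^ 2))"
    using identity_3[OF q(1)] unfolding q_def
    by (rule nahm_sum_eqI) (simp add: nahm_exponent_eq half)
  then show "nahm_sum nahm_matrix (vector [-1/2, 1]) (1/6) \<tau> =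
      2 * qpow \<tau> (1/6) * (\<Prod>(p, e)\<leftarrow>[(1, -2), (3, -2), (2, -1)]. theta_pair 8 (qpow \<tau> (8 / of_nat 8)) p powi e)"
    unfolding eta_quotient_theta_pair_b[OF q(1)] using q by (simp add: power_int_minus q_def)
next
  show "denom (1/6) = int 6" by (rule denom_eqI[of _ 1 _ "1" "0"]) auto
qed (simp_all add: klein_list_def eta_list_def power2_eq_square)

lemma nahm_sum_modular_4:
  "modular_function (Gamma1 2304) (\<lambda>\<tau>. nahm_sum nahm_matrix (vector [1/2, 0]) (1/24) (of_int (denom (1/24)) * \<tau>))"
proof (rule Gamma1_modular_nahm_sum[where \<delta> = 24 and m = 8 and c = 1 and E = "1/24" and es = "[(2, 1), (1, -3), (3, -3)]"])
  fix \<tau> :: complex assume \<tau>: "Im \<tau> > 0"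
  define q where "q = qpow \<tau> 1"
  have q: "norm q < 1" "q \<noteq> 0" using norm_qpow_less_1[OF \<tau>, of 1] by (simp_all add: q_def)
  have half: "(of_int (((int i)\<^sup>2 + int i) div 2) :: rat) = (of_nat i ^ 2 + of_nat i) / 2" for i
    using half_int_div[of "1" i] by simp
  have "nahm_sum nahm_matrix (vector [1/2, 0]) (1/24) \<tau> = qpow \<tau> (1/24) *
      (qpoch_inf (q^2) (q^2) ^ 4 / (qpoch_inf q q ^ 3 * qpoch_inf (q^4) (q^4)))"
    using identity_4[OF q(1)] unfolding q_def
    by (rule nahm_sum_eqI) (simp add: nahm_exponent_eq half)
  then show "nahm_sum nahm_matrix (vector [1/2, 0]) (1/24) \<tau> =
      1 * qpow \<tau> (1/24) * (\<Prod>(p, e)\<leftarrow>[(2, 1), (1, -3), (3, -3)]. theta_pair 8 (qpow \<tau> (8 / of_nat 8)) p powi e)"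
    unfolding eta_quotient_theta_pair_a[OF q(1)] using q by (simp add: power_int_minus q_def)
next
  show "denom (1/24) = int 24" by (rule denom_eqI[of _ 1 _ "1" "0"]) auto
qed (simp_all add: klein_list_def eta_list_def power2_eq_square)

lemma nahm_sum_modular_5:
  "modular_function (Gamma1 9216) (\<lambda>\<tau>. nahm_sum nahm_matrix (vector [0, 1]) (19/96) (of_int (denom (19/96)) * \<tau>))"
proof (rule Gamma1_modular_nahm_sum[where \<delta> = 96 and m = 16 and c = 1 and E = "19/96" and es = "[(2, 1), (6, 1), (1, -1), (7, -1), (3, -2), (5, -2), (4, -1)]"])
  fix \<tau> :: complex assume \<tau>: "Im \<tau> > 0"
  define q where "q = qpow \<tau> (1 / 2)"
  have q: "norm q < 1" "q \<noteq> 0" using norm_qpow_less_1[OF \<tau>, of "1 / 2"] by (simp_all add: q_def)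
  have q2: "qpow \<tau> 1 = q ^ 2" by (simp add: q_def qpow_power)
  have "nahm_sum nahm_matrix (vector [0, 1]) (19/96) \<tau> = qpow \<tau> (19/96) * (qpoch_inf (q^2) (q^2) ^ 3 * (qpoch_inf q (q^8) * qpoch_inf (q^7) (q^8) * qpoch_inf (q^8) (q^8))
      / (qpoch_inf q q ^ 2 * qpoch_inf (q^4) (q^4) ^ 2))"
    using identity_5[OF q(1)] unfolding q2[symmetric] unfolding q_def
    by (rule nahm_sum_eqI) (simp add: nahm_exponent_eq field_simps)
  then show "nahm_sum nahm_matrix (vector [0, 1]) (19/96) \<tau> =
      1 * qpow \<tau> (19/96) * (\<Prod>(p, e)\<leftarrow>[(2, 1), (6, 1), (1, -1), (7, -1), (3, -2), (5, -2), (4, -1)]. theta_pair 16 (qpow \<tau> (8 / of_nat 16)) p powi e)"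
    unfolding eta_quotient_theta_pair_c[OF q(1)]
    using q qpoch_inf_mod_16[OF q(1), of 1] qpoch_inf_nonzero_power[OF q(1), of _ 16]
    by (simp add: power_int_minus q_def[symmetric] theta_pair_def qpoch_inf_mod_16[OF q(1)])
      (simp add: divide_simps power_mult_distrib power2_eq_square)
next
  show "denom (19/96) = int 96" by (rule denom_eqI[of _ "19" _ "-5" "1"]) auto
qed (simp_all add: klein_list_def eta_list_def power2_eq_square)

theorem theorem3p3:
  shows
    "(\<forall>q::complex. norm q < 1 \<longrightarrow>
       (q \<noteq> 0 \<longrightarrow>
         ((\<lambda>(i, j). q powi (((int i)\<^sup>2 - 3 * int i) div 2 - int i * int j + (int j)\<^sup>2 + 2 * int j)
             / (qpoch q q i * qpoch q q j))
          has_sum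
            (2 * inverse q * (qpoch_inf (q^2) (q^2) ^ 4
              / (qpoch_inf q q ^ 3 * qpoch_inf (q^4) (q^4))))) (UNIV :: (nat \<times> nat) set)) \<and>
       ((\<lambda>(i, j). q powi ((int i)\<^sup>2 - 2 * int i * int j + 2 * (int j)\<^sup>2)
           / (qpoch (q^2) (q^2) i * qpoch (q^2) (q^2) j))
        has_sum
          (qpoch_inf (q^2) (q^2) ^ 3
            * (qpoch_inf (q^3) (q^8) * qpoch_inf (q^5) (q^8) * qpoch_inf (q^8) (q^8))
            / (qpoch_inf q q ^ 2 * qpoch_inf (q^4) (q^4) ^ 2))) (UNIV :: (nat \<times> nat) set) \<and>
       ((\<lambda>(i, j). q powi (((int i)\<^sup>2 - int i) div 2 - int i * int j + (int j)\<^sup>2 + int j)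
           / (qpoch q q i * qpoch q q j))
        has_sum
          (2 * (qpoch_inf (q^2) (q^2) * qpoch_inf (q^4) (q^4) / qpoch_inf q q ^ 2)))
          (UNIV :: (nat \<times> nat) set) \<and>
       ((\<lambda>(i, j). q powi (((int i)\<^sup>2 + int i) div 2 - int i * int j + (int j)\<^sup>2)
           / (qpoch q q i * qpoch q q j))
        has_sum
          (qpoch_inf (q^2) (q^2) ^ 4 / (qpoch_inf q q ^ 3 * qpoch_inf (q^4) (q^4))))
          (UNIV :: (nat \<times> nat) set) \<and>
       ((\<lambda>(i, j). q powi ((int i)\<^sup>2 - 2 * int i * int j + 2 * (int j)\<^sup>2 + 2 * int j)
           / (qpoch (q^2) (q^2) i * qpoch (q^2) (q^2) j))
        has_sum
          (qpoch_inf (q^2) (q^2) ^ 3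
            * (qpoch_inf q (q^8) * qpoch_inf (q^7) (q^8) * qpoch_inf (q^8) (q^8))
            / (qpoch_inf q q ^ 2 * qpoch_inf (q^4) (q^4) ^ 2))) (UNIV :: (nat \<times> nat) set))
     \<and>
     (\<forall>(B, C, N) \<in> {(vector [-3/2, 2], 25/24, 2304),
                     (vector [0, 0], -5/96, 9216),
                     (vector [-1/2, 1], 1/6, 576),
                     (vector [1/2, 0], 1/24, 2304),
                     (vector [0, 1], 19/96, 9216)}.
        modular_function (Gamma1 N)
          (\<lambda>\<tau>. nahm_sum (vector [vector [1, -1], vector [-1, 2]]) B C (of_int (denom C) * \<tau>)))"
proof (intro conjI)
  show "\<forall>(B, C, N) \<in> {(vector [-3/2, 2], 25/24, 2304),
                     (vector [0, 0], -5/96, 9216),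
                     (vector [-1/2, 1], 1/6, 576),
                     (vector [1/2, 0], 1/24, 2304),
                     (vector [0, 1], 19/96, 9216)}.
        modular_function (Gamma1 N)
          (\<lambda>\<tau>. nahm_sum (vector [vector [1, -1], vector [-1, 2]]) B C (of_int (denom C) * \<tau>))"
    using nahm_sum_modular_1 nahm_sum_modular_2 nahm_sum_modular_3 nahm_sum_modular_4 nahm_sum_modular_5
    by blast
qed (intro allI impI conjI identity_1 identity_2 identity_3 identity_4 identity_5; assumption)

end
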